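(* $\mathsf{IGMP}$ implies the singular cardinal hypothesis $\mathsf{SCH}$.
   Context: $H(\theta)$ is the collection of sets of hereditary cardinality less than $\theta$, and $P_{\omega_2}(X)=\{a\subseteq X: |a|<\omega_2\}$. For a set $N$, a set $d\subseteq N$ is countably approximated by $N$ if for every $a\in N$ which $N$ models is countable, $d\cap a\in N$. A set $d\subseteq N$ is $N$-guessed if there is $e\in N$ with $d=e\cap N$. $N$ is $\omega_1$-guessing if every $d\subseteq N\cap \mathrm{On}$ with $\sup(d)<\sup(N\cap\mathrm{On})$ which is countably approximated by $N$ is $N$-guessed. $N$ is indestructibly $\omega_1$-guessing if every forcing poset which preserves $\omega_1$ forces that $N$ is $\omega_1$-guessing. For a cardinal $\theta\ge\omega_2$, $\mathsf{IGMP}(\theta)$ says that there are stationarily many $N\in P_{\omega_2}(H(\theta))$ which are indestructibly $\omega_1$-guessing. $\mathsf{IGMP}$ says that $\mathsf{IGMP}(\theta)$ holds for all cardinals $\theta\ge\omega_2$. *)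

theory Defs
  imports Main
begin

unbundle cardinal_syntax

section \<open>The universe of sets\<close>

text \<open>
  A type of class \<open>zfc\<close> is a universe of sets, where \<open>elts x\<close> is the extension of \<open>x\<close>. As in the
  AFP entry \<open>ZFC_in_HOL\<close>, Separation and Replacement range over arbitrary HOL predicates and
  functions. The axiom of choice then follows from Hilbert choice.
\<close>

class zfc =
  fixes elts :: "'a \<Rightarrow> 'a set"
  assumes extensionality: "elts x = elts y \<Longrightarrow> x = y"
    and foundation: "wf {(x, y). x \<in> elts y}"
    and pairing: "\<exists>z. elts z = {x, y}"
    and union: "\<exists>u. elts u = (\<Union>y\<in>elts x. elts y)"
    and powerset: "\<exists>p. elts p = {y. elts y \<subseteq> elts x}"
    and infinity: "\<exists>w. (\<exists>z\<in>elts w. elts z = {}) \<and>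
                       (\<forall>x\<in>elts w. \<exists>y\<in>elts w. elts y = insert x (elts x))"
    and separation: "\<exists>y. elts y = {z \<in> elts x. P z}"
    and replacement: "\<exists>y. elts y = f ` elts x"

text \<open>Meaningful only if some set has extension \<open>A\<close>, i.e. if \<open>A\<close> is not a proper class.\<close>

definition vset :: "'v::zfc set \<Rightarrow> 'v" where
  "vset A = (THE x. elts x = A)"

definition opair :: "'v::zfc \<Rightarrow> 'v \<Rightarrow> 'v" where
  "opair x y = vset {vset {x}, vset {x, y}}"


section \<open>Set-theoretic formulas\<close>

text \<open>
  The formulas below have to be read in three ways: in the universe, relativised to a set \<open>N\<close>
  (``\<open>N\<close> models \dots''), and in forcing extensions. They are therefore written once, over an
  arbitrary type \<open>'t\<close> of truth values and arbitrary interpretations of the atomic formulas,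
  negation, conjunction and the universal quantifier.
\<close>

locale formulas =
  fixes Mem :: "'u \<Rightarrow> 'u \<Rightarrow> 't"  (infix "\<^bold>\<in>" 50)
    and Eq :: "'u \<Rightarrow> 'u \<Rightarrow> 't"  (infix "\<^bold>=" 50)
    and Neg :: "'t \<Rightarrow> 't"  ("\<^bold>\<not> _" [40] 40)
    and Conj :: "'t \<Rightarrow> 't \<Rightarrow> 't"  (infixr "\<^bold>\<and>" 35)
    and All :: "('u \<Rightarrow> 't) \<Rightarrow> 't"  (binder "\<^bold>\<forall>" 10)
begin

definition Disj :: "'t \<Rightarrow> 't \<Rightarrow> 't"  (infixr "\<^bold>\<or>" 30) where
  "A \<^bold>\<or> B \<equiv> (\<^bold>\<not> (\<^bold>\<not> A \<^bold>\<and> \<^bold>\<not> B))"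

definition Imp :: "'t \<Rightarrow> 't \<Rightarrow> 't"  (infixr "\<^bold>\<longrightarrow>" 25) where
  "A \<^bold>\<longrightarrow> B \<equiv> (\<^bold>\<not> (A \<^bold>\<and> \<^bold>\<not> B))"

definition Iff :: "'t \<Rightarrow> 't \<Rightarrow> 't"  (infixr "\<^bold>\<longleftrightarrow>" 25) where
  "A \<^bold>\<longleftrightarrow> B \<equiv> ((A \<^bold>\<longrightarrow> B) \<^bold>\<and> (B \<^bold>\<longrightarrow> A))"

definition Ex :: "('u \<Rightarrow> 't) \<Rightarrow> 't"  (binder "\<^bold>\<exists>" 10) where
  "(\<^bold>\<exists>x. F x) \<equiv> (\<^bold>\<not> (\<^bold>\<forall>x. \<^bold>\<not> F x))"

definition Sub :: "'u \<Rightarrow> 'u \<Rightarrow> 't"  (infix "\<^bold>\<subseteq>" 50) where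
  "x \<^bold>\<subseteq> y \<equiv> (\<^bold>\<forall>z. z \<^bold>\<in> x \<^bold>\<longrightarrow> z \<^bold>\<in> y)"

definition is_inter :: "'u \<Rightarrow> 'u \<Rightarrow> 'u \<Rightarrow> 't" where
  "is_inter b x y \<equiv> (\<^bold>\<forall>z. z \<^bold>\<in> b \<^bold>\<longleftrightarrow> z \<^bold>\<in> x \<^bold>\<and> z \<^bold>\<in> y)"

definition is_upair :: "'u \<Rightarrow> 'u \<Rightarrow> 'u \<Rightarrow> 't" where
  "is_upair u x y \<equiv> (\<^bold>\<forall>z. z \<^bold>\<in> u \<^bold>\<longleftrightarrow> z \<^bold>= x \<^bold>\<or> z \<^bold>= y)"

definition is_opair :: "'u \<Rightarrow> 'u \<Rightarrow> 'u \<Rightarrow> 't" where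
  "is_opair u x y \<equiv> (\<^bold>\<exists>a. \<^bold>\<exists>b. is_upair a x x \<^bold>\<and> is_upair b x y \<^bold>\<and> is_upair u a b)"

definition pair_in :: "'u \<Rightarrow> 'u \<Rightarrow> 'u \<Rightarrow> 't" where
  "pair_in x y f \<equiv> (\<^bold>\<exists>u. is_opair u x y \<^bold>\<and> u \<^bold>\<in> f)"

definition is_injection :: "'u \<Rightarrow> 'u \<Rightarrow> 'u \<Rightarrow> 't" where
  "is_injection f a b \<equiv>
    ((\<^bold>\<forall>u. u \<^bold>\<in> f \<^bold>\<longrightarrow> (\<^bold>\<exists>x. \<^bold>\<exists>y. x \<^bold>\<in> a \<^bold>\<and> y \<^bold>\<in> b \<^bold>\<and> is_opair u x y)) \<^bold>\<and>
     (\<^bold>\<forall>x. x \<^bold>\<in> a \<^bold>\<longrightarrow> (\<^bold>\<exists>y. pair_in x y f)) \<^bold>\<and>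
     (\<^bold>\<forall>x. \<^bold>\<forall>y. \<^bold>\<forall>y'. pair_in x y f \<^bold>\<and> pair_in x y' f \<^bold>\<longrightarrow> y \<^bold>= y') \<^bold>\<and>
     (\<^bold>\<forall>x. \<^bold>\<forall>x'. \<^bold>\<forall>y. pair_in x y f \<^bold>\<and> pair_in x' y f \<^bold>\<longrightarrow> x \<^bold>= x'))"

definition is_transitive :: "'u \<Rightarrow> 't" where
  "is_transitive x \<equiv> (\<^bold>\<forall>y. y \<^bold>\<in> x \<^bold>\<longrightarrow> y \<^bold>\<subseteq> x)"

definition is_ordinal :: "'u \<Rightarrow> 't" where
  "is_ordinal x \<equiv> (is_transitive x \<^bold>\<and> (\<^bold>\<forall>y. y \<^bold>\<in> x \<^bold>\<longrightarrow> is_transitive y))"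

definition is_limit :: "'u \<Rightarrow> 't" where
  "is_limit x \<equiv> (is_ordinal x \<^bold>\<and> (\<^bold>\<exists>y. y \<^bold>\<in> x) \<^bold>\<and>
     (\<^bold>\<forall>y. y \<^bold>\<in> x \<^bold>\<longrightarrow> (\<^bold>\<exists>z. z \<^bold>\<in> x \<^bold>\<and> y \<^bold>\<in> z)))"

definition is_omega :: "'u \<Rightarrow> 't" where
  "is_omega w \<equiv> (is_limit w \<^bold>\<and> (\<^bold>\<forall>x. x \<^bold>\<in> w \<^bold>\<longrightarrow> \<^bold>\<not> is_limit x))"

definition is_countable :: "'u \<Rightarrow> 't" where
  "is_countable a \<equiv> (\<^bold>\<exists>w. \<^bold>\<exists>f. is_omega w \<^bold>\<and> is_injection f a w)"

definition is_omega1 :: "'u \<Rightarrow> 't" where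
  "is_omega1 w \<equiv> (is_ordinal w \<^bold>\<and> \<^bold>\<not> is_countable w \<^bold>\<and> (\<^bold>\<forall>x. x \<^bold>\<in> w \<^bold>\<longrightarrow> is_countable x))"

definition is_ordinal_part :: "'u \<Rightarrow> 'u \<Rightarrow> 't" where
  "is_ordinal_part n N \<equiv> (\<^bold>\<forall>x. x \<^bold>\<in> n \<^bold>\<longleftrightarrow> x \<^bold>\<in> N \<^bold>\<and> is_ordinal x)"

text \<open>\<open>s\<close> is the least ordinal that is \<open>\<ge>\<close> all elements of the set \<open>x\<close> of ordinals.\<close>

definition is_sup :: "'u \<Rightarrow> 'u \<Rightarrow> 't" where
  "is_sup s x \<equiv> (is_ordinal s \<^bold>\<and> (\<^bold>\<forall>y. y \<^bold>\<in> x \<^bold>\<longrightarrow> y \<^bold>\<subseteq> s) \<^bold>\<and>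
     (\<^bold>\<forall>t. is_ordinal t \<^bold>\<and> (\<^bold>\<forall>y. y \<^bold>\<in> x \<^bold>\<longrightarrow> y \<^bold>\<subseteq> t) \<^bold>\<longrightarrow> s \<^bold>\<subseteq> t))"

text \<open>\<open>a\<close> is countable in the structure \<open>(N, \<in>)\<close>: all quantifiers are restricted to \<open>N\<close>.\<close>

definition models_countable :: "'u \<Rightarrow> 'u \<Rightarrow> 't" where
  "models_countable N a \<equiv>
     formulas.is_countable Mem Eq Neg Conj (\<lambda>F. \<^bold>\<forall>x. x \<^bold>\<in> N \<^bold>\<longrightarrow> F x) a"

definition countably_approximated :: "'u \<Rightarrow> 'u \<Rightarrow> 't" where
  "countably_approximated d N \<equiv>
     (\<^bold>\<forall>a. a \<^bold>\<in> N \<^bold>\<and> models_countable N a \<^bold>\<longrightarrow> (\<^bold>\<exists>b. is_inter b d a \<^bold>\<and> b \<^bold>\<in> N))"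

definition guessed :: "'u \<Rightarrow> 'u \<Rightarrow> 't" where
  "guessed d N \<equiv> (\<^bold>\<exists>e. e \<^bold>\<in> N \<^bold>\<and> is_inter d e N)"

definition omega1_guessing :: "'u \<Rightarrow> 't" where
  "omega1_guessing N \<equiv>
     (\<^bold>\<forall>n. \<^bold>\<forall>d. is_ordinal_part n N \<^bold>\<and> d \<^bold>\<subseteq> n \<^bold>\<and>
        (\<^bold>\<exists>s. \<^bold>\<exists>t. is_sup s d \<^bold>\<and> is_sup t n \<^bold>\<and> s \<^bold>\<in> t) \<^bold>\<and>
        countably_approximated d N
      \<^bold>\<longrightarrow> guessed d N)"

end


section \<open>Cardinals\<close>

text \<open>Ordinals are von Neumann ordinals and cardinals are initial ordinals.\<close>

definition Ord :: "'v::zfc \<Rightarrow> bool" where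
  "Ord = formulas.is_ordinal (\<lambda>x y. x \<in> elts y) Not (\<and>) HOL.All"

definition Card :: "'v::zfc \<Rightarrow> bool" where
  "Card \<kappa> \<longleftrightarrow> Ord \<kappa> \<and> (\<forall>\<alpha>\<in>elts \<kappa>. |elts \<alpha>| <o |elts \<kappa>| )"

definition least_ord :: "('v::zfc \<Rightarrow> bool) \<Rightarrow> 'v" where
  "least_ord P = (THE \<alpha>. Ord \<alpha> \<and> P \<alpha> \<and> (\<forall>\<beta>\<in>elts \<alpha>. \<not> P \<beta>))"

definition omega :: "'v::zfc" where
  "omega = least_ord (\<lambda>\<alpha>. infinite (elts \<alpha>))"

definition card_succ :: "'v::zfc \<Rightarrow> 'v" where
  "card_succ \<kappa> = least_ord (\<lambda>\<alpha>. |elts \<kappa>| <o |elts \<alpha>| )"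

definition omega1 :: "'v::zfc" where
  "omega1 = card_succ omega"

definition omega2 :: "'v::zfc" where
  "omega2 = card_succ omega1"

definition cf :: "'v::zfc \<Rightarrow> 'v" where
  "cf \<kappa> = least_ord (\<lambda>\<alpha>. \<exists>f. f ` elts \<alpha> \<subseteq> elts \<kappa> \<and>
                           (\<forall>\<beta>\<in>elts \<kappa>. \<exists>\<gamma>\<in>elts \<alpha>. \<beta> \<in> elts (f \<gamma>) \<or> \<beta> = f \<gamma>))"

definition singular :: "'v::zfc \<Rightarrow> bool" where
  "singular \<kappa> \<longleftrightarrow> Card \<kappa> \<and> infinite (elts \<kappa>) \<and> cf \<kappa> \<in> elts \<kappa>"

text \<open>
  The general form of SCH, about all singular cardinals above \<open>2\<close> to the power of their
  cofinality. It implies the version for singular strong limit cardinals.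
\<close>

definition SCH :: "'v::zfc itself \<Rightarrow> bool" where
  "SCH _ \<longleftrightarrow> (\<forall>\<kappa>::'v. singular \<kappa> \<and> ctwo ^c |elts (cf \<kappa>)| <o |elts \<kappa>|
                 \<longrightarrow> |elts \<kappa>| ^c |elts (cf \<kappa>)| =o |elts (card_succ \<kappa>)| )"


section \<open>Forcing\<close>

definition forcing_poset :: "'v::zfc \<Rightarrow> ('v \<Rightarrow> 'v \<Rightarrow> bool) \<Rightarrow> bool" where
  "forcing_poset P le \<longleftrightarrow> elts P \<noteq> {} \<and> (\<forall>p\<in>elts P. le p p) \<and>
     (\<forall>p\<in>elts P. \<forall>q\<in>elts P. \<forall>r\<in>elts P. le p q \<longrightarrow> le q r \<longrightarrow> le p r)"

inductive is_name :: "'v::zfc \<Rightarrow> 'v \<Rightarrow> bool" for P where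
  "(\<And>z. z \<in> elts \<tau> \<Longrightarrow> \<exists>\<sigma> p. z = opair \<sigma> p \<and> p \<in> elts P \<and> is_name P \<sigma>) \<Longrightarrow> is_name P \<tau>"

text \<open>
  The canonical name of a ground model set. No largest condition is assumed, so every condition
  is used in its place.
\<close>

function check_name :: "'v::zfc \<Rightarrow> 'v \<Rightarrow> 'v" where
  "check_name P x = vset (\<Union>p\<in>elts P. (\<lambda>y. opair (check_name P y) p) ` elts x)"
  by auto
termination
  by (relation "{((P, y), (Q, x)). P = Q \<and> y \<in> elts x}")
     (auto intro: wf_subset[OF wf_inv_image[OF foundation, of snd]] simp: inv_image_def)

declare check_name.simps [simp del]

definition dense_below :: "'v::zfc \<Rightarrow> ('v \<Rightarrow> 'v \<Rightarrow> bool) \<Rightarrow> 'v \<Rightarrow> ('v \<Rightarrow> bool) \<Rightarrow> bool" where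
  "dense_below P le p D \<longleftrightarrow> (\<forall>q\<in>elts P. le q p \<longrightarrow> (\<exists>r\<in>elts P. le r q \<and> D r))"

lemma dense_below_mono [mono]:
  "(\<And>r. D r \<longrightarrow> E r) \<Longrightarrow> dense_below P le p D \<longrightarrow> dense_below P le p E"
  unfolding dense_below_def by blast

text \<open>
  The usual recursive clause for \<open>p \<tturnstile> \<tau> = \<sigma>\<close>. It descends from \<open>\<tau>, \<sigma>\<close> to elements of their
  domains, so by Foundation the inductive predicate is the unique solution of the recursion.
\<close>

inductive force_eq :: "'v::zfc \<Rightarrow> ('v \<Rightarrow> 'v \<Rightarrow> bool) \<Rightarrow> 'v \<Rightarrow> 'v \<Rightarrow> 'v \<Rightarrow> bool" for P le where
  "(\<And>\<pi> s. opair \<pi> s \<in> elts \<tau> \<Longrightarrow> dense_below P le p (\<lambda>q. le q s \<longrightarrow>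
       (\<exists>\<rho> t. opair \<rho> t \<in> elts \<sigma> \<and> le q t \<and> force_eq P le \<pi> \<rho> q))) \<Longrightarrow>
   (\<And>\<rho> t. opair \<rho> t \<in> elts \<sigma> \<Longrightarrow> dense_below P le p (\<lambda>q. le q t \<longrightarrow>
       (\<exists>\<pi> s. opair \<pi> s \<in> elts \<tau> \<and> le q s \<and> force_eq P le \<pi> \<rho> q))) \<Longrightarrow>
   force_eq P le \<tau> \<sigma> p"

definition force_mem :: "'v::zfc \<Rightarrow> ('v \<Rightarrow> 'v \<Rightarrow> bool) \<Rightarrow> 'v \<Rightarrow> 'v \<Rightarrow> 'v \<Rightarrow> bool" where
  "force_mem P le \<tau> \<sigma> p \<longleftrightarrow> dense_below P le p (\<lambda>q.
     \<exists>\<rho> t. opair \<rho> t \<in> elts \<sigma> \<and> le q t \<and> force_eq P le \<tau> \<rho> q)"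

text \<open>The truth value of a statement of the forcing language is the predicate ``\<open>p\<close> forces it''.\<close>

definition force_neg :: "'v::zfc \<Rightarrow> ('v \<Rightarrow> 'v \<Rightarrow> bool) \<Rightarrow> ('v \<Rightarrow> bool) \<Rightarrow> 'v \<Rightarrow> bool" where
  "force_neg P le A p \<longleftrightarrow> (\<forall>q\<in>elts P. le q p \<longrightarrow> \<not> A q)"

definition force_conj :: "('v \<Rightarrow> bool) \<Rightarrow> ('v \<Rightarrow> bool) \<Rightarrow> 'v \<Rightarrow> bool" where
  "force_conj A B p \<longleftrightarrow> A p \<and> B p"

definition force_all :: "'v::zfc \<Rightarrow> ('v \<Rightarrow> 'v \<Rightarrow> bool) \<Rightarrow> 'v \<Rightarrow> bool" where
  "force_all P F p \<longleftrightarrow> (\<forall>\<tau>. is_name P \<tau> \<longrightarrow> F \<tau> p)"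

definition preserves_omega1 :: "'v::zfc \<Rightarrow> ('v \<Rightarrow> 'v \<Rightarrow> bool) \<Rightarrow> bool" where
  "preserves_omega1 P le \<longleftrightarrow> (\<forall>p\<in>elts P.
     formulas.is_omega1 (force_mem P le) (force_eq P le) (force_neg P le) force_conj (force_all P)
       (check_name P omega1) p)"

definition forces_omega1_guessing :: "'v::zfc \<Rightarrow> ('v \<Rightarrow> 'v \<Rightarrow> bool) \<Rightarrow> 'v \<Rightarrow> bool" where
  "forces_omega1_guessing P le N \<longleftrightarrow> (\<forall>p\<in>elts P.
     formulas.omega1_guessing (force_mem P le) (force_eq P le) (force_neg P le) force_conj
       (force_all P) (check_name P N) p)"

definition indestructibly_omega1_guessing :: "'v::zfc \<Rightarrow> bool" where
  "indestructibly_omega1_guessing N \<longleftrightarrow>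
     (\<forall>P le. forcing_poset P le \<and> preserves_omega1 P le \<longrightarrow> forces_omega1_guessing P le N)"


section \<open>The indestructible guessing model principle\<close>

definition trcl :: "'v::zfc \<Rightarrow> 'v set" where
  "trcl x = {y. (y, x) \<in> {(u, v). u \<in> elts v}\<^sup>+}"

definition H :: "'v::zfc \<Rightarrow> 'v set" where
  "H \<theta> = {x. |trcl x| <o |elts \<theta>|}"

definition P_less :: "'v::zfc \<Rightarrow> 'v set \<Rightarrow> 'v set" where
  "P_less \<kappa> X = {a. elts a \<subseteq> X \<and> |elts a| <o |elts \<kappa>|}"

definition club_in_P :: "'v::zfc \<Rightarrow> 'v set \<Rightarrow> 'v set \<Rightarrow> bool" where
  "club_in_P \<kappa> X C \<longleftrightarrow> C \<subseteq> P_less \<kappa> X \<and>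
     (\<forall>a\<in>P_less \<kappa> X. \<exists>b\<in>C. elts a \<subseteq> elts b) \<and>
     (\<forall>D\<subseteq>C. D \<noteq> {} \<and> |D| <o |elts \<kappa>| \<and> (\<forall>a\<in>D. \<forall>b\<in>D. elts a \<subseteq> elts b \<or> elts b \<subseteq> elts a)
        \<longrightarrow> vset (\<Union>a\<in>D. elts a) \<in> C)"

definition stationary_in_P :: "'v::zfc \<Rightarrow> 'v set \<Rightarrow> 'v set \<Rightarrow> bool" where
  "stationary_in_P \<kappa> X S \<longleftrightarrow> S \<subseteq> P_less \<kappa> X \<and> (\<forall>C. club_in_P \<kappa> X C \<longrightarrow> S \<inter> C \<noteq> {})"

definition IGMP_at :: "'v::zfc \<Rightarrow> bool" where
  "IGMP_at \<theta> \<longleftrightarrow>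
     stationary_in_P omega2 (H \<theta>) {N \<in> P_less omega2 (H \<theta>). indestructibly_omega1_guessing N}"

definition IGMP :: "'v::zfc itself \<Rightarrow> bool" where
  "IGMP _ \<longleftrightarrow> (\<forall>\<theta>::'v. Card \<theta> \<and> elts omega2 \<subseteq> elts \<theta> \<longrightarrow> IGMP_at \<theta>)"

end

theory Submission
  imports Defs "HOL-Library.Countable_Set"
begin

text \<open>
  Only plain guessing in the ground model, i.e. the one-point forcing, is used. Let \<open>\<kappa>\<close> be singular
  with \<open>2 ^ cf \<kappa> < \<kappa>\<close>, and argue by induction on \<open>\<kappa>\<close>.

  If \<open>cf \<kappa> = \<omega>\<close>, write \<open>\<gamma> = \<Union>\<^sub>n D n \<gamma>\<close> for \<open>\<gamma> < \<kappa>\<^sup>+\<close> with \<open>|D n \<gamma>| < \<kappa>\<close> and \<open>D n \<beta> \<subseteq> D n \<gamma>\<close> for \<open>\<beta> < \<gamma>\<close> and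
  almost all \<open>n\<close>. As \<open>2\<^sup>\<omega> < \<kappa>\<close>, for every countable \<open>x\<close> the traces \<open>D n \<gamma> \<inter> x\<close> are, for almost all \<open>n\<close>, the
  same for all large \<open>\<gamma>\<close>. Let \<open>N\<close> be a guessing model and \<open>\<delta> < \<kappa>\<^sup>+\<close> a bound of \<open>N \<inter> \<kappa>\<^sup>+\<close>. Guessing implies
  that countable subsets of \<open>N \<inter> \<kappa>\<^sup>+\<close> are covered by countable elements of \<open>N\<close>; hence for some \<open>n\<close> the
  set \<open>D n \<delta> \<inter> N\<close> is unbounded in \<open>N \<inter> \<kappa>\<^sup>+\<close> and countably approximated by \<open>N\<close>, so of the form \<open>e \<inter> N\<close> with
  \<open>e \<in> N\<close>. By elementarity \<open>e\<close> is unbounded in \<open>\<kappa>\<^sup>+\<close> and each of its countable subsets is contained in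
  some \<open>D m \<beta>\<close>, and counting these subsets gives \<open>(\<kappa>\<^sup>+)\<^sup>\<omega> = \<kappa>\<^sup>+\<close>.

  If \<open>cf \<kappa>\<close> is uncountable, the induction hypothesis bounds \<open>\<nu> ^ cf \<kappa>\<close> for \<open>\<nu> < \<kappa>\<close>, and Silver's theorem applies.
  Its proof counts, for a family of eventually different functions, those below a given one on a
  stationary set.
\<close>

text \<open>Elementarity is not formalised as satisfaction. Instead \<open>N\<close> is closed under
  a fixed two-place function with small values, which collects one Skolem choice for each statement
  that the arguments reflect. The sets closed under such a function form a club, so stationarity
  yields a guessing \<open>N\<close> among them. Nor is \<open>N\<close> transitive: the locale
  \<open>absolute\<close> shows that what \<open>N\<close> takes for countable is countable. The
  forcing statement becomes a plain one by parametricity of the formulas.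

  Two obstacles shape the countable case. The level from which traces stabilise depends on the
  countable set, whereas approximation asks for one level serving all countable elements of
  \<open>N\<close>. Countably many counterexamples are therefore merged into a single countable
  element of \<open>N\<close>, and this is what covering is for. Covering works because
  \<open>N\<close> contains all countable ordinals, hence uncountably many elements of each of its
  uncountable elements: a guess of a countable set is countable.

  The induction hypothesis bounds \<open>\<nu> ^ cf \<nu>\<close> only; \<open>power_bound\<close>
  derives bounds for \<open>\<nu> ^ cf \<kappa>\<close> from it.\<close>

declare card_of_card_order_on [simp] card_of_well_order_on [simp] Field_card_of [simp] card_of_refl [simp]

lemma Card_order_cardSuc_card_of [simp]:
  "Card_order (cardSuc |A| )" "Well_order (cardSuc |A| )"
  by (simp_all add: cardSuc_Card_order cardSuc_Well_order)

subsection \<open>Small classes and ordinals\<close>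

definition small :: "'v::zfc set \<Rightarrow> bool" where
  "small A \<longleftrightarrow> (\<exists>x. elts x = A)"

lemma small_elts [simp]: "small (elts x)"
  by (auto simp: small_def)

lemma vset_elts [simp]: "vset (elts x) = x"
  unfolding vset_def by (rule the_equality) (auto intro: extensionality)

lemma elts_vset [simp]: "small A \<Longrightarrow> elts (vset A) = A"
  by (metis small_def vset_elts)

lemma small_subset: "small A \<Longrightarrow> B \<subseteq> A \<Longrightarrow> small B"
proof -
  assume "small A" "B \<subseteq> A"
  then obtain x where x: "elts x = A" by (auto simp: small_def)
  obtain y where "elts y = {z \<in> elts x. z \<in> B}" using separation[of x "\<lambda>z. z \<in> B"] by auto
  also have "\<dots> = B" using x \<open>B \<subseteq> A\<close> by auto
  finally show ?thesis by (auto simp: small_def)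
qed

lemma small_image [simp]:
  fixes f :: "'v::zfc \<Rightarrow> 'v"
  shows "small A \<Longrightarrow> small (f ` A)"
  unfolding small_def using replacement[of f] by blast

lemma small_Union:
  fixes A :: "'v::zfc \<Rightarrow> 'v set"
  assumes "small I" "\<And>i. i \<in> I \<Longrightarrow> small (A i)"
  shows "small (\<Union>i\<in>I. A i)"
proof -
  have "small ((\<lambda>i. vset (A i)) ` I)" using assms(1) by (rule small_image)
  then obtain x where x: "elts x = (\<lambda>i. vset (A i)) ` I" by (auto simp: small_def)
  obtain u where "elts u = (\<Union>y\<in>elts x. elts y)" using union[of x] by auto
  also have "\<dots> = (\<Union>i\<in>I. A i)" using x assms(2) by auto
  finally show ?thesis by (auto simp: small_def)
qed

lemma small_pair [simp]: "small {x, y}"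
  using pairing by (auto simp: small_def)

lemma small_Un [simp]: "small A \<Longrightarrow> small B \<Longrightarrow> small (A \<union> B)"
proof -
  assume "small A" "small B"
  then obtain a b where ab: "elts a = A" "elts b = B" by (auto simp: small_def)
  have "small (\<Union>i\<in>{a,b}. elts i)" by (rule small_Union) auto
  then show ?thesis using ab by simp
qed

lemma small_singleton [simp]: "small {x}"
  using small_pair[of x x] by simp

lemma small_empty [simp]: "small {}"
  by (rule small_subset[OF small_singleton]) auto

lemma small_insert [simp]: "small A \<Longrightarrow> small (insert x A)"
  using small_Un[of "{x}" A] by simp

lemma card_ordLeqE:
  assumes "|A| \<le>o |B|"
  obtains f where "inj_on f A" "f ` A \<subseteq> B"
  using assms unfolding card_of_ordLeq[symmetric] by auto

text \<open>The image of \<open>A\<close> is a subclass of a set, and Replacement along the inverse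
  of the injection gives back \<open>A\<close>. Thus HOL cardinalities, which also make sense for
  proper classes, decide smallness.\<close>

lemma small_ordLeq:
  fixes A B :: "'v::zfc set"
  assumes "|A| \<le>o |B|" "small B"
  shows "small A"
proof -
  obtain f where f: "inj_on f A" "f ` A \<subseteq> B"
    using assms(1) by (rule card_ordLeqE)
  have "small (f ` A)" by (rule small_subset[OF assms(2) f(2)])
  then have "small (inv_into A f ` f ` A)" by (rule small_image)
  then show ?thesis using f(1) by (simp add: inv_into_image_cancel)
qed

lemma ordLeq_Pow_elts: "|Pow (elts x)| \<le>o |{y. elts y \<subseteq> elts x}|"
proof (rule card_of_ordLeqI[where f = vset])
  show "inj_on vset (Pow (elts x))"
    by (rule inj_on_inverseI[of _ elts]) (auto simp: small_subset[OF small_elts])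
qed (auto simp: small_subset[OF small_elts])

lemma mem_irrefl [simp]: "x \<notin> elts x"
  using wf_irrefl[OF foundation, of x] by auto

lemma mem_asym: "x \<in> elts y \<Longrightarrow> y \<notin> elts x"
  using wf_asym[OF foundation, of x y] by auto

lemma mem_induct [case_names mem]:
  assumes "\<And>x. (\<And>y. y \<in> elts x \<Longrightarrow> P y) \<Longrightarrow> P x"
  shows "P (x::'v::zfc)"
  by (rule wf_induct_rule[OF foundation]) (simp add: assms)

lemma Ord_iff: "Ord x \<longleftrightarrow> (\<forall>y\<in>elts x. elts y \<subseteq> elts x \<and> (\<forall>z\<in>elts y. elts z \<subseteq> elts y))"
  unfolding Ord_def formulas.is_ordinal_def formulas.is_transitive_def formulas.Sub_def
    formulas.Imp_def by (simp add: subset_iff Ball_def) blast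

lemma Ord_mem: "Ord x \<Longrightarrow> y \<in> elts x \<Longrightarrow> Ord y"
proof -
  assume x: "Ord x" and y: "y \<in> elts x"
  have yx: "elts y \<subseteq> elts x" using x y unfolding Ord_iff by simp
  have 1: "elts z \<subseteq> elts y" if "z \<in> elts y" for z using x y that unfolding Ord_iff by simp
  have 2: "elts w \<subseteq> elts z" if "z \<in> elts y" "w \<in> elts z" for z w
    using x subsetD[OF yx that(1)] that(2) unfolding Ord_iff by simp
  show "Ord y" unfolding Ord_iff using 1 2 by simp
qed

lemma OrdI: "(\<And>y. y \<in> elts x \<Longrightarrow> Ord y) \<Longrightarrow> (\<And>y. y \<in> elts x \<Longrightarrow> elts y \<subseteq> elts x) \<Longrightarrow> Ord x"
  unfolding Ord_iff by blast

lemma Ord_trans: "Ord x \<Longrightarrow> y \<in> elts x \<Longrightarrow> z \<in> elts y \<Longrightarrow> z \<in> elts x"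
  unfolding Ord_iff by blast

lemma Ord_subset: "Ord x \<Longrightarrow> y \<in> elts x \<Longrightarrow> elts y \<subseteq> elts x"
  unfolding Ord_iff by blast

lemma Ord_linear: "Ord x \<Longrightarrow> Ord y \<Longrightarrow> x \<in> elts y \<or> x = y \<or> y \<in> elts x"
proof (induction x arbitrary: y rule: mem_induct)
  case (mem x)
  note IHx = mem.IH and x = mem.prems(1)
  from mem.prems(2) show ?case
  proof (induction y rule: mem_induct)
    case (mem y)
    show ?case
    proof (rule ccontr)
      assume neg: "\<not> ?case"
      have "elts x = elts y"
      proof (intro set_eqI iffI)
        fix z assume z: "z \<in> elts x"
        then show "z \<in> elts y"
          using IHx[OF z Ord_mem[OF x z] mem.prems] neg Ord_trans[OF x z] by auto
      next
        fix z assume z: "z \<in> elts y"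
        then show "z \<in> elts x"
          using mem.IH[OF z Ord_mem[OF mem.prems z]] neg Ord_trans[OF mem.prems z] by auto
      qed
      then show False using neg extensionality by auto
    qed
  qed
qed

lemma Ord_subset_iff: "Ord x \<Longrightarrow> Ord y \<Longrightarrow> elts x \<subseteq> elts y \<longleftrightarrow> x \<in> elts y \<or> x = y"
  using Ord_linear[of x y] Ord_subset[of y x] mem_irrefl[of y] by blast

lemma Ord_induct [consumes 1, case_names Ord]:
  assumes "Ord x" "\<And>x. Ord x \<Longrightarrow> (\<And>y. y \<in> elts x \<Longrightarrow> P y) \<Longrightarrow> P x"
  shows "P x"
  using assms(1)
proof (induction x rule: mem_induct)
  case (mem x)
  show ?case by (rule assms(2)[OF mem.prems mem.IH]) (auto intro: Ord_mem[OF mem.prems])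
qed

lemma least_ord:
  assumes "Ord \<alpha>" "P \<alpha>"
  shows Ord_least_ord: "Ord (least_ord P)"
    and least_ord_holds: "P (least_ord P)"
    and least_ord_min: "\<And>\<beta>. \<beta> \<in> elts (least_ord P) \<Longrightarrow> \<not> P \<beta>"
proof -
  let ?Q = "\<lambda>\<alpha>. Ord \<alpha> \<and> P \<alpha> \<and> (\<forall>\<beta>\<in>elts \<alpha>. \<not> P \<beta>)"
  have "\<exists>\<alpha>. ?Q \<alpha>"
  using assms
  proof (induction \<alpha> rule: mem_induct)
    case (mem x)
    show ?case
    proof (cases "\<exists>\<beta>\<in>elts x. P \<beta>")
      case True
      then obtain \<beta> where "\<beta> \<in> elts x" "P \<beta>" by blast
      then show ?thesis using mem.IH Ord_mem[OF mem.prems(1)] by blast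
    next
      case False
      then show ?thesis using mem.prems by blast
    qed
  qed
  moreover have "\<alpha> = \<beta>" if "?Q \<alpha>" "?Q \<beta>" for \<alpha> \<beta>
    using that Ord_linear[of \<alpha> \<beta>] by blast
  ultimately have "\<exists>!\<alpha>. ?Q \<alpha>" by (rule ex_ex1I)
  from theI'[OF this] have "?Q (least_ord P)" unfolding least_ord_def .
  then show "Ord (least_ord P)" "P (least_ord P)"
    "\<And>\<beta>. \<beta> \<in> elts (least_ord P) \<Longrightarrow> \<not> P \<beta>"
    by simp_all
qed

lemma least_ord_subset:
  assumes "Ord \<alpha>" "P \<alpha>"
  shows "elts (least_ord P) \<subseteq> elts \<alpha>"
proof -
  note l = least_ord[where P = P, OF assms(1,2)]
  show ?thesis using Ord_linear[OF l(1) assms(1)] assms l(2,3) Ord_subset[OF assms(1)] by blast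
qed

text \<open>For a small class of ordinals this is the strict supremum, the least ordinal above all
  of them; for a singleton it is the successor.\<close>

definition sup_ord :: "'v::zfc set \<Rightarrow> 'v" where
  "sup_ord A = vset (\<Union>x\<in>A. insert x (elts x))"

lemma elts_sup_ord: "small A \<Longrightarrow> elts (sup_ord A) = (\<Union>x\<in>A. insert x (elts x))"
  unfolding sup_ord_def by (rule elts_vset) (auto intro: small_Union)

lemma Ord_sup_ord: 
  assumes "small A" "\<And>x. x \<in> A \<Longrightarrow> Ord x"
  shows "Ord (sup_ord A)"
proof (rule OrdI)
  fix y assume "y \<in> elts (sup_ord A)"
  then obtain x where x: "x \<in> A" "y = x \<or> y \<in> elts x"
    unfolding elts_sup_ord[OF assms(1)] by blast
  show "Ord y" using x assms(2)[OF x(1)] Ord_mem by blast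
  have "elts y \<subseteq> elts x" using x assms(2)[OF x(1)] Ord_subset by blast
  then show "elts y \<subseteq> elts (sup_ord A)"
    unfolding elts_sup_ord[OF assms(1)] using x(1) by blast
qed

text \<open>Mostowski collapse. The well-order may live on any HOL type; the bound by
  \<open>elts x\<close> is what makes the images of its initial segments sets.\<close>

lemma Collapse:
  fixes r :: "'a rel" and x :: "'v::zfc"
  assumes r: "Well_order r" and le: "|Field r| \<le>o |elts x|"
  obtains \<alpha> :: "'v" where "Ord \<alpha>" "|elts \<alpha>| =o |Field r|"
proof -
  interpret wo_rel r using r by (simp add: wo_rel_def)
  have wf: "wf (r - Id)" using WELL by (simp add: well_order_on_def)
  define c :: "'a \<Rightarrow> 'v" where
    "c = wfrec (r - Id) (\<lambda>c a. vset (c ` Order_Relation.underS r a))"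
  have sm: "small (f ` A)" if "A \<subseteq> Field r" for f :: "'a \<Rightarrow> 'v" and A
  proof (rule small_ordLeq)
    show "|f ` A| \<le>o |elts x|"
      using card_of_image[of f A] card_of_mono1[OF that] le
      by (meson ordLeq_transitive)
  qed simp
  have c: "c a = vset (c ` Order_Relation.underS r a)" for a
  proof -
    have "c a = vset (cut c (r - Id) a ` Order_Relation.underS r a)"
      unfolding c_def by (subst wfrec[OF wf]) auto
    also have "cut c (r - Id) a ` Order_Relation.underS r a = c ` Order_Relation.underS r a"
      by (rule image_cong) (auto simp: cut_def Order_Relation.underS_def)
    finally show ?thesis .
  qed
  have sub: "Order_Relation.underS r a \<subseteq> Field r" for a by (rule Order_Relation.underS_Field)
  have ec: "elts (c a) = c ` Order_Relation.underS r a" for a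
    by (subst c) (simp add: sm[OF sub])
  have trans: "b \<in> Order_Relation.underS r a \<Longrightarrow> d \<in> Order_Relation.underS r b \<Longrightarrow> d \<in> Order_Relation.underS r a" for a b d
    using TRANS ANTISYM unfolding Order_Relation.underS_def trans_def antisym_def by blast
  have inj: "inj_on c (Field r)"
  proof (rule inj_onI, rule ccontr)
    fix a b assume ab: "a \<in> Field r" "b \<in> Field r" "c a = c b" "a \<noteq> b"
    then have "a \<in> Order_Relation.underS r b \<or> b \<in> Order_Relation.underS r a"
      using TOTAL unfolding Order_Relation.underS_def total_on_def by blast
    then have "c a \<in> elts (c b) \<or> c b \<in> elts (c a)" using ec by auto
    then show False using ab by simp
  qed
  define \<alpha> where "\<alpha> = vset (c ` Field r)"
  have ea: "elts \<alpha> = c ` Field r" unfolding \<alpha>_def using sm by simp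
  have "Ord \<alpha>"
    unfolding Ord_iff ea using sub
    by (auto simp: ec dest: trans intro: subsetD[OF sub] intro!: imageI)
  moreover have "|elts \<alpha>| =o |Field r|"
    unfolding ea using inj card_of_ordIsoI[OF inj_on_imp_bij_betw[OF inj]] ordIso_symmetric by blast
  ultimately show ?thesis using that by blast
qed

lemma ordinal_of_card:
  fixes x :: "'v::zfc"
  obtains \<alpha> :: 'v where "Ord \<alpha>" "|elts \<alpha>| =o |elts x|"
proof -
  have "|Field |elts x| | \<le>o |elts x|" by (simp add: ordIso_imp_ordLeq)
  with Collapse[of "|elts x|" x] that show ?thesis
    using card_of_Well_order by auto
qed

lemma cardSuc_ordLeq_Pow: "cardSuc |A| \<le>o |Pow A|"
  by (rule cardSuc_least) (simp_all add: card_of_Pow)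

text \<open>The HOL cardinal \<open>cardSuc\<close> lives on another type. By Cantor its field is no
  larger than the power set of \<open>x\<close>, so it can be collapsed to an ordinal of the
  universe.\<close>

lemma ordinal_of_cardSuc:
  fixes x :: "'v::zfc"
  obtains \<alpha> :: 'v where "Ord \<alpha>" "|elts \<alpha>| =o cardSuc |elts x|"
proof -
  let ?r = "cardSuc |elts x|"
  have co: "Card_order ?r" and w: "Well_order ?r" by simp_all
  obtain p where p: "elts p = {y. elts y \<subseteq> elts x}" using powerset[of x] by auto
  have "|Field ?r| \<le>o |elts p|" unfolding p
    by (rule ordIso_ordLeq_trans[OF card_of_Field_ordIso[OF co]
          ordLeq_transitive[OF cardSuc_ordLeq_Pow ordLeq_Pow_elts]])
  from Collapse[OF w this] show ?thesis
    using that ordIso_transitive[OF _ card_of_Field_ordIso[OF co]] by blast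
qed

subsection \<open>Cardinals\<close>

lemma finite_ordLess_infinite_card:
  assumes "finite A" "infinite B"
  shows "|A| <o |B|"
  by (rule finite_ordLess_infinite) (use assms in simp_all)

lemma not_ordLeq_card_iff [simp]: "\<not> |A| \<le>o |B| \<longleftrightarrow> |B| <o |A|"
  by (rule not_ordLeq_iff_ordLess) simp_all

lemma not_ordLess_card_iff [simp]: "\<not> |A| <o |B| \<longleftrightarrow> |B| \<le>o |A|"
  by (rule not_ordLess_iff_ordLeq) simp_all

lemma ordLess_cardSuc_iff: "|A| <o cardSuc |B| \<longleftrightarrow> |A| \<le>o |B|"
  by (rule cardSuc_ordLeq_ordLess) simp_all

lemma card_succ:
  fixes \<kappa> :: "'v::zfc"
  shows Ord_card_succ: "Ord (card_succ \<kappa>)"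
    and card_succ_greater: "|elts \<kappa>| <o |elts (card_succ \<kappa>)|"
    and card_succ_mem: "\<And>\<beta>. \<beta> \<in> elts (card_succ \<kappa>) \<Longrightarrow> |elts \<beta>| \<le>o |elts \<kappa>|"
    and card_succ_cardSuc: "|elts (card_succ \<kappa>)| =o cardSuc |elts \<kappa>|"
proof -
  let ?P = "\<lambda>\<alpha>. |elts \<kappa>| <o |elts \<alpha>|"
  obtain \<alpha> :: 'v where a: "Ord \<alpha>" "|elts \<alpha>| =o cardSuc |elts \<kappa>|" 
    by (rule ordinal_of_cardSuc[of \<kappa>])
  have P: "?P \<alpha>"
    by (rule ordLess_ordIso_trans[OF cardSuc_greater ordIso_symmetric[OF a(2)]]) simp
  show 1: "Ord (card_succ \<kappa>)" "|elts \<kappa>| <o |elts (card_succ \<kappa>)|"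
    unfolding card_succ_def using least_ord(1,2)[where P = ?P, OF a(1) P] by auto
  show "|elts \<beta>| \<le>o |elts \<kappa>|" if "\<beta> \<in> elts (card_succ \<kappa>)" for \<beta>
    using least_ord(3)[where P = ?P, OF a(1) P] that
    unfolding card_succ_def not_ordLess_card_iff[symmetric] by blast
  have "elts (card_succ \<kappa>) \<subseteq> elts \<alpha>"
    unfolding card_succ_def by (rule least_ord_subset[where P = ?P, OF a(1) P])
  then have "|elts (card_succ \<kappa>)| \<le>o cardSuc |elts \<kappa>|"
    by (rule ordLeq_ordIso_trans[OF card_of_mono1 a(2)])
  moreover have "cardSuc |elts \<kappa>| \<le>o |elts (card_succ \<kappa>)|"
    by (rule cardSuc_least[OF _ _ 1(2)]) simp_all
  ultimately show "|elts (card_succ \<kappa>)| =o cardSuc |elts \<kappa>|"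
    by (simp add: ordIso_iff_ordLeq)
qed

lemma ordLess_card_succ_iff: "|A| <o |elts (card_succ \<kappa>)| \<longleftrightarrow> |A| \<le>o |elts \<kappa>|"
proof
  assume "|A| <o |elts (card_succ \<kappa>)|"
  from ordLess_ordIso_trans[OF this card_succ_cardSuc]
  show "|A| \<le>o |elts \<kappa>|" by (simp add: ordLess_cardSuc_iff)
next
  assume "|A| \<le>o |elts \<kappa>|"
  from ordLeq_ordLess_trans[OF this card_succ_greater]
  show "|A| <o |elts (card_succ \<kappa>)|" .
qed

lemma card_succ_ordLeq_iff: "|elts (card_succ \<kappa>)| \<le>o |A| \<longleftrightarrow> |elts \<kappa>| <o |A|"
  using ordLess_card_succ_iff[of A \<kappa>] not_ordLeq_card_iff not_ordLess_card_iff by blast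

lemma Card_card_succ: "Card (card_succ \<kappa>)"
  unfolding Card_def
  by (auto simp: Ord_card_succ intro: ordLeq_ordLess_trans[OF card_succ_mem card_succ_greater])

lemma Card_Ord: "Card \<kappa> \<Longrightarrow> Ord \<kappa>"
  by (simp add: Card_def)

lemma Card_mem: "Card \<kappa> \<Longrightarrow> \<beta> \<in> elts \<kappa> \<Longrightarrow> |elts \<beta>| <o |elts \<kappa>|"
  by (simp add: Card_def)

lemma Card_mem_iff:
  assumes "Card \<kappa>" "Ord \<beta>"
  shows "\<beta> \<in> elts \<kappa> \<longleftrightarrow> |elts \<beta>| <o |elts \<kappa>|"
proof
  note * = assms
  assume "|elts \<beta>| <o |elts \<kappa>|"
  then have "\<not> elts \<kappa> \<subseteq> elts \<beta>" using card_of_mono1 not_ordLess_ordLeq by blast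
  then show "\<beta> \<in> elts \<kappa>"
    using * Ord_linear[of \<kappa> \<beta>] Ord_subset[of \<beta> \<kappa>] Card_Ord by blast
qed (rule Card_mem[OF assms(1)])

text \<open>Regularity of successors: the strict supremum of at most \<kappa> ordinals of size at
  most \<kappa> again has size at most \<kappa>.\<close>

lemma card_succ_bounded:
  assumes "X \<subseteq> elts (card_succ \<kappa>)" "|X| \<le>o |elts \<kappa>|" "infinite (elts \<kappa>)"
  obtains \<delta> where "\<delta> \<in> elts (card_succ \<kappa>)" "X \<subseteq> elts \<delta>"
proof
  have sm: "small X" using assms(1) small_subset small_elts by blast
  have o: "Ord x" if "x \<in> X" for x using that assms(1) Ord_card_succ Ord_mem by blast
  show "X \<subseteq> elts (sup_ord X)" by (auto simp: elts_sup_ord[OF sm])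
  have "|elts (sup_ord X)| \<le>o |elts \<kappa>|"
    unfolding elts_sup_ord[OF sm]
  proof (rule card_of_UNION_ordLeq_infinite[OF assms(3,2)], rule ballI)
    fix x assume "x \<in> X"
    then have "|elts x| \<le>o |elts \<kappa>|" using card_succ_mem assms(1) by blast
    moreover have "|{x}| \<le>o |elts \<kappa>|" using assms(3)
      by (intro card_of_singl_ordLeq) auto
    ultimately have "|{x} \<union> elts x| \<le>o |elts \<kappa>|"
      using assms(3) by (intro card_of_Un_ordLeq_infinite_Field) simp_all
    then show "|insert x (elts x)| \<le>o |elts \<kappa>|" by simp
  qed
  then show "sup_ord X \<in> elts (card_succ \<kappa>)"
    using Card_mem_iff[OF Card_card_succ Ord_sup_ord[OF sm o]] ordLess_card_succ_iff by blast
qed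

section \<open>Cofinality\<close>

definition cofinal_map :: "('v::zfc \<Rightarrow> 'v) \<Rightarrow> 'v \<Rightarrow> 'v \<Rightarrow> bool" where
  "cofinal_map f \<alpha> \<kappa> \<longleftrightarrow> f ` elts \<alpha> \<subseteq> elts \<kappa> \<and>
     (\<forall>\<beta>\<in>elts \<kappa>. \<exists>\<gamma>\<in>elts \<alpha>. \<beta> \<in> elts (f \<gamma>) \<or> \<beta> = f \<gamma>)"

lemma cf_props:
  assumes "Ord \<kappa>"
  shows Ord_cf: "Ord (cf \<kappa>)"
    and cf_cofinal: "\<exists>f. cofinal_map f (cf \<kappa>) \<kappa>"
    and cf_min: "\<And>\<alpha> f. Ord \<alpha> \<Longrightarrow> cofinal_map f \<alpha> \<kappa> \<Longrightarrow> elts (cf \<kappa>) \<subseteq> elts \<alpha>"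
proof -
  have cf: "cf \<kappa> = least_ord (\<lambda>\<alpha>. \<exists>f. cofinal_map f \<alpha> \<kappa>)"
    by (simp add: cf_def cofinal_map_def)
  have ex: "\<exists>f. cofinal_map f \<kappa> \<kappa>"
    by (rule exI[of _ id]) (auto simp: cofinal_map_def)
  show "Ord (cf \<kappa>)" "\<exists>f. cofinal_map f (cf \<kappa>) \<kappa>"
    unfolding cf using least_ord(1,2)[where P = "\<lambda>\<alpha>. \<exists>f. cofinal_map f \<alpha> \<kappa>", OF assms ex] by auto
  show "elts (cf \<kappa>) \<subseteq> elts \<alpha>" if "Ord \<alpha>" "cofinal_map f \<alpha> \<kappa>" for \<alpha> f
    unfolding cf by (rule least_ord_subset) (use that in auto)
qed

text \<open>By minimality of \<open>cf\<close>, the map is not cofinal. Some \<beta> is then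
  dominated by no value, and linearity turns this into a strict upper bound.\<close>

lemma not_cofinal_bounded:
  assumes "Ord \<kappa>" "\<alpha> \<in> elts (cf \<kappa>)" "f ` elts \<alpha> \<subseteq> elts \<kappa>"
  obtains \<beta> where "\<beta> \<in> elts \<kappa>" "\<And>\<gamma>. \<gamma> \<in> elts \<alpha> \<Longrightarrow> f \<gamma> \<in> elts \<beta>"
proof -
  have oa: "Ord \<alpha>" using assms Ord_cf Ord_mem by blast
  have "\<not> cofinal_map f \<alpha> \<kappa>"
    using cf_min[OF assms(1) oa] assms(2) mem_irrefl by blast
  then obtain \<beta> where b: "\<beta> \<in> elts \<kappa>" "\<And>\<gamma>. \<gamma> \<in> elts \<alpha> \<Longrightarrow> \<not> (\<beta> \<in> elts (f \<gamma>) \<or> \<beta> = f \<gamma>)"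
    using assms(3) unfolding cofinal_map_def by blast
  have "f \<gamma> \<in> elts \<beta>" if "\<gamma> \<in> elts \<alpha>" for \<gamma>
    using b that assms(1,3) Ord_linear[of \<beta> "f \<gamma>"] Ord_mem by blast
  with b(1) that show ?thesis by blast
qed

lemma Card_limit:
  assumes "Card \<kappa>" "infinite (elts \<kappa>)" "\<beta> \<in> elts \<kappa>"
  shows "vset (insert \<beta> (elts \<beta>)) \<in> elts \<kappa>"
proof -
  let ?s = "vset (insert \<beta> (elts \<beta>))"
  have es: "elts ?s = insert \<beta> (elts \<beta>)" by simp
  have ob: "Ord \<beta>" using assms Card_Ord Ord_mem by blast
  have os: "Ord ?s" using Ord_sup_ord[of "{\<beta>}"] ob by (simp add: sup_ord_def)
  have "|{\<beta>}| <o |elts \<kappa>|" using assms(2)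
    by (simp add: finite_ordLess_infinite_card)
  then have "|{\<beta>} \<union> elts \<beta>| <o |elts \<kappa>|"
    using assms Card_mem by (intro card_of_Un_ordLess_infinite) auto
  then show ?thesis using Card_mem_iff[OF assms(1) os] es by simp
qed

subsection \<open>The first infinite and the first uncountable ordinal\<close>

lemma countable_ordLeq_nat: "countable A \<longleftrightarrow> |A| \<le>o |UNIV :: nat set|"
  unfolding countable_def card_of_ordLeq[symmetric] by simp

text \<open>On a finite set the acyclic membership relation is also well-founded upwards, which
  would give a maximal element.\<close>

lemma inductive_infinite:
  assumes ne: "A \<noteq> {}" and suc: "\<And>y. y \<in> A \<Longrightarrow> \<exists>z\<in>A. y \<in> elts z"
  shows "infinite (A :: 'v::zfc set)"
proof
  assume "finite A"
  define r where "r = {(z, y). y \<in> elts z \<and> y \<in> A \<and> z \<in> A}"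
  have "finite r" using \<open>finite A\<close> by (auto simp: r_def intro: finite_subset[of _ "A \<times> A"])
  moreover have "acyclic r"
  proof -
    have "wf (r\<inverse>)" by (rule wf_subset[OF foundation]) (auto simp: r_def)
    then show ?thesis using wf_acyclic acyclic_converse by blast
  qed
  ultimately have "wf r" by (rule finite_acyclic_wf)
  then obtain y where "y \<in> A" "\<And>z. (z, y) \<in> r \<Longrightarrow> z \<notin> A"
    using ne by (metis wfE_min all_not_in_conv)
  then show False using suc unfolding r_def by blast
qed

text \<open>The set from Infinity need not be an ordinal; only its size is used, since an ordinal of
  the same size shows that infinite ordinals exist.\<close>

lemma omega_props:
  shows Ord_omega: "Ord (omega :: 'v::zfc)"
    and infinite_omega: "infinite (elts (omega :: 'v))"
    and finite_mem_omega: "\<And>n. n \<in> elts (omega :: 'v) \<Longrightarrow> finite (elts n)"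
proof -
  obtain w :: 'v where w: "\<exists>z\<in>elts w. elts z = {}" 
    "\<forall>x\<in>elts w. \<exists>y\<in>elts w. elts y = insert x (elts x)"
    using infinity by blast
  have "infinite (elts w)" by (rule inductive_infinite) (use w in blast)+
  moreover obtain \<alpha> :: 'v where a: "Ord \<alpha>" "|elts \<alpha>| =o |elts w|" by (rule ordinal_of_card)
  ultimately have "infinite (elts \<alpha>)" using card_of_ordIso_finite by blast
  from least_ord[where P = "\<lambda>\<alpha>. infinite (elts \<alpha>)", OF a(1) this]
  show "Ord (omega :: 'v)" "infinite (elts (omega :: 'v))"
    "\<And>n. n \<in> elts (omega :: 'v) \<Longrightarrow> finite (elts n)"
    unfolding omega_def by auto
qed

lemma countable_omega: "countable (elts (omega :: 'v::zfc))"
proof -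
  have "inj_on (\<lambda>n. card (elts n)) (elts (omega :: 'v))"
  proof (rule inj_onI)
    fix m n :: 'v assume mn: "m \<in> elts omega" "n \<in> elts omega" and eq: "card (elts m) = card (elts n)"
    have *: "card (elts i) < card (elts j)" if "i \<in> elts j" "j \<in> elts omega" for i j :: 'v
    proof -
      have "finite (elts j)" by (rule finite_mem_omega[OF that(2)])
      moreover have "elts i \<subset> elts j"
        using that Ord_subset[OF Ord_mem[OF Ord_omega that(2)] that(1)] mem_irrefl[of i] by blast
      ultimately show ?thesis by (rule psubset_card_mono)
    qed
    have "Ord m" "Ord n" using mn Ord_omega Ord_mem by blast+
    from Ord_linear[OF this] *[of m n] *[of n m] eq mn show "m = n" by auto
  qed
  then show ?thesis by (auto simp: countable_def)
qed

lemma omega_card: "|elts omega| =o |UNIV :: nat set|"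
  using countable_omega[unfolded countable_ordLeq_nat] infinite_omega
  by (simp add: infinite_iff_card_of_nat ordIso_iff_ordLeq)

lemma countable_ordLeq_omega: "countable (A :: 'v::zfc set) \<longleftrightarrow> |A| \<le>o |elts (omega :: 'v)|"
  unfolding countable_ordLeq_nat
  using ordLeq_ordIso_trans[OF _ omega_card] ordLeq_ordIso_trans[OF _ ordIso_symmetric[OF omega_card]]
  by blast

lemma Card_omega: "Card omega"
  unfolding Card_def
  by (simp add: Ord_omega finite_ordLess_infinite_card[OF finite_mem_omega infinite_omega])

lemma Card_omega1: "Card omega1"
  by (simp add: omega1_def Card_card_succ)

lemma uncountable_omega1: "uncountable (elts omega1)"
  unfolding countable_ordLeq_omega omega1_def not_ordLeq_card_iff by (rule card_succ_greater)

lemma infinite_omega1: "infinite (elts omega1)"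
  using uncountable_omega1 countable_finite by blast

lemma countable_mem_omega1: "\<alpha> \<in> elts omega1 \<Longrightarrow> countable (elts \<alpha>)"
  unfolding countable_ordLeq_omega omega1_def by (rule card_succ_mem)

lemma uncountable_iff_omega1:
  "uncountable (A :: 'v::zfc set) \<longleftrightarrow> |elts (omega1 :: 'v)| \<le>o |A|"
  unfolding countable_ordLeq_omega omega1_def card_succ_ordLeq_iff by simp

lemma ordLess_omega2_iff:
  "|A| <o |elts (omega2 :: 'v::zfc)| \<longleftrightarrow> |A| \<le>o |elts (omega1 :: 'v)|"
  unfolding omega2_def by (rule ordLess_card_succ_iff)

lemma countable_ordLeq_omega1:
  "countable (A :: 'v::zfc set) \<Longrightarrow> |A| \<le>o |elts (omega1 :: 'v)|"
  unfolding countable_ordLeq_omega omega1_def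
  by (rule ordLeq_transitive[OF _ ordLess_imp_ordLeq[OF card_succ_greater]])

subsection \<open>Ordered pairs\<close>

lemma elts_opair: "elts (opair x y) = {vset {x}, vset {x, y}}"
  unfolding opair_def by simp

lemma opair_inject [simp]: "opair x y = opair x' y' \<longleftrightarrow> x = x' \<and> y = y'"
proof
  assume "opair x y = opair x' y'"
  then have "{vset {x}, vset {x, y}} = {vset {x'}, vset {x', y'}}"
    by (metis elts_opair)
  then have "elts ` {vset {x}, vset {x, y}} = elts ` {vset {x'}, vset {x', y'}}" by simp
  then have "{{x}, {x, y}} = {{x'}, {x', y'}}" by simp
  then show "x = x' \<and> y = y'" by (auto simp: doubleton_eq_iff)
qed simp

subsection \<open>Absoluteness\<close>

definition Limit :: "'v::zfc \<Rightarrow> bool" where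
  "Limit x \<longleftrightarrow> Ord x \<and> elts x \<noteq> {} \<and> (\<forall>y\<in>elts x. \<exists>z\<in>elts x. y \<in> elts z)"

lemma Limit_omega: "Limit omega"
  unfolding Limit_def
proof (intro conjI ballI)
  show "elts omega \<noteq> {}" by (rule infinite_imp_nonempty[OF infinite_omega])
  fix y :: 'a assume y: "y \<in> elts omega"
  show "\<exists>z\<in>elts omega. y \<in> elts z"
    by (rule bexI[of _ "vset (insert y (elts y))"]) (simp_all add: Card_limit[OF Card_omega infinite_omega y])
qed (rule Ord_omega)

text \<open>Limits are infinite and elements of \<open>omega\<close> are finite. This links the
  cardinality definition of \<open>omega\<close> with the formula \<open>is_omega\<close>.\<close>

lemma omega_iff_Limit: "w = omega \<longleftrightarrow> Limit w \<and> (\<forall>x\<in>elts w. \<not> Limit x)"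
proof -
  have inf: "infinite (elts x)" if "Limit x" for x :: 'a
    using that inductive_infinite[of "elts x"] unfolding Limit_def by blast
  have "w = omega" if w: "Limit w" "\<forall>x\<in>elts w. \<not> Limit x"
  proof -
    have ow: "Ord w" using w by (simp add: Limit_def)
    have "w \<notin> elts omega" using inf[OF w(1)] finite_mem_omega by blast
    moreover have "omega \<notin> elts w" using w(2) Limit_omega by blast
    ultimately show ?thesis using Ord_linear[OF ow Ord_omega] by blast
  qed
  then show ?thesis using Limit_omega inf finite_mem_omega by blast
qed

text \<open>Closure properties that make the formulas below absolute for the structure \<open>(M, \<in>)\<close>. They
  hold for elementary submodels and for the universe; \<open>M\<close> need not be transitive.\<close>

locale absolute =
  fixes M :: "'v::zfc set"
  assumes pair_closed: "x \<in> M \<Longrightarrow> y \<in> M \<Longrightarrow> vset {x, y} \<in> M"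
    and mem_diff: "x \<in> M \<Longrightarrow> y \<in> M \<Longrightarrow> z \<in> elts x \<Longrightarrow> z \<notin> elts y \<Longrightarrow> \<exists>z\<in>M. z \<in> elts x \<and> z \<notin> elts y"
    and mem_nonsub: "x \<in> M \<Longrightarrow> z \<in> elts x \<Longrightarrow> \<not> elts z \<subseteq> elts x \<Longrightarrow>
      \<exists>z\<in>M. z \<in> elts x \<and> \<not> elts z \<subseteq> elts x"
    and mem_nontrans: "x \<in> M \<Longrightarrow> z \<in> elts x \<Longrightarrow> \<not> (\<forall>y\<in>elts z. elts y \<subseteq> elts z) \<Longrightarrow>
      \<exists>z\<in>M. z \<in> elts x \<and> \<not> (\<forall>y\<in>elts z. elts y \<subseteq> elts z)"
    and mem_ex: "x \<in> M \<Longrightarrow> z \<in> elts x \<Longrightarrow> \<exists>z\<in>M. z \<in> elts x"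
    and mem_above: "x \<in> M \<Longrightarrow> y \<in> M \<Longrightarrow> z \<in> elts x \<Longrightarrow> y \<in> elts z \<Longrightarrow> \<exists>z\<in>M. z \<in> elts x \<and> y \<in> elts z"
    and mem_max: "x \<in> M \<Longrightarrow> z \<in> elts x \<Longrightarrow> (\<forall>t\<in>elts x. z \<notin> elts t) \<Longrightarrow>
      \<exists>z\<in>M. z \<in> elts x \<and> (\<forall>t\<in>elts x. z \<notin> elts t)"
    and mem_Limit: "x \<in> M \<Longrightarrow> z \<in> elts x \<Longrightarrow> Limit z \<Longrightarrow> \<exists>z\<in>M. z \<in> elts x \<and> Limit z"
    and mem_dom: "x \<in> M \<Longrightarrow> f \<in> M \<Longrightarrow> z \<in> elts x \<Longrightarrow> (\<forall>y. opair z y \<notin> elts f) \<Longrightarrow>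
      \<exists>z\<in>M. z \<in> elts x \<and> (\<forall>y. opair z y \<notin> elts f)"
    and mem_ran: "f \<in> M \<Longrightarrow> b \<in> M \<Longrightarrow> u \<in> elts f \<Longrightarrow> (\<forall>x. \<forall>y\<in>elts b. u \<noteq> opair x y) \<Longrightarrow>
      \<exists>u\<in>M. u \<in> elts f \<and> (\<forall>x. \<forall>y\<in>elts b. u \<noteq> opair x y)"
    and mem_coll: "f \<in> M \<Longrightarrow> opair x y \<in> elts f \<Longrightarrow> opair x' y \<in> elts f \<Longrightarrow> x \<noteq> x' \<Longrightarrow>
      \<exists>x\<in>M. \<exists>x'\<in>M. \<exists>y\<in>M. opair x y \<in> elts f \<and> opair x' y \<in> elts f \<and> x \<noteq> x'"
begin

abbreviation (input) "AllM \<equiv> \<lambda>F. \<forall>x. x \<in> M \<longrightarrow> F x"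
abbreviation (input) "E \<equiv> \<lambda>x y. x \<in> elts y"

lemma ext: 
  assumes "x \<in> M" "y \<in> M" "\<And>z. z \<in> M \<Longrightarrow> z \<in> elts x \<longleftrightarrow> z \<in> elts y"
  shows "x = y"
proof (rule ccontr)
  assume "x \<noteq> y"
  then have "elts x \<noteq> elts y" using extensionality by blast
  then obtain z where "z \<in> elts x \<and> z \<notin> elts y \<or> z \<in> elts y \<and> z \<notin> elts x" by blast
  then show False using mem_diff[of x y z] mem_diff[of y x z] assms by blast
qed

lemmas connectives = formulas.Disj_def formulas.Imp_def formulas.Iff_def formulas.Ex_def

lemma sub: "x \<in> M \<Longrightarrow> y \<in> M \<Longrightarrow> formulas.Sub E Not (\<and>) AllM x y \<longleftrightarrow> elts x \<subseteq> elts y"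
  unfolding formulas.Sub_def connectives using mem_diff[of x y] by blast

lemma upair: "u \<in> M \<Longrightarrow> x \<in> M \<Longrightarrow> y \<in> M \<Longrightarrow>
    formulas.is_upair E (=) Not (\<and>) AllM u x y \<longleftrightarrow> u = vset {x, y}"
  unfolding formulas.is_upair_def connectives using ext[OF _ pair_closed[of x y], of u] by auto

lemma opair_closed: "x \<in> M \<Longrightarrow> y \<in> M \<Longrightarrow> opair x y \<in> M"
  unfolding opair_def using pair_closed[of x x] pair_closed[of x y] pair_closed by simp

lemma opair: "u \<in> M \<Longrightarrow> x \<in> M \<Longrightarrow> y \<in> M \<Longrightarrow>
    formulas.is_opair E (=) Not (\<and>) AllM u x y \<longleftrightarrow> u = opair x y"
  unfolding formulas.is_opair_def connectives using pair_closed[of x x] pair_closed[of x y]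
  by (auto simp: upair opair_def)

lemma pair_in: "x \<in> M \<Longrightarrow> y \<in> M \<Longrightarrow> f \<in> M \<Longrightarrow>
    formulas.pair_in E (=) Not (\<and>) AllM x y f \<longleftrightarrow> opair x y \<in> elts f"
  unfolding formulas.pair_in_def connectives using opair_closed[of x y]
  by (auto simp: opair)

lemma transitive: "x \<in> M \<Longrightarrow>
    formulas.is_transitive E Not (\<and>) AllM x \<longleftrightarrow> (\<forall>y\<in>elts x. elts y \<subseteq> elts x)"
  unfolding formulas.is_transitive_def connectives using mem_nonsub[of x] by (auto simp: sub)

lemma ordinal: "x \<in> M \<Longrightarrow> formulas.is_ordinal E Not (\<and>) AllM x \<longleftrightarrow> Ord x"
proof -
  assume x: "x \<in> M"
  have "(\<forall>y. y \<in> M \<longrightarrow> y \<in> elts x \<longrightarrow> (\<forall>z\<in>elts y. elts z \<subseteq> elts y)) \<longleftrightarrow>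
      (\<forall>y\<in>elts x. \<forall>z\<in>elts y. elts z \<subseteq> elts y)"
    using mem_nontrans[OF x] by blast
  then show ?thesis
    unfolding formulas.is_ordinal_def connectives Ord_iff using x by (simp add: transitive) blast
qed

lemma limit: "x \<in> M \<Longrightarrow> formulas.is_limit E Not (\<and>) AllM x \<longleftrightarrow> Limit x"
  unfolding formulas.is_limit_def connectives Limit_def 
  using mem_ex[of x] mem_above[of x] mem_max[of x] 
  by (auto simp: ordinal) (metis | blast)+

lemma omega: "w \<in> M \<Longrightarrow> formulas.is_omega E Not (\<and>) AllM w \<longleftrightarrow> w = omega"
  unfolding formulas.is_omega_def connectives omega_iff_Limit using mem_Limit[of w]
  by (auto simp: limit)

text \<open>The formula speaks only of elements of \<open>M\<close>. But a failure anywhere of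
  totality on \<open>a\<close>, of having values in \<open>w\<close>, or of injectivity is reflected
  into \<open>M\<close> by \<open>mem_dom\<close>, \<open>mem_ran\<close> and
  \<open>mem_coll\<close>. So choosing a value for each element of \<open>a\<close> gives an
  injection into \<open>w\<close>.\<close>

lemma injection_countable:
  assumes M: "f \<in> M" "a \<in> M" "w \<in> M"
    and inj: "formulas.is_injection E (=) Not (\<and>) AllM f a w"
    and w: "countable (elts w)"
  shows "countable (elts a)"
proof -
  have "\<exists>y. y \<in> M \<and> opair x y \<in> elts f" if "x \<in> M" "x \<in> elts a" for x
    using inj that M unfolding formulas.is_injection_def connectives by (auto simp: pair_in)
  then have dom: "\<exists>y. opair x y \<in> elts f" if "x \<in> elts a" for x
    using mem_dom[of a f] M that by blast
  have "\<exists>x y. y \<in> elts w \<and> u = opair x y" if "u \<in> M" "u \<in> elts f" for u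
    using inj that M unfolding formulas.is_injection_def connectives by (auto simp: opair)
  then have ran: "y \<in> elts w" if "opair x y \<in> elts f" for x y
    using mem_ran[of f w "opair x y"] M that by force
  have "x = x'" if "x \<in> M" "x' \<in> M" "y \<in> M" "opair x y \<in> elts f" "opair x' y \<in> elts f" for x x' y
    using inj that M unfolding formulas.is_injection_def connectives by (auto simp: pair_in)
  then have coll: "x = x'" if "opair x y \<in> elts f" "opair x' y \<in> elts f" for x x' y
    using mem_coll[of f x y x'] M that by blast
  define g where "g x = (SOME y. opair x y \<in> elts f)" for x
  have g: "opair x (g x) \<in> elts f" if "x \<in> elts a" for x
    unfolding g_def by (rule someI_ex[OF dom[OF that]])
  have "inj_on g (elts a)" by (rule inj_onI) (metis g coll)
  moreover have "countable (g ` elts a)"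
    by (rule countable_subset[OF _ w]) (auto intro: ran g)
  ultimately show ?thesis by (rule countable_image_inj_on[rotated])
qed

lemma countable:
  assumes "a \<in> M" "formulas.is_countable E (=) Not (\<and>) AllM a"
  shows "countable (elts a)"
proof -
  obtain w f where "w \<in> M" "f \<in> M" "formulas.is_omega E Not (\<and>) AllM w"
    "formulas.is_injection E (=) Not (\<and>) AllM f a w"
    using assms(2) unfolding formulas.is_countable_def connectives by blast
  then show ?thesis using injection_countable[of f a w] assms(1) countable_omega by (simp add: omega)
qed

end

interpretation V: absolute "UNIV :: 'v::zfc set"
  by unfold_locales blast+

lemma formula_ordinal: "formulas.is_ordinal (\<lambda>x y. x \<in> elts y) Not (\<and>) HOL.All x \<longleftrightarrow> Ord x"
  unfolding Ord_def ..

lemma formula_countable: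
  fixes a :: "'v::zfc"
  shows "formulas.is_countable (\<lambda>x y. x \<in> elts y) (=) Not (\<and>) HOL.All a \<longleftrightarrow> countable (elts a)"
proof
  assume "formulas.is_countable (\<lambda>x y. x \<in> elts y) (=) Not (\<and>) HOL.All a"
  then show "countable (elts a)" using V.countable[of a] by simp
next
  assume "countable (elts a)"
  then obtain g :: "'v \<Rightarrow> 'v" where g: "inj_on g (elts a)" "g ` elts a \<subseteq> elts omega"
    unfolding countable_ordLeq_omega by (rule card_ordLeqE)
  define f where "f = vset ((\<lambda>x. opair x (g x)) ` elts a)"
  have ef: "elts f = (\<lambda>x. opair x (g x)) ` elts a" unfolding f_def by simp
  have "formulas.is_omega (\<lambda>x y. x \<in> elts y) Not (\<and>) HOL.All omega"
    using V.omega[of omega] by simp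
  moreover have "formulas.is_injection (\<lambda>x y. x \<in> elts y) (=) Not (\<and>) HOL.All f a omega"
  proof -
    have op: "formulas.is_opair (\<lambda>x y. x \<in> elts y) (=) Not (\<and>) HOL.All u x y \<longleftrightarrow> u = opair x y"
      for u x y :: 'v using V.opair[of u x y] by simp
    have pi: "formulas.pair_in (\<lambda>x y. x \<in> elts y) (=) Not (\<and>) HOL.All x y f \<longleftrightarrow> x \<in> elts a \<and> y = g x"
      for x y :: 'v using V.pair_in[of x y f] by (auto simp: ef)
    have "\<forall>u\<in>elts f. \<exists>x y. x \<in> elts a \<and> y \<in> elts omega \<and> u = opair x y"
      using g(2) by (auto simp: ef)
    moreover have "\<forall>x x' y. (x \<in> elts a \<and> y = g x) \<and> (x' \<in> elts a \<and> y = g x') \<longrightarrow> x = x'"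
      using g(1) by (auto simp: inj_on_def)
    ultimately show ?thesis
      unfolding formulas.is_injection_def V.connectives op pi by blast
  qed
  ultimately show "formulas.is_countable (\<lambda>x y. x \<in> elts y) (=) Not (\<and>) HOL.All a"
    unfolding formulas.is_countable_def V.connectives by blast
qed

lemma formula_omega1:
  "formulas.is_omega1 (\<lambda>x y. x \<in> elts y) (=) Not (\<and>) HOL.All omega1"
  unfolding formulas.is_omega1_def V.connectives formula_countable formula_ordinal
  using uncountable_omega1 countable_mem_omega1 Card_Ord[OF Card_omega1] by blast

subsection \<open>Trivial forcing\<close>

text \<open>Evaluation of a name with conditions ignored, as is right when the only condition lies
  in the generic filter. The recursion descends three membership steps, through the Kuratowski
  pair.\<close>

function val :: "'v::zfc \<Rightarrow> 'v" where
  "val \<tau> = vset (val ` {\<sigma>. \<exists>s. opair \<sigma> s \<in> elts \<tau>})"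
  by auto
termination
proof (relation "{(x, y). x \<in> elts y}\<^sup>+")
  show "wf ({(x, y :: 'v::zfc). x \<in> elts y}\<^sup>+)" by (rule wf_trancl[OF foundation])
  fix \<tau> \<sigma> :: "'v::zfc" assume "\<sigma> \<in> {\<sigma>. \<exists>s. opair \<sigma> s \<in> elts \<tau>}"
  then obtain s where s: "opair \<sigma> s \<in> elts \<tau>" by blast
  have 1: "\<sigma> \<in> elts (vset {\<sigma>})" by simp
  have 2: "vset {\<sigma>} \<in> elts (opair \<sigma> s)" by (simp add: elts_opair)
  show "(\<sigma>, \<tau>) \<in> {(x, y). x \<in> elts y}\<^sup>+"
    by (rule trancl_into_trancl[OF trancl_into_trancl[OF r_into_trancl]]) (use s 1 2 in auto)
qed

declare val.simps [simp del]

lemma elts_val: "elts (val \<tau>) = val ` {\<sigma>. \<exists>s. opair \<sigma> s \<in> elts \<tau>}"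
proof -
  have "{\<sigma>. \<exists>s. opair \<sigma> s \<in> elts \<tau>} \<subseteq> (\<lambda>z. SOME \<sigma>. \<exists>s. z = opair \<sigma> s) ` elts \<tau>"
  proof clarify
    fix \<sigma> s assume s: "opair \<sigma> s \<in> elts \<tau>"
    have "\<sigma> = (SOME \<sigma>'. \<exists>s'. opair \<sigma> s = opair \<sigma>' s')" by simp
    then show "\<sigma> \<in> (\<lambda>z. SOME \<sigma>. \<exists>s. z = opair \<sigma> s) ` elts \<tau>" by (rule image_eqI[OF _ s])
  qed
  then have "small {\<sigma>. \<exists>s. opair \<sigma> s \<in> elts \<tau>}" by (rule small_subset[rotated]) simp
  then show ?thesis by (subst val.simps) simp
qed

context
  includes lifting_syntax
  fixes R :: "'a \<Rightarrow> 'b \<Rightarrow> bool" and T :: "'c \<Rightarrow> 'd \<Rightarrow> bool"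
    and Mem Mem' Eq Eq' Neg Neg' Conj Conj'
  assumes rels [transfer_rule]:
    "(R ===> R ===> T) Mem Mem'" "(R ===> R ===> T) Eq Eq'" "(T ===> T) Neg Neg'"
    "(T ===> T ===> T) Conj Conj'"
begin

text \<open>The formulas are polymorphic in their interpretations, so interpretations related by
  \<open>R\<close> on objects and \<open>T\<close> on truth values yield related truth values. With
  names on one side and sets on the other, this takes the place of an induction on formulas.\<close>

lemma parametric_countable:
  assumes [transfer_rule]: "((R ===> T) ===> T) Q Q'"
  shows "(R ===> T) (formulas.is_countable Mem Eq Neg Conj Q) (formulas.is_countable Mem' Eq' Neg' Conj' Q')"
  unfolding formulas.is_countable_def formulas.is_injection_def
    formulas.is_omega_def formulas.is_limit_def formulas.is_ordinal_def formulas.is_transitive_def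
    formulas.Sub_def formulas.pair_in_def formulas.is_opair_def formulas.is_upair_def
    formulas.Iff_def formulas.Imp_def formulas.Ex_def formulas.Disj_def
  by transfer_prover

lemma parametric_connectives:
  "(T ===> T ===> T) (formulas.Imp Neg Conj) (formulas.Imp Neg' Conj')"
  "(T ===> T ===> T) (formulas.Iff Neg Conj) (formulas.Iff Neg' Conj')"
  unfolding formulas.Imp_def formulas.Iff_def by transfer_prover+

context
  fixes Q Q'
  assumes Q [transfer_rule]: "((R ===> T) ===> T) Q Q'"
begin

lemma parametric_ordinal:
  "(R ===> T) (formulas.is_ordinal Mem Neg Conj Q) (formulas.is_ordinal Mem' Neg' Conj' Q')"
  unfolding formulas.is_ordinal_def formulas.is_transitive_def formulas.Sub_def formulas.Imp_def
  by transfer_prover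

lemma parametric_omega1:
  "(R ===> T) (formulas.is_omega1 Mem Eq Neg Conj Q) (formulas.is_omega1 Mem' Eq' Neg' Conj' Q')"
  supply parametric_countable [transfer_rule] parametric_ordinal [transfer_rule]
  unfolding formulas.is_omega1_def formulas.Imp_def by transfer_prover

text \<open>Here the quantifier itself depends on \<open>N\<close>: its restrictions to related
  \<open>N\<close> and \<open>N'\<close> are shown to be related before
  \<open>parametric_countable\<close> is applied to them.\<close>

lemma parametric_models_countable:
  "(R ===> R ===> T) (formulas.models_countable Mem Eq Neg Conj Q) (formulas.models_countable Mem' Eq' Neg' Conj' Q')"
proof (intro rel_funI)
  fix N N' a a' assume [transfer_rule]: "R N N'" and a: "R a a'"
  have "((R ===> T) ===> T) (\<lambda>F. Q (\<lambda>x. formulas.Imp Neg Conj (Mem x N) (F x)))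
     (\<lambda>F. Q' (\<lambda>x. formulas.Imp Neg' Conj' (Mem' x N') (F x)))"
    supply parametric_connectives [transfer_rule] by transfer_prover
  from rel_funD[OF parametric_countable[OF this] a]
  show "T (formulas.models_countable Mem Eq Neg Conj Q N a) (formulas.models_countable Mem' Eq' Neg' Conj' Q' N' a')"
    unfolding formulas.models_countable_def .
qed

lemma parametric_guessing:
  "(R ===> T) (formulas.omega1_guessing Mem Eq Neg Conj Q) (formulas.omega1_guessing Mem' Eq' Neg' Conj' Q')"
  supply parametric_models_countable [transfer_rule] parametric_ordinal [transfer_rule]
    parametric_connectives [transfer_rule]
  unfolding formulas.omega1_guessing_def formulas.guessed_def formulas.countably_approximated_def
    formulas.is_sup_def formulas.is_ordinal_part_def formulas.is_inter_def
    formulas.Sub_def formulas.Ex_def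
  by transfer_prover

end

end

locale trivial_forcing =
  fixes c :: "'v::zfc"
begin

definition P :: 'v where "P = vset {c}"
text \<open>With the constantly true order, \<open>dense_below P le p D\<close> means
  \<open>D c\<close> for every \<open>p\<close>, even outside \<open>P\<close>, so the results below
  hold for arbitrary \<open>p\<close>.\<close>

definition le :: "'v \<Rightarrow> 'v \<Rightarrow> bool" where "le p q = True"

lemma elts_P [simp]: "elts P = {c}" by (simp add: P_def)

lemma forcing_poset: "forcing_poset P le"
  by (simp add: forcing_poset_def le_def)

lemma dense_below [simp]: "dense_below P le p D \<longleftrightarrow> D c"
  by (simp add: dense_below_def le_def)

lemma force_eq: "force_eq P le \<tau> \<sigma> p \<longleftrightarrow> val \<tau> = val \<sigma>"
proof (induction \<tau> arbitrary: \<sigma> p rule: val.induct)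
  case (1 \<tau>)
  note IH = 1
  have IH: "force_eq P le \<pi> \<rho> p \<longleftrightarrow> val \<pi> = val \<rho>" if "opair \<pi> s \<in> elts \<tau>" for \<pi> \<rho> s p
    using IH that by blast
  have "force_eq P le \<tau> \<sigma> p \<longleftrightarrow>
     (\<forall>\<pi> s. opair \<pi> s \<in> elts \<tau> \<longrightarrow> (\<exists>\<rho> t. opair \<rho> t \<in> elts \<sigma> \<and> val \<pi> = val \<rho>)) \<and>
     (\<forall>\<rho> t. opair \<rho> t \<in> elts \<sigma> \<longrightarrow> (\<exists>\<pi> s. opair \<pi> s \<in> elts \<tau> \<and> val \<pi> = val \<rho>))"
    by (subst force_eq.simps) (simp add: le_def IH cong: conj_cong)
  also have "\<dots> \<longleftrightarrow> elts (val \<tau>) = elts (val \<sigma>)"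
  proof -
    have "elts (val \<tau>) = elts (val \<sigma>) \<longleftrightarrow>
      (\<forall>\<pi>. (\<exists>s. opair \<pi> s \<in> elts \<tau>) \<longrightarrow> val \<pi> \<in> elts (val \<sigma>)) \<and>
      (\<forall>\<rho>. (\<exists>t. opair \<rho> t \<in> elts \<sigma>) \<longrightarrow> val \<rho> \<in> elts (val \<tau>))"
      unfolding elts_val set_eq_subset image_subset_iff by simp
    moreover have "val \<pi> \<in> elts (val \<sigma>) \<longleftrightarrow> (\<exists>\<rho> t. opair \<rho> t \<in> elts \<sigma> \<and> val \<pi> = val \<rho>)" for \<pi>
      unfolding elts_val by auto
    moreover have "val \<rho> \<in> elts (val \<tau>) \<longleftrightarrow> (\<exists>\<pi> s. opair \<pi> s \<in> elts \<tau> \<and> val \<pi> = val \<rho>)" for \<rho>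
      unfolding elts_val image_iff by (simp add: eq_commute)
    ultimately show ?thesis by simp
  qed
  also have "\<dots> \<longleftrightarrow> val \<tau> = val \<sigma>" by (metis extensionality)
  finally show ?case .
qed

lemma force_mem: "force_mem P le \<tau> \<sigma> p \<longleftrightarrow> val \<tau> \<in> elts (val \<sigma>)"
  by (auto simp: force_mem_def force_eq le_def elts_val)

lemma elts_check: "elts (check_name P x) = (\<lambda>y. opair (check_name P y) c) ` elts x"
  by (subst check_name.simps) simp

lemma val_check [simp]: "val (check_name P x) = x"
proof (induction x rule: mem_induct)
  case (mem x)
  have "elts (val (check_name P x)) = elts x"
    unfolding elts_val elts_check using mem by force
  then show ?case by (rule extensionality)
qed

lemma is_name_check: "is_name P (check_name P x)"
proof (induction x rule: mem_induct)
  case (mem x)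
  show ?case by (rule is_name.intros) (use mem in \<open>auto simp: elts_check\<close>)
qed

text \<open>Restricted to names because \<open>force_all\<close> ranges over names. Every set is the
  value of its check name, and this makes the two universal quantifiers correspond.\<close>

definition R :: "'v \<Rightarrow> 'v \<Rightarrow> bool" where "R \<tau> x \<longleftrightarrow> is_name P \<tau> \<and> val \<tau> = x"
definition T :: "('v \<Rightarrow> bool) \<Rightarrow> bool \<Rightarrow> bool" where "T A b \<longleftrightarrow> A c = b"

context
  includes lifting_syntax
begin

lemma rels:
  "(R ===> R ===> T) (force_mem P le) (\<lambda>x y. x \<in> elts y)"
  "(R ===> R ===> T) (force_eq P le) (=)"
  "(T ===> T) (force_neg P le) Not"
  "(T ===> T ===> T) force_conj (\<and>)"
  "((R ===> T) ===> T) (force_all P) HOL.All"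
proof -
  show "((R ===> T) ===> T) (force_all P) HOL.All"
    unfolding rel_fun_def R_def T_def force_all_def using is_name_check val_check by metis
qed (simp_all add: rel_fun_def R_def T_def force_mem force_eq force_neg_def force_conj_def le_def)

lemma transfer_omega1:
  "(R ===> T) (formulas.is_omega1 (force_mem P le) (force_eq P le) (force_neg P le) force_conj (force_all P))
     (formulas.is_omega1 (\<lambda>x y. x \<in> elts y) (=) Not (\<and>) HOL.All)"
  by (rule parametric_omega1[OF rels])

lemma transfer_guessing:
  "(R ===> T) (formulas.omega1_guessing (force_mem P le) (force_eq P le) (force_neg P le) force_conj (force_all P))
     (formulas.omega1_guessing (\<lambda>x y. x \<in> elts y) (=) Not (\<and>) HOL.All)"
  by (rule parametric_guessing[OF rels])

end

lemma check_omega1_guessing: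
  assumes "indestructibly_omega1_guessing (N :: 'v)"
  shows "formulas.omega1_guessing (\<lambda>x y. x \<in> elts y) (=) Not (\<and>) HOL.All N"
proof -
  have R: "R (check_name P x) x" for x by (simp add: R_def is_name_check)
  have "preserves_omega1 P le"
    using rel_funD[OF transfer_omega1 R[of omega1]] formula_omega1
    unfolding preserves_omega1_def T_def by simp
  then have "forces_omega1_guessing P le N"
    using assms forcing_poset unfolding indestructibly_omega1_guessing_def by blast
  then show ?thesis
    using rel_funD[OF transfer_guessing R[of N]] 
    unfolding forces_omega1_guessing_def T_def by simp
qed

end

lemma omega1_guessingD:
  fixes N :: "'v::zfc"
  assumes N: "indestructibly_omega1_guessing N" and "absolute (elts N)"
    and d: "d \<subseteq> elts N" "\<And>x. x \<in> d \<Longrightarrow> Ord x"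
    and s: "d \<subseteq> elts s" "s \<in> elts s'" "Ord s'" "s' \<in> elts N"
    and approx: "\<And>a. a \<in> elts N \<Longrightarrow> countable (elts a) \<Longrightarrow> vset (d \<inter> elts a) \<in> elts N"
  obtains e where "e \<in> elts N" "elts e \<inter> elts N = d"
proof -
  interpret absolute "elts N" by fact
  interpret trivial_forcing N .
  have g: "formulas.omega1_guessing (\<lambda>x y. x \<in> elts y) (=) Not (\<and>) HOL.All N"
    by (rule check_omega1_guessing[OF N])
  define n where "n = vset {x \<in> elts N. Ord x}"
  define D where "D = vset d"
  have n: "elts n = {x \<in> elts N. Ord x}"
    unfolding n_def by (rule elts_vset, rule small_subset[OF small_elts[of N]]) auto
  have D: "elts D = d" unfolding D_def by (rule elts_vset[OF small_subset[OF small_elts d(1)]])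
  define sd where "sd = least_ord (\<lambda>t. \<forall>y\<in>d. elts y \<subseteq> elts t)"
  define tn where "tn = least_ord (\<lambda>t. \<forall>y\<in>elts n. elts y \<subseteq> elts t)"
  have Os: "Ord s" using s Ord_mem by blast
  have bd: "\<forall>y\<in>d. elts y \<subseteq> elts s" using Ord_subset[OF Os] s(1) by blast
  have bn: "Ord (sup_ord (elts n))" "\<forall>y\<in>elts n. elts y \<subseteq> elts (sup_ord (elts n))"
    by (auto simp: n elts_sup_ord[OF small_elts[of n], unfolded n]
        intro!: Ord_sup_ord[OF small_elts[of n], unfolded n])
  note sd = least_ord[where P = "\<lambda>t. \<forall>y\<in>d. elts y \<subseteq> elts t", OF Os bd, folded sd_def]
    least_ord_subset[where P = "\<lambda>t. \<forall>y\<in>d. elts y \<subseteq> elts t", folded sd_def]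
  note tn = least_ord[where P = "\<lambda>t. \<forall>y\<in>elts n. elts y \<subseteq> elts t", OF bn, folded tn_def]
    least_ord_subset[where P = "\<lambda>t. \<forall>y\<in>elts n. elts y \<subseteq> elts t", folded tn_def]
  \<comment> \<open>The bound needed is sup d \<le> s < s' \<le> sup (N \<inter> On), where the last
    step holds because s' is an ordinal in \<open>N\<close>.\<close>
  have "sd \<in> elts s'"
    using sd(4)[OF Os bd] s(2,3) Ord_subset_iff[OF sd(1) Os] Ord_trans[of s' s sd] by blast
  moreover have "elts s' \<subseteq> elts tn" using tn(2) s(3,4) by (simp add: n)
  ultimately have "sd \<in> elts tn" by blast
  have "formulas.guessed (\<lambda>x y. x \<in> elts y) Not (\<and>) HOL.All D N"
  proof -
    have 1: "formulas.is_ordinal_part (\<lambda>x y. x \<in> elts y) Not (\<and>) HOL.All n N"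
      unfolding formulas.is_ordinal_part_def connectives formula_ordinal by (simp add: n)
    have 2: "formulas.Sub (\<lambda>x y. x \<in> elts y) Not (\<and>) HOL.All D n"
      using d by (auto simp: V.sub[simplified] D n)
    have 3: "formulas.is_sup (\<lambda>x y. x \<in> elts y) Not (\<and>) HOL.All sd D"
      unfolding formulas.is_sup_def connectives formula_ordinal
      using sd(1,2,4) by (simp add: V.sub[simplified] D) blast
    have 4: "formulas.is_sup (\<lambda>x y. x \<in> elts y) Not (\<and>) HOL.All tn n"
      unfolding formulas.is_sup_def connectives formula_ordinal
      using tn(1,2,4) by (simp add: V.sub[simplified]) blast
    have 5: "formulas.countably_approximated (\<lambda>x y. x \<in> elts y) (=) Not (\<and>) HOL.All D N"
      unfolding formulas.countably_approximated_def formulas.models_countable_def connectives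
        formulas.is_inter_def
    proof safe
      fix a assume a: "a \<in> elts N" "formulas.is_countable (\<lambda>x y. x \<in> elts y) (=) Not (\<and>)
        (\<lambda>F. \<forall>x. \<not> (x \<in> elts N \<and> \<not> F x)) a"
      assume *: "\<forall>b. \<not> ((\<forall>z. \<not> (z \<in> elts b \<and> \<not> (z \<in> elts D \<and> z \<in> elts a)) \<and>
          \<not> ((z \<in> elts D \<and> z \<in> elts a) \<and> z \<notin> elts b)) \<and> b \<in> elts N)"
      have "countable (elts a)" using countable[OF a(1)] a(2) by simp
      from approx[OF a(1) this] have "vset (d \<inter> elts a) \<in> elts N" .
      moreover have "elts (vset (d \<inter> elts a)) = d \<inter> elts a"
        by (rule elts_vset, rule small_subset[OF small_elts[of a]]) auto
      ultimately show False using *[rule_format, of "vset (d \<inter> elts a)"] by (simp add: D)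
    qed
    show ?thesis
      using g 1 2 3 4 5 \<open>sd \<in> elts tn\<close>
      unfolding formulas.omega1_guessing_def connectives by blast
  qed
  then obtain e where "e \<in> elts N" "elts e \<inter> elts N = d"
    unfolding formulas.guessed_def formulas.is_inter_def connectives D by blast
  then show ?thesis by (rule that)
qed

subsection \<open>Guessing models\<close>

lemma infinite_Un_ordLeq:
  assumes "infinite B" "|A| \<le>o |B|" "|C| \<le>o |B|"
  shows "|A \<union> C| \<le>o |B|"
  by (rule card_of_Un_ordLeq_infinite_Field) (use assms in simp_all)

lemma nat_UN_ordLeq:
  assumes "infinite B" "\<And>n :: nat. |A n| \<le>o |B|"
  shows "|\<Union>n. A n| \<le>o |B|"
  by (rule card_of_UNION_ordLeq_infinite) (use assms in \<open>simp_all add: infinite_iff_card_of_nat\<close>)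

lemma closure_exists:
  fixes G :: "'v \<Rightarrow> 'v \<Rightarrow> 'v set" and B :: "'b set"
  assumes B: "infinite B" and A: "|A| \<le>o |B|" "A \<subseteq> X"
    and G: "\<And>x y. |G x y| \<le>o |B|" "\<And>x y. x \<in> X \<Longrightarrow> y \<in> X \<Longrightarrow> G x y \<subseteq> X"
  obtains U where "A \<subseteq> U" "U \<subseteq> X" "|U| \<le>o |B|" "\<And>x y. x \<in> U \<Longrightarrow> y \<in> U \<Longrightarrow> G x y \<subseteq> U"
proof
  define S where "S = rec_nat A (\<lambda>n V. V \<union> (\<Union>x\<in>V. \<Union>y\<in>V. G x y))"
  have S: "S 0 = A" "\<And>n. S (Suc n) = S n \<union> (\<Union>x\<in>S n. \<Union>y\<in>S n. G x y)"
    by (simp_all add: S_def)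
  show "A \<subseteq> (\<Union>n. S n)" using S(1) by blast
  have "S n \<subseteq> X" for n
  proof (induction n)
    case (Suc n)
    then have "G x y \<subseteq> X" if "x \<in> S n" "y \<in> S n" for x y using that G(2) by blast
    then show ?case unfolding S(2) using Suc by blast
  qed (simp add: S A)
  then show "(\<Union>n. S n) \<subseteq> X" by blast
  have "|S n| \<le>o |B|" for n
  proof (induction n)
    case (Suc n)
    show ?case unfolding S(2)
      by (intro infinite_Un_ordLeq B Suc card_of_UNION_ordLeq_infinite ballI G(1))
  qed (simp add: S A)
  then show "|\<Union>n. S n| \<le>o |B|" by (rule nat_UN_ordLeq[OF B])
  have mono: "m \<le> n \<Longrightarrow> S m \<subseteq> S n" for m n
    by (rule lift_Suc_mono_le) (auto simp: S(2))
  fix x y assume "x \<in> (\<Union>n. S n)" "y \<in> (\<Union>n. S n)"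
  then obtain m n where mn: "x \<in> S m" "y \<in> S n" by blast
  have "x \<in> S (max m n)" "y \<in> S (max m n)"
    using mn mono[of m "max m n"] mono[of n "max m n"] by auto
  then have "G x y \<subseteq> S (Suc (max m n))" unfolding S(2) by blast
  then show "G x y \<subseteq> (\<Union>n. S n)" by blast
qed

lemma mem_P_less_omega2_iff:
  fixes a :: "'v::zfc"
  shows "a \<in> P_less omega2 X \<longleftrightarrow> elts a \<subseteq> X \<and> |elts a| \<le>o |elts (omega1 :: 'v)|"
  by (simp add: P_less_def ordLess_omega2_iff)

text \<open>Unboundedness is closing off in \<omega> steps. For unions, a chain puts any two
  arguments into one member, which is closed under \<open>G\<close>.\<close>

lemma club_closed:
  fixes G :: "'v::zfc \<Rightarrow> 'v \<Rightarrow> 'v set"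
  assumes c: "|c| \<le>o |elts (omega1 :: 'v)|" "c \<subseteq> X"
    and G: "\<And>x y. |G x y| \<le>o |elts (omega1 :: 'v)|" "\<And>x y. x \<in> X \<Longrightarrow> y \<in> X \<Longrightarrow> G x y \<subseteq> X"
  shows "club_in_P omega2 X
    {a \<in> P_less omega2 X. c \<subseteq> elts a \<and> (\<forall>x\<in>elts a. \<forall>y\<in>elts a. G x y \<subseteq> elts a)}"
    (is "club_in_P _ _ ?C")
  unfolding club_in_P_def
proof (intro conjI ballI allI impI)
  fix a assume "a \<in> P_less omega2 X"
  then have a: "elts a \<subseteq> X" "|elts a| \<le>o |elts (omega1 :: 'v)|" by (auto simp: mem_P_less_omega2_iff)
  obtain U where U: "elts a \<union> c \<subseteq> U" "U \<subseteq> X" "|U| \<le>o |elts (omega1 :: 'v)|"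
    "\<And>x y. x \<in> U \<Longrightarrow> y \<in> U \<Longrightarrow> G x y \<subseteq> U"
    by (rule closure_exists[where A = "elts a \<union> c" and X = X and G = G, OF infinite_omega1])
      (use a c G in \<open>auto intro: infinite_Un_ordLeq[OF infinite_omega1]\<close>)
  have eU: "elts (vset U) = U" by (rule elts_vset[OF small_ordLeq[OF U(3) small_elts]])
  then have "vset U \<in> ?C" using U by (simp add: mem_P_less_omega2_iff)
  moreover have "elts a \<subseteq> elts (vset U)" using U(1) eU by simp
  ultimately show "\<exists>b\<in>?C. elts a \<subseteq> elts b" by blast
next
  fix D assume D: "D \<subseteq> ?C" and *: "D \<noteq> {} \<and> |D| <o |elts (omega2 :: 'v)| \<and>
    (\<forall>a\<in>D. \<forall>b\<in>D. elts a \<subseteq> elts b \<or> elts b \<subseteq> elts a)"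
  let ?U = "\<Union>a\<in>D. elts a"
  have "|?U| \<le>o |elts (omega1 :: 'v)|"
    using * D by (intro card_of_UNION_ordLeq_infinite[OF infinite_omega1])
      (auto simp: ordLess_omega2_iff mem_P_less_omega2_iff)
  moreover from this have eU: "elts (vset ?U) = ?U" by (intro elts_vset small_ordLeq[OF _ small_elts])
  moreover have "?U \<subseteq> X" using D by (auto simp: mem_P_less_omega2_iff)
  moreover have "c \<subseteq> ?U" using D * by blast
  moreover have "G x y \<subseteq> ?U" if xy: "x \<in> ?U" "y \<in> ?U" for x y
  proof -
    obtain a b where ab: "a \<in> D" "x \<in> elts a" "b \<in> D" "y \<in> elts b" using xy by blast
    then obtain d where d: "d \<in> D" "x \<in> elts d" "y \<in> elts d" using * by blast
    then have "G x y \<subseteq> elts d" using D by blast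
    then show ?thesis using d(1) by blast
  qed
  ultimately show "vset ?U \<in> ?C" unfolding mem_Collect_eq mem_P_less_omega2_iff by simp
qed blast

section \<open>Sets of bounded hereditary cardinality\<close>

lemma elts_subset_trcl: "elts x \<subseteq> trcl x"
  by (auto simp: trcl_def)

lemma trcl_transitive: "y \<in> trcl x \<Longrightarrow> elts y \<subseteq> trcl x"
  by (auto simp: trcl_def intro: trancl_into_trancl2)

lemma trcl_least:
  assumes "elts x \<subseteq> A" "\<And>y. y \<in> A \<Longrightarrow> elts y \<subseteq> A"
  shows "trcl x \<subseteq> A"
proof
  fix y assume "y \<in> trcl x"
  then have "(y, x) \<in> {(u, v). u \<in> elts v}\<^sup>+" by (simp add: trcl_def)
  then show "y \<in> A" by (induction rule: converse_trancl_induct) (use assms in auto)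
qed

lemma mem_H_card_succ: "x \<in> H (card_succ \<mu>) \<longleftrightarrow> |trcl x| \<le>o |elts \<mu>|"
  by (simp add: H_def ordLess_card_succ_iff)

lemma mem_H_I:
  assumes "|A| \<le>o |elts \<mu>|" "elts x \<subseteq> A" "\<And>y. y \<in> A \<Longrightarrow> elts y \<subseteq> A"
  shows "x \<in> H (card_succ \<mu>)"
  unfolding mem_H_card_succ
  by (rule ordLeq_transitive[OF card_of_mono1[OF trcl_least] assms(1)]) (use assms in auto)

lemma H_transitive:
  assumes "x \<in> H \<theta>" "y \<in> elts x"
  shows "y \<in> H \<theta>"
proof -
  have "trcl y \<subseteq> trcl x"
    by (rule trcl_least) (use assms(2) trcl_transitive elts_subset_trcl in blast)+
  then show ?thesis using assms(1) unfolding H_def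
    by (simp add: ordLeq_ordLess_trans[OF card_of_mono1])
qed

lemma singleton_ordLeq_infinite: "infinite B \<Longrightarrow> |{x}| \<le>o |B|"
  by (rule card_of_singl_ordLeq) auto

text \<open>Stated with an inclusion so that insertions and intersections are both
  instances.\<close>

lemma H_insert_Un:
  assumes "infinite (elts \<mu>)" "x \<in> H (card_succ \<mu>)" "y \<in> H (card_succ \<mu>)" "y' \<in> H (card_succ \<mu>)"
    "elts z \<subseteq> insert x (elts y \<union> elts y')"
  shows "z \<in> H (card_succ \<mu>)"
proof (rule mem_H_I)
  show "|{x} \<union> trcl x \<union> trcl y \<union> trcl y'| \<le>o |elts \<mu>|"
    using assms(1-4) by (intro infinite_Un_ordLeq singleton_ordLeq_infinite) (auto simp: mem_H_card_succ)
  show "elts z \<subseteq> {x} \<union> trcl x \<union> trcl y \<union> trcl y'"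
    using assms(5) elts_subset_trcl by blast
qed (use elts_subset_trcl trcl_transitive in blast)

lemma H_pair:
  assumes "infinite (elts \<mu>)" "x \<in> H (card_succ \<mu>)" "y \<in> H (card_succ \<mu>)"
  shows "vset {x, y} \<in> H (card_succ \<mu>)"
proof (rule mem_H_I)
  show "|{x} \<union> {y} \<union> trcl x \<union> trcl y| \<le>o |elts \<mu>|"
    using assms by (intro infinite_Un_ordLeq singleton_ordLeq_infinite) (auto simp: mem_H_card_succ)
  show "elts (vset {x, y}) \<subseteq> {x} \<union> {y} \<union> trcl x \<union> trcl y" by simp
  show "elts z \<subseteq> {x} \<union> {y} \<union> trcl x \<union> trcl y" if "z \<in> {x} \<union> {y} \<union> trcl x \<union> trcl y" for z
    using that elts_subset_trcl[of x] elts_subset_trcl[of y] trcl_transitive[of z x] trcl_transitive[of z y]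
    by blast
qed

text \<open>A partial Skolem choice with set values: empty where there is nothing to choose, so that
  closure conditions stay inclusions.\<close>

definition witness :: "('v \<Rightarrow> bool) \<Rightarrow> 'v set" where
  "witness Q = (if \<exists>z. Q z then {SOME z. Q z} else {})"

lemma countable_witness [simp]: "countable (witness Q)"
  by (simp add: witness_def)

lemma witness_I: "Q z \<Longrightarrow> \<exists>z\<in>witness Q. Q z"
  unfolding witness_def using someI[of Q z] by auto

lemma witness_D: "z \<in> witness Q \<Longrightarrow> Q z"
  unfolding witness_def by (auto split: if_splits intro: someI)

text \<open>One component for each property in \<open>absolute\<close>. A collision in
  \<open>x\<close> needs three objects but only two arguments are available: one component picks a
  pair taking part in a collision, the next picks a partner for a given pair \<open>y\<close>, and
  the last two project pairs.\<close>

definition skolem :: "'v::zfc \<Rightarrow> 'v \<Rightarrow> 'v set" where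
  "skolem x y = {vset {x, y}} \<union> witness (\<lambda>z. z \<in> elts x \<and> z \<notin> elts y)
    \<union> witness (\<lambda>z. z \<in> elts x \<and> \<not> elts z \<subseteq> elts x)
    \<union> witness (\<lambda>z. z \<in> elts x \<and> \<not> (\<forall>y\<in>elts z. elts y \<subseteq> elts z))
    \<union> witness (\<lambda>z. z \<in> elts x)
    \<union> witness (\<lambda>z. z \<in> elts x \<and> y \<in> elts z)
    \<union> witness (\<lambda>z. z \<in> elts x \<and> (\<forall>t\<in>elts x. z \<notin> elts t))
    \<union> witness (\<lambda>z. z \<in> elts x \<and> Limit z)
    \<union> witness (\<lambda>z. z \<in> elts x \<and> (\<forall>t. opair z t \<notin> elts y))
    \<union> witness (\<lambda>u. u \<in> elts x \<and> (\<forall>s. \<forall>t\<in>elts y. u \<noteq> opair s t))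
    \<union> witness (\<lambda>u. u \<in> elts x \<and> (\<exists>s s' t. u = opair s t \<and> opair s' t \<in> elts x \<and> s \<noteq> s'))
    \<union> witness (\<lambda>u. u \<in> elts x \<and> (\<exists>s s' t. y = opair s t \<and> u = opair s' t \<and> s \<noteq> s'))
    \<union> witness (\<lambda>s. \<exists>t. x = opair s t) \<union> witness (\<lambda>t. \<exists>s. x = opair s t)"

lemma countable_skolem: "countable (skolem x y)"
  unfolding skolem_def by (intro countable_Un) simp_all

lemma skolem_closed_absolute:
  assumes trans: "\<And>x y. x \<in> X \<Longrightarrow> y \<in> elts x \<Longrightarrow> y \<in> X" and pair: "\<And>x y. x \<in> X \<Longrightarrow> y \<in> X \<Longrightarrow> vset {x, y} \<in> X"
    and M: "M \<subseteq> X" "\<And>x y. x \<in> M \<Longrightarrow> y \<in> M \<Longrightarrow> skolem x y \<inter> X \<subseteq> M"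
  shows "absolute M"
proof -
  have w: "\<exists>z\<in>M. Q z"
    if "witness Q \<subseteq> skolem x y" "x \<in> M" "y \<in> M" "\<And>z. Q z \<Longrightarrow> z \<in> X" "\<exists>z. Q z" for x y Q
    using witness_I[of Q] witness_D[of _ Q] M(2)[OF that(2,3)] that by blast
  have X: "z \<in> X" if "x \<in> M" "z \<in> elts x" for x z using that M(1) trans by blast
  show ?thesis
  proof
    show "vset {x, y} \<in> M" if "x \<in> M" "y \<in> M" for x y
      using M(2)[OF that] pair[of x y] M(1) that unfolding skolem_def by blast
    show "\<exists>z\<in>M. z \<in> elts x \<and> z \<notin> elts y" if "x \<in> M" "y \<in> M" "z \<in> elts x" "z \<notin> elts y" for x y z
      by (rule w[of _ x y]) (use that X in \<open>auto simp: skolem_def\<close>)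
    show "\<exists>z\<in>M. z \<in> elts x \<and> \<not> elts z \<subseteq> elts x" if "x \<in> M" "z \<in> elts x" "\<not> elts z \<subseteq> elts x" for x z
      by (rule w[of _ x x]) (use that X in \<open>auto simp: skolem_def\<close>)
    show "\<exists>z\<in>M. z \<in> elts x \<and> \<not> (\<forall>y\<in>elts z. elts y \<subseteq> elts z)"
      if "x \<in> M" "z \<in> elts x" "\<not> (\<forall>y\<in>elts z. elts y \<subseteq> elts z)" for x z
      by (rule w[of _ x x]) (use that(1) X in \<open>auto simp: skolem_def\<close>, use that in blast)
    show "\<exists>z\<in>M. z \<in> elts x" if "x \<in> M" "z \<in> elts x" for x z
      by (rule w[of _ x x]) (use that X in \<open>auto simp: skolem_def\<close>)
    show "\<exists>z\<in>M. z \<in> elts x \<and> y \<in> elts z" if "x \<in> M" "y \<in> M" "z \<in> elts x" "y \<in> elts z" for x y z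
      by (rule w[of _ x y]) (use that X in \<open>auto simp: skolem_def\<close>)
    show "\<exists>z\<in>M. z \<in> elts x \<and> (\<forall>t\<in>elts x. z \<notin> elts t)"
      if "x \<in> M" "z \<in> elts x" "\<forall>t\<in>elts x. z \<notin> elts t" for x z
      by (rule w[of _ x x]) (use that X in \<open>auto simp: skolem_def\<close>)
    show "\<exists>z\<in>M. z \<in> elts x \<and> Limit z" if "x \<in> M" "z \<in> elts x" "Limit z" for x z
      by (rule w[of _ x x]) (use that X in \<open>auto simp: skolem_def\<close>)
    show "\<exists>z\<in>M. z \<in> elts x \<and> (\<forall>y. opair z y \<notin> elts f)"
      if "x \<in> M" "f \<in> M" "z \<in> elts x" "\<forall>y. opair z y \<notin> elts f" for x f z
      by (rule w[of _ x f]) (use that X in \<open>auto simp: skolem_def\<close>)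
    show "\<exists>u\<in>M. u \<in> elts f \<and> (\<forall>x. \<forall>y\<in>elts b. u \<noteq> opair x y)"
      if "f \<in> M" "b \<in> M" "u \<in> elts f" "\<forall>x. \<forall>y\<in>elts b. u \<noteq> opair x y" for f b u
      by (rule w[of _ f b]) (use that X in \<open>auto simp: skolem_def\<close>)
    show "\<exists>x\<in>M. \<exists>x'\<in>M. \<exists>y\<in>M. opair x y \<in> elts f \<and> opair x' y \<in> elts f \<and> x \<noteq> x'"
      if f: "f \<in> M" "opair x y \<in> elts f" "opair x' y \<in> elts f" "x \<noteq> x'" for f x x' y
    proof -
      have "\<exists>u\<in>M. u \<in> elts f \<and> (\<exists>s s' t. u = opair s t \<and> opair s' t \<in> elts f \<and> s \<noteq> s')"
        by (rule w[of _ f f]) (use f X in \<open>auto simp: skolem_def\<close>)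
      then obtain s s' t where u: "opair s t \<in> M" "opair s t \<in> elts f" "opair s' t \<in> elts f" "s \<noteq> s'"
        by blast
      have "\<exists>u\<in>M. u \<in> elts f \<and> (\<exists>s1 s' t1. opair s t = opair s1 t1 \<and> u = opair s' t1 \<and> s1 \<noteq> s')"
        by (rule w[of _ f "opair s t"]) (use f u X in \<open>auto simp: skolem_def\<close>)
      then obtain s' where u': "opair s' t \<in> M" "opair s' t \<in> elts f" "s \<noteq> s'" by auto
      \<comment> \<open>The components lie in \<open>X\<close> by transitivity, and injectivity of
        \<open>opair\<close> forces the projections in \<open>skolem\<close> to return exactly
        them.\<close>
      have comps: "a \<in> M" "b \<in> M" if "opair a b \<in> M" for a b
      proof -
        have "vset {a, b} \<in> X" by (rule X[OF that]) (simp add: elts_opair)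
        then have *: "a \<in> X" "b \<in> X" using trans by auto
        have "\<exists>a'\<in>M. \<exists>b'. opair a b = opair a' b'"
          by (rule w[of _ "opair a b" "opair a b"]) (use that * in \<open>auto simp: skolem_def\<close>)
        then show "a \<in> M" by auto
        have "\<exists>b'\<in>M. \<exists>a'. opair a b = opair a' b'"
          by (rule w[of _ "opair a b" "opair a b"]) (use that * in \<open>auto simp: skolem_def\<close>)
        then show "b \<in> M" by auto
      qed
      show ?thesis using u u' comps[OF u(1)] comps[OF u'(1)] by blast
    qed
  qed
qed

text \<open>The bounds \<open>s\<close>, \<open>s'\<close> express sup d < sup (M \<inter> On).
  Approximation is demanded on all truly countable elements, which for absolute \<open>M\<close>
  include those that \<open>M\<close> models as countable; so this follows from the formula.\<close>

definition guessing :: "'v::zfc set \<Rightarrow> bool" where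
  "guessing M \<longleftrightarrow> (\<forall>d s s'. d \<subseteq> M \<and> (\<forall>x\<in>d. Ord x) \<and> d \<subseteq> elts s \<and> s \<in> elts s' \<and> Ord s' \<and> s' \<in> M \<and>
     (\<forall>a\<in>M. countable (elts a) \<longrightarrow> vset (d \<inter> elts a) \<in> M) \<longrightarrow> (\<exists>e\<in>M. elts e \<inter> M = d))"

text \<open>\<open>G\<close> and \<open>skolem\<close> are cut down to \<open>H\<close> so that the
  sets closed under them form a club there. A member of this club supplied by stationarity is
  absolute, being closed under \<open>skolem\<close>, and hence guessing in the formula-free
  sense.\<close>

theorem guessing_model:
  fixes \<mu> :: "'v::zfc" and G :: "'v \<Rightarrow> 'v \<Rightarrow> 'v set"
  assumes IGMP: "IGMP TYPE('v)" and \<mu>: "|elts (omega1 :: 'v)| \<le>o |elts \<mu>|"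
    and c: "|c| \<le>o |elts (omega1 :: 'v)|" and G: "\<And>x y. |G x y| \<le>o |elts (omega1 :: 'v)|"
  obtains N :: 'v where "|elts N| \<le>o |elts (omega1 :: 'v)|" "elts N \<subseteq> H (card_succ \<mu>)"
    "c \<inter> H (card_succ \<mu>) \<subseteq> elts N"
    "\<forall>x\<in>elts N. \<forall>y\<in>elts N. G x y \<inter> H (card_succ \<mu>) \<subseteq> elts N"
    "guessing (elts N)"
proof -
  let ?\<theta> = "card_succ \<mu>"
  let ?X = "H ?\<theta>"
  have inf: "infinite (elts \<mu>)" using \<mu> infinite_omega1 card_of_ordLeq_infinite by blast
  define G' where "G' x y = (G x y \<union> skolem x y) \<inter> ?X" for x y
  have G': "|G' x y| \<le>o |elts (omega1 :: 'v)|" for x y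
    unfolding G'_def
    by (rule ordLeq_transitive[OF card_of_mono1[OF Int_lower1]])
      (intro infinite_Un_ordLeq infinite_omega1 G countable_ordLeq_omega1 countable_skolem)
  have c': "|c \<inter> ?X| \<le>o |elts (omega1 :: 'v)|"
    by (rule ordLeq_transitive[OF card_of_mono1[OF Int_lower1] c])
  have "elts (omega2 :: 'v) \<subseteq> elts ?\<theta>"
    unfolding omega2_def card_succ_def[of omega1]
    by (rule least_ord_subset[where P = "\<lambda>\<alpha>. |elts omega1| <o |elts \<alpha>|"])
      (simp_all add: Ord_card_succ ordLess_card_succ_iff \<mu>)
  then have "IGMP_at ?\<theta>" using IGMP Card_card_succ unfolding IGMP_def by blast
  moreover have "club_in_P omega2 ?X {a \<in> P_less omega2 ?X. c \<inter> ?X \<subseteq> elts a \<and>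
    (\<forall>x\<in>elts a. \<forall>y\<in>elts a. G' x y \<subseteq> elts a)}"
    by (rule club_closed[OF c' _ G']) (auto simp: G'_def)
  ultimately obtain N :: 'v where N: "N \<in> P_less omega2 ?X" "indestructibly_omega1_guessing N"
    "c \<inter> ?X \<subseteq> elts N" "\<And>x y. x \<in> elts N \<Longrightarrow> y \<in> elts N \<Longrightarrow> G' x y \<subseteq> elts N"
    unfolding IGMP_at_def stationary_in_P_def by blast
  have NX: "elts N \<subseteq> ?X" "|elts N| \<le>o |elts (omega1 :: 'v)|"
    using N(1) by (auto simp: mem_P_less_omega2_iff)
  have abs: "absolute (elts N)"
  proof (rule skolem_closed_absolute[where X = ?X])
    show "skolem x y \<inter> ?X \<subseteq> elts N" if "x \<in> elts N" "y \<in> elts N" for x y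
      using N(4)[OF that] unfolding G'_def by blast
  qed (use H_transitive H_pair[OF inf] NX(1) in blast)+
  show ?thesis
  proof (rule that[OF NX(2,1) N(3)])
    show "\<forall>x\<in>elts N. \<forall>y\<in>elts N. G x y \<inter> ?X \<subseteq> elts N"
      using N(4) by (auto simp: G'_def)
    show "guessing (elts N)"
      unfolding guessing_def
    proof (intro allI impI, elim conjE)
      fix d s s' assume "d \<subseteq> elts N" "\<forall>x\<in>d. Ord x" "d \<subseteq> elts s" "s \<in> elts s'" "Ord s'" "s' \<in> elts N"
        and "\<forall>a\<in>elts N. countable (elts a) \<longrightarrow> vset (d \<inter> elts a) \<in> elts N"
      then obtain e where "e \<in> elts N" "elts e \<inter> elts N = d"
        by (elim omega1_guessingD[OF N(2) abs, of d s s']) auto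
      then show "\<exists>e\<in>elts N. elts e \<inter> elts N = d" by blast
    qed
  qed
qed

subsection \<open>Covering countable sets by countable elements of a guessing model\<close>

text \<open>The pairing \<open>p\<close> on \<mu>, iterated to the left, codes finite sequences by
  ordinals, and \<open>q\<close> takes them apart: guessing concerns sets of ordinals only. The
  other conditions are the reflection properties used by the covering argument; later
  \<open>M\<close> is \<open>elts N\<close> and \<mu> is \<open>card_succ \<kappa>\<close>.\<close>

locale guessing_submodel =
  fixes \<mu> :: "'v::zfc" and M :: "'v set" and p :: "'v \<Rightarrow> 'v \<Rightarrow> 'v" and q :: "'v \<Rightarrow> 'v \<times> 'v"
  assumes Ord: "Ord \<mu>"
    and p: "\<And>x y. x \<in> elts \<mu> \<Longrightarrow> y \<in> elts \<mu> \<Longrightarrow> p x y \<in> elts \<mu>"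
    and q: "\<And>x y. x \<in> elts \<mu> \<Longrightarrow> y \<in> elts \<mu> \<Longrightarrow> q (p x y) = (x, y)"
    and empty_mem: "vset {} \<in> M"
    and p_mem: "\<And>x y. x \<in> M \<Longrightarrow> y \<in> M \<Longrightarrow> x \<in> elts \<mu> \<Longrightarrow> y \<in> elts \<mu> \<Longrightarrow> p x y \<in> M"
    and decode_mem: "\<And>x. x \<in> M \<Longrightarrow>
      vset ((\<Union>s\<in>elts x. range (\<lambda>k. snd (q (((fst \<circ> q) ^^ k) s)))) \<inter> elts \<mu>) \<in> M"
    and insert_mem: "\<And>x y. x \<in> M \<Longrightarrow> y \<in> M \<Longrightarrow> vset (insert x (elts y)) \<in> M"
    and Int_mem: "\<And>x y. x \<in> M \<Longrightarrow> y \<in> M \<Longrightarrow> vset (elts x \<inter> elts y) \<in> M"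
    and countable_mem: "\<And>x. x \<in> M \<Longrightarrow> countable (elts x) \<Longrightarrow> elts x \<subseteq> M"
    and uncountable_mem: "\<And>x. x \<in> M \<Longrightarrow> uncountable (elts x) \<Longrightarrow> uncountable (elts x \<inter> M)"
    and guess: "\<And>d. d \<subseteq> M \<Longrightarrow> d \<subseteq> elts \<mu> \<Longrightarrow>
      (\<And>a. a \<in> M \<Longrightarrow> countable (elts a) \<Longrightarrow> vset (d \<inter> elts a) \<in> M) \<Longrightarrow> \<exists>e\<in>M. elts e \<inter> M = d"
begin

text \<open>Every element is decoded to every depth, even if it is no code or only a short one. The
  extra values do no harm: there are countably many per element, and those outside \<mu> are
  discarded.\<close>

definition decode :: "'v \<Rightarrow> 'v set" where
  "decode c = (\<Union>s\<in>elts c. range (\<lambda>k. snd (q (((fst \<circ> q) ^^ k) s)))) \<inter> elts \<mu>"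

lemma elts_decode: "elts (vset (decode c)) = decode c"
  by (rule elts_vset[OF small_subset[OF small_elts[of \<mu>]]]) (auto simp: decode_def)

lemma countable_decode: "countable (elts c) \<Longrightarrow> countable (decode c)"
  unfolding decode_def by (intro countable_Int1 countable_UN) auto

lemma finite_mem: "finite F \<Longrightarrow> F \<subseteq> M \<Longrightarrow> vset F \<in> M"
proof (induction F rule: finite_induct)
  case empty
  show ?case by (rule empty_mem)
next
  case (insert x F)
  have "small F" using insert.hyps(1) by (induction F) auto
  then have "vset (insert x (elts (vset F))) = vset (insert x F)" by simp
  then show ?case using insert_mem[of x "vset F"] insert by simp
qed

text \<open>The finite initial segments of an enumeration of \<open>x\<close>, coded as ordinals, form a set \<open>d\<close>. If
  \<open>d\<close> has infinite intersection with a countable \<open>c \<in> M\<close>, then the entries of the codes in \<open>c\<close>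
  cover \<open>x\<close>. Otherwise \<open>d\<close> is countably approximated, hence guessed by some \<open>e \<in> M\<close>, which must be
  countable as \<open>e \<inter> M\<close> is.\<close>

lemma countable_cover:
  assumes x: "countable x" "x \<subseteq> M" "x \<subseteq> elts \<mu>"
  obtains y where "y \<in> M" "countable (elts y)" "elts y \<subseteq> elts \<mu>" "x \<subseteq> elts y"
proof (cases "x = {}")
  case True
  then show ?thesis using that[OF empty_mem] by simp
next
  case False
  define a where "a = from_nat_into x"
  have xa: "x = range a" unfolding a_def using range_from_nat_into[OF False x(1)] by simp
  have aM: "a n \<in> M" "a n \<in> elts \<mu>" for n using x(2,3) xa by auto
  \<comment> \<open>\<open>s n\<close> codes \<open>a 0, ..., a (n - 1)\<close> on top of the start
    value \<open>a 0\<close>. Hence \<open>a i\<close> is the last entry of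
    \<open>s (Suc i)\<close>, reached from \<open>s (Suc (i + k))\<close> by dropping
    \<open>k\<close> entries.\<close>
  define s where "s = rec_nat (a 0) (\<lambda>n t. p t (a n))"
  have s: "s 0 = a 0" "\<And>n. s (Suc n) = p (s n) (a n)" by (simp_all add: s_def)
  have sM: "s n \<in> M \<and> s n \<in> elts \<mu>" for n by (induction n) (use aM p p_mem in \<open>auto simp: s\<close>)
  have dec: "snd (q (((fst \<circ> q) ^^ k) (s (Suc (i + k))))) = a i" for i k
  proof (induction k)
    case (Suc k)
    have "(fst \<circ> q) (s (Suc (i + Suc k))) = s (Suc (i + k))"
      using q sM aM by (simp add: s(2)[of "Suc (i + k)"])
    then have "((fst \<circ> q) ^^ Suc k) (s (Suc (i + Suc k))) = ((fst \<circ> q) ^^ k) (s (Suc (i + k)))"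
      by (simp only: funpow_Suc_right o_apply)
    then show ?case using Suc by (simp only:)
  qed (use q sM aM in \<open>simp add: s(2)[of i]\<close>)
  have cover: "x \<subseteq> decode c" if "infinite {n. s n \<in> elts c}" for c
  proof -
    have *: "\<exists>n>i. s n \<in> elts c" for i using that by (auto simp: infinite_nat_iff_unbounded)
    show ?thesis
    proof
      fix z assume "z \<in> x"
      then obtain i where i: "z = a i" using xa by auto
      obtain n where n: "n > i" "s n \<in> elts c" using * by blast
      then obtain k where "n = Suc (i + k)" using less_iff_Suc_add by blast
      then have "z = snd (q (((fst \<circ> q) ^^ k) (s n)))" using dec[of k i] i by simp
      then have "z \<in> range (\<lambda>k. snd (q (((fst \<circ> q) ^^ k) (s n))))" by (rule range_eqI)
      with n(2) have "z \<in> (\<Union>s\<in>elts c. range (\<lambda>k. snd (q (((fst \<circ> q) ^^ k) s))))" by (rule UN_I)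
      then show "z \<in> decode c" unfolding decode_def using i aM(2)[of i] by simp
    qed
  qed
  note thesisI = that
  have fin: ?thesis if "c \<in> M" "countable (elts c)" "infinite {n. s n \<in> elts c}" for c
  proof (rule thesisI)
    show "vset (decode c) \<in> M" using decode_mem[OF \<open>c \<in> M\<close>] unfolding decode_def .
    show "countable (elts (vset (decode c)))" unfolding elts_decode using countable_decode that by blast
    show "elts (vset (decode c)) \<subseteq> elts \<mu>" unfolding elts_decode by (simp add: decode_def)
    show "x \<subseteq> elts (vset (decode c))" unfolding elts_decode using cover that by blast
  qed
  show ?thesis
  \<comment> \<open>Infinitely many indices are asked for, not infinitely many values, so
    repetitions in \<open>s\<close> are allowed.\<close>
  proof (cases "\<exists>c\<in>M. countable (elts c) \<and> infinite {n. s n \<in> elts c}")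
    case True
    then show ?thesis using fin by blast
  next
    case False
    have "\<exists>e\<in>M. elts e \<inter> M = range s"
    proof (rule guess)
      fix c assume "c \<in> M" "countable (elts c)"
      then have "finite (s ` {n. s n \<in> elts c})" using False by blast
      moreover have "range s \<inter> elts c = s ` {n. s n \<in> elts c}" by auto
      ultimately show "vset (range s \<inter> elts c) \<in> M" using finite_mem[of "range s \<inter> elts c"] sM by auto
    qed (use sM in auto)
    then obtain e where e: "e \<in> M" "elts e \<inter> M = range s" by blast
    then have ce: "countable (elts e)" using uncountable_mem[of e] by auto
    then have "elts e = range s" using countable_mem[OF e(1)] e(2) by blast
    \<comment> \<open>The countable \<open>e\<close> contains every \<open>s n\<close>, against the
      case assumption: the second case cannot occur.\<close>
    then have "infinite {n. s n \<in> elts e}" by simp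
    then show ?thesis using False e(1) ce by blast
  qed
qed

end

subsection \<open>Covering matrices\<close>

text \<open>Cofinality is applied to the successor of \<beta>, which turns the weak inequality into
  a strict one.\<close>

lemma cofinal_strict:
  assumes "Card \<kappa>" "infinite (elts \<kappa>)" "cofinal_map f \<alpha> \<kappa>" "\<beta> \<in> elts \<kappa>"
  obtains \<gamma> where "\<gamma> \<in> elts \<alpha>" "\<beta> \<in> elts (f \<gamma>)"
proof -
  let ?s = "vset (insert \<beta> (elts \<beta>))"
  obtain \<gamma> where g: "\<gamma> \<in> elts \<alpha>" "?s \<in> elts (f \<gamma>) \<or> ?s = f \<gamma>"
    using assms(3) Card_limit[OF assms(1,2,4)] unfolding cofinal_map_def by blast
  have "Ord (f \<gamma>)" using assms(1,3) g(1) unfolding cofinal_map_def by (blast intro: Ord_mem Card_Ord)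
  moreover have "\<beta> \<in> elts ?s" by simp
  ultimately have "\<beta> \<in> elts (f \<gamma>)" using g(2) Ord_trans[of "f \<gamma>" ?s \<beta>] by metis
  then show ?thesis using that g(1) by blast
qed

lemma omega_cofinal_filtration:
  fixes \<kappa> :: "'v::zfc"
  assumes \<kappa>: "Card \<kappa>" "infinite (elts \<kappa>)" "cf \<kappa> = omega" "|elts (omega :: 'v)| <o |elts \<kappa>|"
  obtains K :: "nat \<Rightarrow> 'v set" where "mono K" "\<forall>n. infinite (K n) \<and> |K n| <o |elts \<kappa>|"
    "elts \<kappa> \<subseteq> (\<Union>n. K n)"
proof -
  obtain f where f: "cofinal_map f omega \<kappa>" using cf_cofinal[OF Card_Ord[OF \<kappa>(1)]] \<kappa>(3) by auto
  define g where "g = from_nat_into (elts (omega :: 'v))"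
  have rg: "range g = elts omega"
    unfolding g_def by (rule range_from_nat_into[OF infinite_imp_nonempty[OF infinite_omega] countable_omega])
  \<comment> \<open>Finite unions make \<open>K\<close> increasing although the cofinal map need not
    be; adding \<open>omega\<close> makes each \<open>K n\<close> infinite, as needed for later
    unions bounded by \<open>|K n|\<close>.\<close>
  define K where "K n = elts omega \<union> (\<Union>k\<in>{..n}. elts (f (g k)))" for n :: nat
  show ?thesis
  proof (rule that)
    show "mono K" unfolding K_def mono_def by (auto 4 4)
    have "infinite (K n)" for n using infinite_omega unfolding K_def by auto
    moreover have "|K n| <o |elts \<kappa>|" for n
    proof -
      have fk: "|elts (f (g k))| <o |elts \<kappa>|" for k
        using f rg Card_mem[OF \<kappa>(1)] unfolding cofinal_map_def by blast
      have "|\<Union>k\<in>F. elts (f (g k))| <o |elts \<kappa>|" if "finite F" for F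
        using that
      proof (induction F rule: finite_induct)
        case empty
        show ?case by (rule finite_ordLess_infinite_card) (use \<kappa>(2) in auto)
      next
        case (insert k F)
        then show ?case using card_of_Un_ordLess_infinite[OF \<kappa>(2) fk] by simp
      qed
      then show ?thesis unfolding K_def by (intro card_of_Un_ordLess_infinite[OF \<kappa>(2) \<kappa>(4)]) auto
    qed
    ultimately show "\<forall>n. infinite (K n) \<and> |K n| <o |elts \<kappa>|" by blast
    show "elts \<kappa> \<subseteq> (\<Union>n. K n)"
    proof
      fix \<beta> assume "\<beta> \<in> elts \<kappa>"
      then obtain \<gamma> where "\<gamma> \<in> elts omega" "\<beta> \<in> elts (f \<gamma>)" by (rule cofinal_strict[OF \<kappa>(1,2) f])
      moreover then obtain n where "\<gamma> = g n" using rg by blast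
      ultimately show "\<beta> \<in> (\<Union>n. K n)" unfolding K_def by auto
    qed
  qed
qed

definition covering_matrix :: "'v::zfc \<Rightarrow> (nat \<Rightarrow> 'v \<Rightarrow> 'v set) \<Rightarrow> bool" where
  "covering_matrix \<kappa> D \<longleftrightarrow>
    (\<forall>\<gamma>\<in>elts (card_succ \<kappa>). (\<forall>n. D n \<gamma> \<subseteq> elts \<gamma> \<and> |D n \<gamma>| <o |elts \<kappa>| ) \<and> mono (\<lambda>n. D n \<gamma>) \<and>
       (\<forall>\<beta>\<in>elts \<gamma>. \<exists>l. \<forall>n\<ge>l. insert \<beta> (D n \<beta>) \<subseteq> D n \<gamma>))"

lemma covering_matrixD:
  assumes "covering_matrix \<kappa> D" "\<gamma> \<in> elts (card_succ \<kappa>)"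
  shows "D n \<gamma> \<subseteq> elts \<gamma>" "|D n \<gamma>| <o |elts \<kappa>|" "mono (\<lambda>n. D n \<gamma>)"
    "\<beta> \<in> elts \<gamma> \<Longrightarrow> \<exists>l. \<forall>n\<ge>l. insert \<beta> (D n \<beta>) \<subseteq> D n \<gamma>"
  using assms unfolding covering_matrix_def by simp_all

text \<open>With \<open>\<kappa>\<close> the increasing union of small sets \<open>K n\<close> and injections \<open>e \<gamma> : \<gamma> \<rightarrow> \<kappa>\<close>, the set
  \<open>D n \<gamma>\<close> consists of the ordinals reachable from \<open>\<gamma>\<close> by descents along pairs \<open>\<beta> \<in> \<gamma>\<close> with
  \<open>e \<gamma> \<beta> \<in> K n\<close>.\<close>

lemma covering_matrix_exists:
  fixes \<kappa> :: "'v::zfc"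
  assumes \<kappa>: "Card \<kappa>" "infinite (elts \<kappa>)" "cf \<kappa> = omega" "|elts (omega :: 'v)| <o |elts \<kappa>|"
  obtains D where "covering_matrix \<kappa> D"
proof -
  obtain K :: "nat \<Rightarrow> 'v set" where K': "mono K" "\<forall>n. infinite (K n) \<and> |K n| <o |elts \<kappa>|" "elts \<kappa> \<subseteq> (\<Union>n. K n)"
    by (rule omega_cofinal_filtration[OF \<kappa>])
  have K: "mono K" "\<And>n. infinite (K n)" "\<And>n. |K n| <o |elts \<kappa>|" "elts \<kappa> \<subseteq> (\<Union>n. K n)"
    using K' by auto
  let ?L = "elts (card_succ \<kappa>)"
  have "\<exists>e. inj_on e (elts \<gamma>) \<and> e ` elts \<gamma> \<subseteq> elts \<kappa>" if "\<gamma> \<in> ?L" for \<gamma>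
    by (rule card_ordLeqE[OF card_succ_mem[OF that]]) (intro exI conjI)
  then obtain e where e: "\<And>\<gamma>. \<gamma> \<in> ?L \<Longrightarrow> inj_on (e \<gamma>) (elts \<gamma>) \<and> e \<gamma> ` elts \<gamma> \<subseteq> elts \<kappa>" by metis
  define S where "S n = {(\<beta>, \<gamma>). \<gamma> \<in> ?L \<and> \<beta> \<in> elts \<gamma> \<and> e \<gamma> \<beta> \<in> K n}" for n
  have fibre: "|{\<beta>. (\<beta>, \<gamma>) \<in> S n}| \<le>o |K n|" for n \<gamma>
  proof (cases "\<gamma> \<in> ?L")
    case True
    then show ?thesis using e[OF True]
      by (intro card_of_ordLeqI[where f = "e \<gamma>"]) (auto simp: S_def intro: inj_on_subset)
  next
    case False
    then have "{\<beta>. (\<beta>, \<gamma>) \<in> S n} = {}" by (auto simp: S_def)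
    then show ?thesis by (simp only: card_of_empty)
  qed
  have pow: "|{\<beta>. (\<beta>, \<gamma>) \<in> S n ^^ Suc k}| \<le>o |K n|" for n k \<gamma>
  proof (induction k arbitrary: \<gamma>)
    case 0
    then show ?case using fibre by simp
  next
    case (Suc k)
    have "{\<beta>. (\<beta>, \<gamma>) \<in> S n ^^ Suc (Suc k)} = (\<Union>\<delta>\<in>{\<delta>. (\<delta>, \<gamma>) \<in> S n}. {\<beta>. (\<beta>, \<delta>) \<in> S n ^^ Suc k})"
      by (subst relpow.simps(2)) blast
    also have "| \<dots> | \<le>o |K n|" by (rule card_of_UNION_ordLeq_infinite[OF K(2) fibre]) (rule ballI, rule Suc)
    finally show ?case .
  qed
  define D where "D n \<gamma> = {\<beta>. (\<beta>, \<gamma>) \<in> (S n)\<^sup>+}" for n \<gamma>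
  have "covering_matrix \<kappa> D"
    unfolding covering_matrix_def
  proof (intro ballI conjI allI)
    fix \<gamma> n assume \<gamma>: "\<gamma> \<in> ?L"
    have "\<beta> \<in> elts \<gamma>" if "(\<beta>, \<gamma>) \<in> (S n)\<^sup>+" for \<beta>
      using that
    proof (induction rule: trancl_induct)
      case (step \<gamma>1 \<gamma>2)
      then have "Ord \<gamma>2" by (auto simp: S_def intro: Ord_mem[OF Ord_card_succ])
      then show ?case using step Ord_trans[of \<gamma>2 \<gamma>1 \<beta>] by (auto simp: S_def)
    qed (simp add: S_def)
    then show "D n \<gamma> \<subseteq> elts \<gamma>" by (auto simp: D_def)
    have "D n \<gamma> = (\<Union>k. {\<beta>. (\<beta>, \<gamma>) \<in> S n ^^ Suc k})"
    proof -
      have "(\<exists>m>0. P m) \<longleftrightarrow> (\<exists>k. P (Suc k))" for P by (metis gr0_implies_Suc zero_less_Suc)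
      then show ?thesis unfolding D_def trancl_power by auto
    qed
    also have "| \<dots> | \<le>o |K n|" by (rule nat_UN_ordLeq[OF K(2) pow])
    finally show "|D n \<gamma>| <o |elts \<kappa>|" by (rule ordLeq_ordLess_trans[OF _ K(3)])
  next
    fix \<gamma> assume \<gamma>: "\<gamma> \<in> ?L"
    have "S m \<subseteq> S n" if "m \<le> n" for m n using K(1) that unfolding S_def mono_def by blast
    then show "mono (\<lambda>n. D n \<gamma>)"
      unfolding D_def mono_def by (auto intro: trancl_mono)
    fix \<beta> assume \<beta>: "\<beta> \<in> elts \<gamma>"
    then obtain l where "e \<gamma> \<beta> \<in> K l" using e[OF \<gamma>] K(4) by blast
    then have "(\<beta>, \<gamma>) \<in> S n" if "n \<ge> l" for n
      using K(1) that \<gamma> \<beta> unfolding S_def mono_def by blast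
    \<comment> \<open>Every descent from \<beta> becomes one from \<gamma> by prefixing the single
      step from \<gamma> to \<beta>.\<close>
    then have "insert \<beta> (D n \<beta>) \<subseteq> D n \<gamma>" if "n \<ge> l" for n
      using that unfolding D_def by (auto intro: trancl_into_trancl)
    then show "\<exists>l. \<forall>n\<ge>l. insert \<beta> (D n \<beta>) \<subseteq> D n \<gamma>" by blast
  qed
  then show ?thesis by (rule that)
qed

lemma infinite_card_succ: "infinite (elts \<kappa>) \<Longrightarrow> infinite (elts (card_succ \<kappa>))"
  using card_of_ordLeq_infinite[OF ordLess_imp_ordLeq[OF card_succ_greater]] .

lemma card_succ_union:
  fixes \<kappa> :: "'v::zfc"
  assumes inf: "infinite (elts \<kappa>)" and I: "|I| \<le>o |elts \<kappa>|" and un: "elts (card_succ \<kappa>) \<subseteq> (\<Union>i\<in>I. A i)"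
  obtains i where "i \<in> I" "\<And>\<delta>. \<delta> \<in> elts (card_succ \<kappa>) \<Longrightarrow> \<not> A i \<subseteq> elts \<delta>"
proof -
  have "\<exists>i\<in>I. \<forall>\<delta>\<in>elts (card_succ \<kappa>). \<not> A i \<subseteq> elts \<delta>"
  proof (rule ccontr)
    assume *: "\<not> ?thesis"
    have "|A i| \<le>o |elts \<kappa>|" if i: "i \<in> I" for i
    proof -
      obtain \<delta> where "\<delta> \<in> elts (card_succ \<kappa>)" "A i \<subseteq> elts \<delta>" using * i by auto
      then show ?thesis by (meson card_succ_mem card_of_mono1 ordLeq_transitive)
    qed
    then have "|\<Union>i\<in>I. A i| \<le>o |elts \<kappa>|" by (intro card_of_UNION_ordLeq_infinite[OF inf I]) blast
    with card_of_mono1[OF un] have "|elts (card_succ \<kappa>)| \<le>o |elts \<kappa>|" by (rule ordLeq_transitive)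
    then show False using card_succ_greater[of \<kappa>] not_ordLess_ordLeq by blast
  qed
  then show ?thesis using that by blast
qed

text \<open>There are at most \<open>2\<^sup>\<omega>\<close> sequences of traces on
  \<open>x\<close>, so by regularity one of them occurs for unboundedly many ordinals. Take \<gamma>
  to be one of these. Any \<beta> above \<gamma> lies below another such \<beta>', and for large
  \<open>n\<close> its trace is squeezed between two equal ones.\<close>

lemma covering_matrix_trace:
  fixes \<kappa> :: "'v::zfc"
  assumes D: "covering_matrix \<kappa> D" and inf: "infinite (elts \<kappa>)"
    and c: "|Pow (UNIV :: nat set)| \<le>o |elts \<kappa>|" and x: "countable x"
  obtains \<gamma> where "\<gamma> \<in> elts (card_succ \<kappa>)"
    "\<And>\<beta>. \<beta> \<in> elts (card_succ \<kappa>) \<Longrightarrow> \<gamma> \<in> elts \<beta> \<Longrightarrow> \<exists>l. \<forall>n\<ge>l. D n \<beta> \<inter> x = D n \<gamma> \<inter> x"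
proof -
  let ?L = "elts (card_succ \<kappa>)"
  define \<phi> where "\<phi> \<beta> = (\<lambda>n. D n \<beta> \<inter> x)" for \<beta>
  have "|\<phi> ` ?L| \<le>o |Pow (UNIV :: nat set)|"
  proof (rule card_of_ordLeqI)
    let ?e = "\<lambda>h. (to_nat_on (UNIV \<times> x)) ` {(n, z). z \<in> h n}"
    show "inj_on ?e (\<phi> ` ?L)"
    proof (rule inj_onI)
      fix h h' assume h: "h \<in> \<phi> ` ?L" "h' \<in> \<phi> ` ?L" "?e h = ?e h'"
      have sub: "{(n, z). z \<in> h n} \<subseteq> UNIV \<times> x" "{(n, z). z \<in> h' n} \<subseteq> UNIV \<times> x"
        using h(1,2) by (auto simp: \<phi>_def)
      have "inj_on (to_nat_on (UNIV \<times> x)) (UNIV \<times> x :: (nat \<times> 'v) set)"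
        using x by (intro inj_on_to_nat_on) auto
      from inj_on_image_eq_iff[OF this sub] h(3) have "{(n, z). z \<in> h n} = {(n, z). z \<in> h' n}" by blast
      then show "h = h'" by (auto simp: fun_eq_iff set_eq_iff)
    qed
  qed auto
  then have I: "|\<phi> ` ?L| \<le>o |elts \<kappa>|" using c by (rule ordLeq_transitive)
  obtain h where h: "h \<in> \<phi> ` ?L" "\<And>\<delta>. \<delta> \<in> ?L \<Longrightarrow> \<not> {\<beta> \<in> ?L. \<phi> \<beta> = h} \<subseteq> elts \<delta>"
    by (rule card_succ_union[OF inf I, of "\<lambda>h. {\<beta> \<in> ?L. \<phi> \<beta> = h}"]) auto
  obtain \<gamma> where \<gamma>: "\<gamma> \<in> ?L" "\<phi> \<gamma> = h" using h(1) by blast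
  have "\<exists>l. \<forall>n\<ge>l. D n \<beta> \<inter> x = D n \<gamma> \<inter> x" if \<beta>: "\<beta> \<in> ?L" "\<gamma> \<in> elts \<beta>" for \<beta>
  proof -
    have "vset (insert \<beta> (elts \<beta>)) \<in> ?L"
      by (rule Card_limit[OF Card_card_succ infinite_card_succ[OF inf] \<beta>(1)])
    from h(2)[OF this] obtain \<beta>' where \<beta>': "\<beta>' \<in> ?L" "\<phi> \<beta>' = h" "\<beta>' \<noteq> \<beta>" "\<beta>' \<notin> elts \<beta>" by auto
    then have "\<beta> \<in> elts \<beta>'"
      using Ord_linear[OF Ord_mem[OF Ord_card_succ \<beta>(1)] Ord_mem[OF Ord_card_succ \<beta>'(1)]] by blast
    then obtain l where l: "\<forall>n\<ge>l. insert \<beta> (D n \<beta>) \<subseteq> D n \<beta>'"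
      using covering_matrixD(4)[OF D \<beta>'(1)] by blast
    obtain l' where l': "\<forall>n\<ge>l'. insert \<gamma> (D n \<gamma>) \<subseteq> D n \<beta>"
      using covering_matrixD(4)[OF D \<beta>] by blast
    have "\<phi> \<beta>' = \<phi> \<gamma>" using \<beta>'(2) \<gamma>(2) by simp
    then have eq: "D n \<beta>' \<inter> x = D n \<gamma> \<inter> x" for n unfolding \<phi>_def by (rule fun_cong)
    have "D n \<beta> \<inter> x = D n \<gamma> \<inter> x" if "n \<ge> max l l'" for n
      using l[rule_format, of n] l'[rule_format, of n] eq[of n] that by auto
    then show ?thesis by blast
  qed
  with \<gamma>(1) show ?thesis by (rule that)
qed

subsection \<open>Singular cardinals of countable cofinality\<close>

definition seqs :: "'a set \<Rightarrow> (nat \<Rightarrow> 'a) set" where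
  "seqs A = {f. range f \<subseteq> A}"

lemma seqs_ordLeq:
  assumes "|A| \<le>o |B|"
  shows "|seqs A| \<le>o |seqs B|"
proof -
  obtain g where g: "inj_on g A" "g ` A \<subseteq> B" using assms by (rule card_ordLeqE)
  show ?thesis
  proof (rule card_of_ordLeqI[where f = "\<lambda>f. g \<circ> f"])
    show "inj_on (\<lambda>f. g \<circ> f) (seqs A)"
    proof (rule inj_onI, rule ext)
      fix f h n assume fh: "f \<in> seqs A" "h \<in> seqs A" "g \<circ> f = g \<circ> h"
      then have "g (f n) = g (h n)" by (metis o_apply)
      moreover have "f n \<in> A" "h n \<in> A" using fh by (auto simp: seqs_def)
      ultimately show "f n = h n" using g(1) by (simp add: inj_on_eq_iff)
    qed
    show "g \<circ> f \<in> seqs B" if "f \<in> seqs A" for f using that g(2) by (auto simp: seqs_def)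
  qed
qed

theorem card_succ_seqs:
  fixes \<kappa> :: "'v::zfc"
  assumes IGMP: "IGMP TYPE('v)" and \<kappa>: "Card \<kappa>" "infinite (elts \<kappa>)" "cf \<kappa> = omega"
    and c: "|Pow (UNIV :: nat set)| <o |elts \<kappa>|"
    and IH: "\<And>X :: 'v set. |X| <o |elts \<kappa>| \<Longrightarrow> |seqs X| \<le>o |elts (card_succ \<kappa>)|"
  shows "|seqs (elts (card_succ \<kappa>))| \<le>o |elts (card_succ \<kappa>)|"
proof -
  define \<mu> where "\<mu> = card_succ \<kappa>"
  let ?L = "elts \<mu>"
  let ?X = "H (card_succ \<mu>)"
  have o\<kappa>: "|elts (omega :: 'v)| <o |elts \<kappa>|"
    by (rule ordIso_ordLess_trans[OF omega_card ordLess_transitive[OF card_of_Pow c]])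
  have o1\<kappa>: "|elts (omega1 :: 'v)| \<le>o |elts \<kappa>|"
    using o\<kappa> unfolding omega1_def card_succ_ordLeq_iff .
  have \<kappa>L: "|elts \<kappa>| \<le>o |?L|" unfolding \<mu>_def by (rule ordLess_imp_ordLeq[OF card_succ_greater])
  have o1L: "|elts (omega1 :: 'v)| \<le>o |?L|" by (rule ordLeq_transitive[OF o1\<kappa> \<kappa>L])
  have infL: "infinite ?L" unfolding \<mu>_def by (rule infinite_card_succ[OF \<kappa>(2)])
  have Ord\<mu>: "Ord \<mu>" unfolding \<mu>_def by (rule Ord_card_succ)
  have OrdL: "Ord x" if "x \<in> ?L" for x using Ord_mem[OF Ord\<mu> that] .

  obtain D where D: "covering_matrix \<kappa> D" by (rule covering_matrix_exists[OF \<kappa> o\<kappa>])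
  note cmD = covering_matrixD[OF D, folded \<mu>_def]
  have DL: "D n \<gamma> \<subseteq> ?L" if "\<gamma> \<in> ?L" for n \<gamma> using cmD(1)[OF that] Ord_subset[OF Ord\<mu> that] by blast
  have "\<exists>\<gamma>\<in>?L. \<forall>\<beta>\<in>?L. \<gamma> \<in> elts \<beta> \<longrightarrow> (\<exists>l. \<forall>n\<ge>l. D n \<beta> \<inter> elts x = D n \<gamma> \<inter> elts x)"
    if "countable (elts x)" for x
    by (rule covering_matrix_trace[OF D \<kappa>(2) ordLess_imp_ordLeq[OF c] that, folded \<mu>_def]) blast
  then obtain tr where tr: "\<And>x. countable (elts x) \<Longrightarrow> tr x \<in> ?L"
    "\<And>x \<beta>. countable (elts x) \<Longrightarrow> \<beta> \<in> ?L \<Longrightarrow> tr x \<in> elts \<beta> \<Longrightarrow>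
       \<exists>l. \<forall>n\<ge>l. D n \<beta> \<inter> elts x = D n (tr x) \<inter> elts x" by metis

  obtain p0 where p0: "inj_on p0 (?L \<times> ?L)" "p0 ` (?L \<times> ?L) \<subseteq> ?L"
    by (rule card_ordLeqE[OF ordIso_imp_ordLeq[OF card_of_Times_same_infinite[OF infL]]])
  define p where "p x y = p0 (x, y)" for x y
  define q where "q = inv_into (?L \<times> ?L) p0"
  define dec where "dec x = (\<Union>s\<in>elts x. range (\<lambda>k. snd (q (((fst \<circ> q) ^^ k) s)))) \<inter> ?L" for x
  define \<iota> where "\<iota> x = (SOME i. inj_on i (elts (omega1 :: 'v)) \<and> i ` elts (omega1 :: 'v) \<subseteq> elts x)" for x :: 'v
  define uncov where "uncov x X \<longleftrightarrow> countable X \<and> X \<subseteq> elts x \<inter> ?L \<and> \<not> (\<exists>n. \<exists>\<beta>\<in>?L. X \<subseteq> D n \<beta>)" for x X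
  \<comment> \<open>Besides the closure conditions of the locale, \<open>G\<close> reflects three
    facts: bounded sets have bounds in \<open>N\<close>, stable traces on countable sets are in
    \<open>N\<close>, and if \<open>x\<close> has an uncovered countable subset then one is in
    \<open>N\<close>. Applied to countable ordinals \<open>y\<close>, the elements
    \<open>\<iota> x y\<close> make an uncountable \<open>x\<close> meet \<open>N\<close>
    uncountably often.\<close>
  define G where "G x y = {p x y, vset (dec x), vset (insert x (elts y)), vset (elts x \<inter> elts y), tr x, \<iota> x y}
    \<union> (if countable (elts x) then elts x else {})
    \<union> witness (\<lambda>\<delta>. \<delta> \<in> ?L \<and> elts x \<inter> ?L \<subseteq> elts \<delta>)
    \<union> range (\<lambda>n. vset (D n (tr x) \<inter> elts x)) \<union> vset ` witness (uncov x)" for x y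
  have "countable (G x y)" for x y
    unfolding G_def by (intro countable_Un countable_image) auto
  then have G: "|G x y| \<le>o |elts (omega1 :: 'v)|" for x y by (rule countable_ordLeq_omega1)
  \<comment> \<open>The successor of \<mu> is included because guessing a subset of \<mu> requires
    its bound \<mu> to lie below an ordinal of \<open>N\<close>.\<close>
  define C where "C = elts (omega1 :: 'v) \<union> {\<mu>, vset (insert \<mu> ?L), vset {}}"
  have C: "|C| \<le>o |elts (omega1 :: 'v)|"
    unfolding C_def
    by (rule infinite_Un_ordLeq[OF infinite_omega1 card_of_mono1[OF subset_refl] countable_ordLeq_omega1]) simp
  obtain N :: 'v where N: "|elts N| \<le>o |elts (omega1 :: 'v)|" "elts N \<subseteq> ?X" "C \<inter> ?X \<subseteq> elts N"
    "\<forall>x\<in>elts N. \<forall>y\<in>elts N. G x y \<inter> ?X \<subseteq> elts N" "guessing (elts N)"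
    by (rule guessing_model[where G = G, OF IGMP o1L C G])

  have subX: "x \<in> ?X" if "elts x \<subseteq> ?L" for x
    by (rule mem_H_I[where A = ?L]) (use that Ord_subset[OF Ord\<mu>] in \<open>auto simp: ordLeq_refl\<close>)
  have LX: "?L \<subseteq> ?X" using subX Ord_subset[OF Ord\<mu>] by blast
  have vsub: "elts (vset Y) = Y" if "Y \<subseteq> ?L" for Y
    using that by (intro elts_vset) (rule small_subset[OF small_elts])
  have vsubX: "vset Y \<in> ?X" if "Y \<subseteq> ?L" for Y
    using that vsub subX by simp
  have closed: "z \<in> elts N" if "x \<in> elts N" "y \<in> elts N" "z \<in> G x y" "z \<in> ?X" for x y z
    using N(4) that by blast
  have \<mu>N: "\<mu> \<in> elts N" using N(3) subX[of \<mu>] unfolding C_def by blast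
  have succ\<mu>: "Ord (vset (insert \<mu> ?L))" using Ord_sup_ord[of "{\<mu>}"] Ord\<mu> by (simp add: sup_ord_def)
  have Int_small: "small (elts x \<inter> Y)" "small (Y \<inter> elts x)" for x :: 'v and Y
    by (rule small_subset[OF small_elts[of x]]; blast)+

  interpret guessing_submodel \<mu> "elts N" p q
  proof
    show "p x y \<in> ?L" if "x \<in> ?L" "y \<in> ?L" for x y using p0(2) that by (auto simp: p_def)
    then show "p x y \<in> elts N" if "x \<in> elts N" "y \<in> elts N" "x \<in> ?L" "y \<in> ?L" for x y
      using closed[of x y "p x y"] that LX unfolding G_def by blast
    show "q (p x y) = (x, y)" if "x \<in> ?L" "y \<in> ?L" for x y
      using p0(1) that by (simp add: p_def q_def)
    show "vset {} \<in> elts N" using N(3) vsubX[of "{}"] unfolding C_def by blast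
    show "vset ((\<Union>s\<in>elts x. range (\<lambda>k. snd (q (((fst \<circ> q) ^^ k) s)))) \<inter> ?L) \<in> elts N"
      if "x \<in> elts N" for x
      by (rule closed[OF that that, of "vset (dec x)", unfolded dec_def])
        (auto simp: G_def dec_def intro: vsubX)
    show "vset (insert x (elts y)) \<in> elts N" if "x \<in> elts N" "y \<in> elts N" for x y
    proof (rule closed[OF that])
      show "vset (insert x (elts y)) \<in> ?X"
        by (rule H_insert_Un[OF infL, of x y y]) (use that N(2) in auto)
    qed (simp add: G_def)
    show "vset (elts x \<inter> elts y) \<in> elts N" if "x \<in> elts N" "y \<in> elts N" for x y
    proof (rule closed[OF that])
      show "vset (elts x \<inter> elts y) \<in> ?X"
        by (rule H_insert_Un[OF infL, of x x x]) (use that N(2) Int_small in auto)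
    qed (simp add: G_def)
    show "elts x \<subseteq> elts N" if "x \<in> elts N" "countable (elts x)" for x
    proof
      fix z assume "z \<in> elts x"
      then show "z \<in> elts N"
        using closed[OF that(1,1), of z] H_transitive[of x _ z] that N(2) by (auto simp: G_def)
    qed
    show "uncountable (elts x \<inter> elts N)" if x: "x \<in> elts N" "uncountable (elts x)" for x
    proof -
      have "\<exists>i. inj_on i (elts (omega1 :: 'v)) \<and> i ` elts (omega1 :: 'v) \<subseteq> elts x"
        using x(2) unfolding uncountable_iff_omega1 card_of_ordLeq[symmetric] by simp
      then have i: "inj_on (\<iota> x) (elts (omega1 :: 'v))" "\<iota> x ` elts (omega1 :: 'v) \<subseteq> elts x"
        unfolding \<iota>_def by (metis (mono_tags, lifting) someI_ex)+
      have "\<iota> x \<alpha> \<in> elts N" if "\<alpha> \<in> elts (omega1 :: 'v)" for \<alpha>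
      proof (rule closed[OF x(1)])
        have "\<alpha> \<in> ?L" 
          unfolding \<mu>_def Card_mem_iff[OF Card_card_succ Ord_mem[OF Card_Ord[OF Card_omega1] that]]
          using ordLess_ordLeq_trans[OF Card_mem[OF Card_omega1 that] o1L] unfolding \<mu>_def .
        then show "\<alpha> \<in> elts N" using N(3) LX that unfolding C_def by blast
        show "\<iota> x \<alpha> \<in> G x \<alpha>" by (simp add: G_def)
        show "\<iota> x \<alpha> \<in> ?X" using H_transitive[of x _ "\<iota> x \<alpha>"] x(1) i(2) that N(2) by blast
      qed
      then have "\<iota> x ` elts (omega1 :: 'v) \<subseteq> elts x \<inter> elts N" using i(2) by blast
      then show ?thesis
        using uncountable_omega1 countable_subset countable_image_inj_on[OF _ i(1)] by metis
    qed
    show "\<exists>e\<in>elts N. elts e \<inter> elts N = d"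
      if "d \<subseteq> elts N" "d \<subseteq> ?L" "\<And>a. a \<in> elts N \<Longrightarrow> countable (elts a) \<Longrightarrow> vset (d \<inter> elts a) \<in> elts N" for d
    proof -
      have "vset (insert \<mu> ?L) \<in> ?X"
        by (rule H_insert_Un[OF infL, of \<mu> \<mu> \<mu>]) (use subX in auto)
      then have "vset (insert \<mu> ?L) \<in> elts N" using N(3) unfolding C_def by blast
      moreover have "\<forall>x\<in>d. Ord x" using that(2) OrdL by blast
      moreover have "\<mu> \<in> elts (vset (insert \<mu> ?L))" by simp
      ultimately show ?thesis
        using N(5)[unfolded guessing_def, rule_format, of d \<mu> "vset (insert \<mu> ?L)"] that succ\<mu> by simp
    qed
  qed (rule Ord\<mu>)
  have mem_L: "z \<in> elts N" if "x \<in> elts N" "y \<in> elts N" "z \<in> G x y" "z \<in> ?L" for x y z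
    using closed[OF that(1-3)] that(4) LX by blast
  have tr_mem: "tr x \<in> elts N" if "x \<in> elts N" "countable (elts x)" for x
    using mem_L[OF that(1,1), of "tr x"] tr(1)[OF that(2)] by (simp add: G_def)
  have trace_mem: "vset (D n (tr x) \<inter> elts x) \<in> elts N" if "x \<in> elts N" "countable (elts x)" for n x
  proof (rule closed[OF that(1,1)])
    show "vset (D n (tr x) \<inter> elts x) \<in> ?X"
      by (rule vsubX) (use DL[OF tr(1)[OF that(2)]] in blast)
  qed (simp add: G_def)
  have bound: "\<exists>\<delta>\<in>elts N \<inter> ?L. elts x \<inter> ?L \<subseteq> elts \<delta>"
    if x: "x \<in> elts N" and b: "\<delta> \<in> ?L" "elts x \<inter> ?L \<subseteq> elts \<delta>" for x \<delta>
  proof -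
    let ?Q = "\<lambda>\<delta>. \<delta> \<in> ?L \<and> elts x \<inter> ?L \<subseteq> elts \<delta>"
    obtain \<delta> where d: "\<delta> \<in> witness ?Q" "?Q \<delta>" using witness_I[of ?Q] b by blast
    then have "\<delta> \<in> elts N" by (intro mem_L[OF x x]) (auto simp: G_def)
    then show ?thesis using d(2) by blast
  qed
  have countable_bound: "\<exists>\<delta>\<in>elts N \<inter> ?L. x \<subseteq> elts \<delta>" if x: "countable x" "x \<subseteq> elts N" "x \<subseteq> ?L" for x
  proof -
    obtain y where y: "y \<in> elts N" "countable (elts y)" "elts y \<subseteq> ?L" "x \<subseteq> elts y"
      by (rule countable_cover[OF x])
    have "|elts y| \<le>o |elts \<kappa>|" by (rule ordLeq_transitive[OF countable_ordLeq_omega1[OF y(2)] o1\<kappa>])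
    then obtain \<delta> where "\<delta> \<in> ?L" "elts y \<subseteq> elts \<delta>"
      by (rule card_succ_bounded[OF y(3)[unfolded \<mu>_def] _ \<kappa>(2), folded \<mu>_def])
    then have "\<exists>\<delta>\<in>elts N \<inter> ?L. elts y \<inter> ?L \<subseteq> elts \<delta>" using bound[OF y(1)] by blast
    then show ?thesis using y(3,4) by blast
  qed
  have "|elts N \<inter> ?L| \<le>o |elts \<kappa>|"
    by (rule ordLeq_transitive[OF card_of_mono1[OF Int_lower1] ordLeq_transitive[OF N(1) o1\<kappa>]])
  then obtain \<delta> where \<delta>: "\<delta> \<in> ?L" "elts N \<inter> ?L \<subseteq> elts \<delta>"
    by (rule card_succ_bounded[OF Int_lower2[of "elts N" ?L, unfolded \<mu>_def] _ \<kappa>(2), folded \<mu>_def])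

  \<comment> \<open>Otherwise each \<open>k\<close> has a counterexample \<open>x k\<close> at a
    level \<open>n k \<ge> k\<close>. Cover all of them by one countable \<open>y\<close> in
    \<open>N\<close>. From some level \<open>l\<close> on, \<delta> and \<open>tr y\<close> have the
    same trace on \<open>y\<close>; since \<open>tr y\<close> is in \<open>N\<close>, so is the
    trace at level \<open>n l\<close>, and intersecting it with \<open>x l\<close> gives a
    contradiction.\<close>
  obtain n0 where n0: "\<And>n x. n \<ge> n0 \<Longrightarrow> x \<in> elts N \<Longrightarrow> countable (elts x) \<Longrightarrow> elts x \<subseteq> ?L \<Longrightarrow>
      vset (D n \<delta> \<inter> elts x) \<in> elts N"
  proof (rule ccontr)
    assume "\<not> thesis"
    then have "\<exists>n x. n \<ge> k \<and> x \<in> elts N \<and> countable (elts x) \<and> elts x \<subseteq> ?L \<and>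
      vset (D n \<delta> \<inter> elts x) \<notin> elts N" for k using that[of k] by blast
    then obtain n x where nx: "\<And>k. n k \<ge> k" "\<And>k. x k \<in> elts N" "\<And>k. countable (elts (x k))"
      "\<And>k. elts (x k) \<subseteq> ?L" "\<And>k. vset (D (n k) \<delta> \<inter> elts (x k)) \<notin> elts N" by metis
    obtain y where y: "y \<in> elts N" "countable (elts y)" "elts y \<subseteq> ?L" "(\<Union>k. elts (x k)) \<subseteq> elts y"
    proof (rule countable_cover)
      show "countable (\<Union>k. elts (x k))" using nx(3) by simp
      show "(\<Union>k. elts (x k)) \<subseteq> elts N" using countable_mem nx(2,3) by blast
      show "(\<Union>k. elts (x k)) \<subseteq> ?L" using nx(4) by blast
    qed
    have "tr y \<in> elts \<delta>" using tr(1)[OF y(2)] tr_mem[OF y(1,2)] \<delta>(2) by blast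
    then obtain l where l: "\<forall>n\<ge>l. D n \<delta> \<inter> elts y = D n (tr y) \<inter> elts y"
      using tr(2)[OF y(2) \<delta>(1)] by blast
    have "vset (elts (vset (D (n l) (tr y) \<inter> elts y)) \<inter> elts (x l)) \<in> elts N"
      by (rule Int_mem[OF trace_mem[OF y(1,2)] nx(2)])
    also have "elts (vset (D (n l) (tr y) \<inter> elts y)) \<inter> elts (x l) = D (n l) \<delta> \<inter> elts (x l)"
    proof -
      have "elts (x l) \<subseteq> elts y" using y(4) by blast
      moreover have "D (n l) \<delta> \<inter> elts y = D (n l) (tr y) \<inter> elts y" using l nx(1)[of l] by blast
      ultimately show ?thesis unfolding elts_vset[OF Int_small(2)] by blast
    qed
    finally show False using nx(5) by blast
  qed
  define d where "d n = D n \<delta> \<inter> elts N" for n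
  have dL: "d n \<subseteq> ?L" "d n \<subseteq> elts N" for n using DL[OF \<delta>(1)] by (auto simp: d_def)
  have guessed: "\<exists>e\<in>elts N. elts e \<inter> elts N = d n" if n: "n \<ge> n0" for n
  proof (rule guess[OF dL(2,1)])
    fix a assume a: "a \<in> elts N" "countable (elts a)"
    let ?a = "vset (elts a \<inter> ?L)"
    have ea: "elts ?a = elts a \<inter> ?L" by (rule vsub) blast
    have "?a \<in> elts N" by (rule Int_mem[OF a(1) \<mu>N])
    then have "vset (D n \<delta> \<inter> elts ?a) \<in> elts N" by (rule n0[OF n]) (use a(2) ea in auto)
    also have "D n \<delta> \<inter> elts ?a = d n \<inter> elts a"
      unfolding ea d_def using countable_mem[OF a] DL[OF \<delta>(1), of n] by blast
    finally show "vset (d n \<inter> elts a) \<in> elts N" .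
  qed
  \<comment> \<open>If every \<open>d n\<close> were bounded in \<open>N\<close>, countably many
    bounds would lie below one \<beta> in \<open>N\<close>. But \<beta> itself belongs to
    \<open>D n \<delta>\<close> for all large \<open>n\<close>.\<close>
  have "\<exists>n\<ge>n0. \<forall>\<beta>\<in>elts N \<inter> ?L. \<not> d n \<subseteq> elts \<beta>"
  proof (rule ccontr)
    assume "\<not> ?thesis"
    then have "\<forall>n. \<exists>\<beta>. n \<ge> n0 \<longrightarrow> \<beta> \<in> elts N \<inter> ?L \<and> d n \<subseteq> elts \<beta>" by blast
    then obtain b where b: "\<And>n. n \<ge> n0 \<Longrightarrow> b n \<in> elts N \<inter> ?L \<and> d n \<subseteq> elts (b n)" by metis
    have "\<exists>\<beta>\<in>elts N \<inter> ?L. b ` {n0..} \<subseteq> elts \<beta>"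
      by (rule countable_bound) (use b in auto)
    then obtain \<beta> where \<beta>: "\<beta> \<in> elts N" "\<beta> \<in> ?L" "b ` {n0..} \<subseteq> elts \<beta>" by blast
    have "\<beta> \<in> elts \<delta>" using \<beta> \<delta>(2) by blast
    then obtain l where l: "\<forall>n\<ge>l. insert \<beta> (D n \<beta>) \<subseteq> D n \<delta>" using cmD(4)[OF \<delta>(1)] by blast
    have "\<beta> \<in> d (max l n0)" using l \<beta>(1) by (auto simp: d_def)
    moreover have "d (max l n0) \<subseteq> elts (b (max l n0))" using b by simp
    moreover have "b (max l n0) \<in> elts \<beta>" using \<beta>(3) by auto
    ultimately show False using mem_asym by blast
  qed
  then obtain n where n: "n \<ge> n0" "\<And>\<beta>. \<beta> \<in> elts N \<Longrightarrow> \<beta> \<in> ?L \<Longrightarrow> \<not> d n \<subseteq> elts \<beta>" by blast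
  obtain e where e: "e \<in> elts N" "elts e \<inter> elts N = d n" using guessed[OF n(1)] by blast
  let ?e = "elts e \<inter> ?L"
  have de: "d n \<subseteq> ?e" using e(2) dL(1) by blast
  have unbounded: "\<not> ?e \<subseteq> elts \<gamma>" if g: "\<gamma> \<in> ?L" for \<gamma>
  proof
    assume "?e \<subseteq> elts \<gamma>"
    then obtain \<beta> where "\<beta> \<in> elts N \<inter> ?L" "?e \<subseteq> elts \<beta>" using bound[OF e(1) g] by blast
    then show False using n(2) de by blast
  qed
  \<comment> \<open>A counterexample could be chosen in \<open>N\<close>. Being countable it is a
    subset of \<open>N\<close>, hence of \<open>d n\<close>, and is covered by
    \<open>D n \<delta>\<close> after all, although \<delta> lies outside \<open>N\<close>.\<close>
  have covered: "\<exists>n. \<exists>\<beta>\<in>?L. X \<subseteq> D n \<beta>" if X: "countable X" "X \<subseteq> ?e" for X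
  proof (rule ccontr)
    assume "\<not> ?thesis"
    then have "uncov e X" using X by (auto simp: uncov_def)
    then obtain Y where Y: "Y \<in> witness (uncov e)" "uncov e Y"
      using witness_I[of "uncov e" X] by blast
    then have cY: "countable Y" "Y \<subseteq> ?e" "\<And>n \<beta>. \<beta> \<in> ?L \<Longrightarrow> \<not> Y \<subseteq> D n \<beta>" unfolding uncov_def by auto
    have eY: "elts (vset Y) = Y" using cY(2) by (intro vsub) blast
    have "vset Y \<in> elts N"
      by (rule closed[OF e(1,1)]) (use Y(1) cY(2) in \<open>auto simp: G_def intro!: vsubX\<close>)
    then have "Y \<subseteq> elts N" using countable_mem[of "vset Y"] cY(1) eY by simp
    then have "Y \<subseteq> d n" using cY(2) e(2) by blast
    then show False using cY(3)[OF \<delta>(1), of n] by (auto simp: d_def)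
  qed
  have "|?L| \<le>o |?e|"
  proof (rule ccontr)
    assume "\<not> ?thesis"
    then have "|?e| \<le>o |elts \<kappa>|" by (simp add: \<mu>_def ordLess_card_succ_iff)
    then obtain \<gamma> where "\<gamma> \<in> ?L" "?e \<subseteq> elts \<gamma>"
      by (rule card_succ_bounded[OF Int_lower2[of "elts e" ?L, unfolded \<mu>_def] _ \<kappa>(2), folded \<mu>_def])
    then show False using unbounded by blast
  qed
  then have "|seqs ?L| \<le>o |seqs ?e|" by (rule seqs_ordLeq)
  \<comment> \<open>A sequence in \<open>?e\<close> has countable range, hence stays inside a single
    \<open>D n \<beta>\<close>; these have size below \<kappa>, where \<open>IH\<close> counts the
    sequences.\<close>
  also have "|seqs ?e| \<le>o |\<Union>(n, \<beta>)\<in>UNIV \<times> ?L. seqs (D n \<beta>)|"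
  proof (rule card_of_mono1, rule subsetI)
    fix f assume "f \<in> seqs ?e"
    then have "range f \<subseteq> ?e" by (simp add: seqs_def)
    then obtain n \<beta> where "\<beta> \<in> ?L" "range f \<subseteq> D n \<beta>" using covered[of "range f"] by auto
    then show "f \<in> (\<Union>(n, \<beta>)\<in>UNIV \<times> ?L. seqs (D n \<beta>))" by (auto simp: seqs_def)
  qed
  also have "|\<Union>(n, \<beta>)\<in>UNIV \<times> ?L. seqs (D n \<beta>)| \<le>o |?L|"
  proof (rule card_of_UNION_ordLeq_infinite[OF infL])
    have "|UNIV :: nat set| \<le>o |?L|" using infL by (simp add: infinite_iff_card_of_nat)
    then show "|(UNIV :: nat set) \<times> ?L| \<le>o |?L|"
      using card_of_Times_infinite[OF infL, of "UNIV :: nat set"] ordIso_imp_ordLeq by blast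
    show "\<forall>i\<in>UNIV \<times> ?L. |case i of (n, \<beta>) \<Rightarrow> seqs (D n \<beta>)| \<le>o |?L|"
      using IH[folded \<mu>_def, OF cmD(2)] by auto
  qed
  finally show ?thesis unfolding \<mu>_def .
qed

subsection \<open>Singular cardinals of uncountable cofinality\<close>

text \<open>If \<open>g\<close> were unbounded, each \<open>j\<close> would be at most some
  \<open>g \<xi>\<close>. As \<open>f\<close> need not be monotone, \<open>f\<close> is bounded
  separately on the segment below \<open>g \<xi>\<close> (by \<open>B \<xi>\<close>, and these by
  \<open>B1\<close>) and at \<open>g \<xi>\<close> itself (by \<open>B2\<close>); together these
  bound the cofinal map \<open>f\<close>.\<close>

lemma cf_regular:
  assumes \<kappa>: "Ord \<kappa>" and \<alpha>: "\<alpha> \<in> elts (cf \<kappa>)" and g: "g ` elts \<alpha> \<subseteq> elts (cf \<kappa>)"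
  obtains \<beta> where "\<beta> \<in> elts (cf \<kappa>)" "g ` elts \<alpha> \<subseteq> elts \<beta>"
proof -
  note Ocf = Ord_cf[OF \<kappa>]
  obtain f where f: "cofinal_map f (cf \<kappa>) \<kappa>" using cf_cofinal[OF \<kappa>] by blast
  then have f\<kappa>: "f j \<in> elts \<kappa>" if "j \<in> elts (cf \<kappa>)" for j using that unfolding cofinal_map_def by blast
  have "\<exists>\<beta>\<in>elts (cf \<kappa>). g ` elts \<alpha> \<subseteq> elts \<beta>"
  proof (rule ccontr)
    assume neg: "\<not> ?thesis"
    have "\<exists>\<beta>\<in>elts \<kappa>. \<forall>j\<in>elts (g \<xi>). f j \<in> elts \<beta>" if "\<xi> \<in> elts \<alpha>" for \<xi>
    proof -
      have "g \<xi> \<in> elts (cf \<kappa>)" using g that by blast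
      moreover have "f ` elts (g \<xi>) \<subseteq> elts \<kappa>" using f\<kappa> Ord_trans[OF Ocf calculation] by blast
      ultimately show ?thesis using not_cofinal_bounded[OF \<kappa>] by metis
    qed
    then obtain B where B: "\<And>\<xi>. \<xi> \<in> elts \<alpha> \<Longrightarrow> B \<xi> \<in> elts \<kappa> \<and> (\<forall>j\<in>elts (g \<xi>). f j \<in> elts (B \<xi>))"
      by metis
    have "B ` elts \<alpha> \<subseteq> elts \<kappa>" using B by blast
    then obtain B1 where B1: "B1 \<in> elts \<kappa>" "\<And>\<xi>. \<xi> \<in> elts \<alpha> \<Longrightarrow> B \<xi> \<in> elts B1"
      using not_cofinal_bounded[OF \<kappa> \<alpha>] by metis
    have "(\<lambda>\<xi>. f (g \<xi>)) ` elts \<alpha> \<subseteq> elts \<kappa>" using f\<kappa> g by blast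
    then obtain B2 where B2: "B2 \<in> elts \<kappa>" "\<And>\<xi>. \<xi> \<in> elts \<alpha> \<Longrightarrow> f (g \<xi>) \<in> elts B2"
      using not_cofinal_bounded[OF \<kappa> \<alpha>] by metis
    have f12: "f j \<in> elts B1 \<or> f j \<in> elts B2" if j: "j \<in> elts (cf \<kappa>)" for j
    proof -
      obtain \<xi> where \<xi>: "\<xi> \<in> elts \<alpha>" "g \<xi> \<notin> elts j" using neg j by blast
      have "g \<xi> \<in> elts (cf \<kappa>)" using g \<xi>(1) by blast
      then have "j \<in> elts (g \<xi>) \<or> j = g \<xi>"
        using Ord_linear[OF Ord_mem[OF Ocf j] Ord_mem[OF Ocf]] \<xi>(2) by blast
      then show ?thesis
      proof
        assume "j \<in> elts (g \<xi>)"
        then have "f j \<in> elts (B \<xi>)" using B \<xi>(1) by blast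
        then show ?thesis using Ord_trans[OF Ord_mem[OF \<kappa> B1(1)] B1(2)[OF \<xi>(1)]] by blast
      next
        assume "j = g \<xi>"
        then show ?thesis using B2(2)[OF \<xi>(1)] by simp
      qed
    qed
    obtain B3 where B3: "B3 \<in> elts \<kappa>" "elts B1 \<subseteq> elts B3" "elts B2 \<subseteq> elts B3"
    proof (cases "elts B1 \<subseteq> elts B2")
      case False
      then have "elts B2 \<subseteq> elts B1"
        using Ord_linear[OF Ord_mem[OF \<kappa> B1(1)] Ord_mem[OF \<kappa> B2(1)]]
          Ord_subset[OF Ord_mem[OF \<kappa> B1(1)]] Ord_subset[OF Ord_mem[OF \<kappa> B2(1)]] by blast
      then show ?thesis using that[OF B1(1)] by blast
    qed (use that[OF B2(1)] in blast)
    obtain j where "j \<in> elts (cf \<kappa>)" "B3 \<in> elts (f j) \<or> B3 = f j"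
      using f B3(1) unfolding cofinal_map_def by blast
    moreover have "f j \<in> elts B3" if "j \<in> elts (cf \<kappa>)" for j using f12[OF that] B3 by blast
    ultimately show False using mem_asym mem_irrefl by metis
  qed
  then show ?thesis using that by blast
qed

text \<open>The setting of Silver's theorem as the induction provides it: \<open>b\<close> is a
  threshold beyond which powers with exponent \<open>cf \<kappa>\<close> are at most successors, and
  all values of \<open>f\<close> lie beyond it.\<close>

locale uncountable_cofinality =
  fixes \<kappa> b :: "'v::zfc" and f :: "'v \<Rightarrow> 'v"
  assumes \<kappa>: "Card \<kappa>" "infinite (elts \<kappa>)"
    and omega_cf: "omega \<in> elts (cf \<kappa>)"
    and f: "cofinal_map f (cf \<kappa>) \<kappa>"
    and b: "infinite (elts b)" "\<And>j. j \<in> elts (cf \<kappa>) \<Longrightarrow> elts b \<subseteq> elts (f j)"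
    and pow: "\<And>\<beta>. \<beta> \<in> elts \<kappa> \<Longrightarrow> elts b \<subseteq> elts \<beta> \<Longrightarrow> |Func (elts (cf \<kappa>)) (elts \<beta>)| \<le>o cardSuc |elts \<beta>|"
    and Pow_cf: "|Pow (elts (cf \<kappa>))| \<le>o |elts \<kappa>|"
begin

abbreviation "\<mu> \<equiv> elts (cf \<kappa>)"

lemma Ord_cf': "Ord (cf \<kappa>)" by (rule Ord_cf[OF Card_Ord[OF \<kappa>(1)]])

lemma Ord_mu: "i \<in> \<mu> \<Longrightarrow> Ord i" by (rule Ord_mem[OF Ord_cf'])

lemma f_mem: "j \<in> \<mu> \<Longrightarrow> f j \<in> elts \<kappa>" using f unfolding cofinal_map_def by blast

text \<open>By Neumer's theorem this is the usual notion of a stationary set, as long as \<open>0 \<notin> T\<close>.\<close>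

definition stat :: "'v set \<Rightarrow> bool" where
  "stat T \<longleftrightarrow> (\<forall>h. (\<forall>i\<in>T. h i \<in> elts i) \<longrightarrow> (\<exists>j. \<forall>i0\<in>\<mu>. \<exists>i\<in>T. i0 \<in> elts i \<and> h i = j))"

definition nonzero :: "'v set" where "nonzero = {i \<in> \<mu>. elts i \<noteq> {}}"

lemma max_mu:
  assumes "i \<in> \<mu>" "j \<in> \<mu>"
  obtains k where "k \<in> \<mu>" "\<forall>l. Ord l \<and> k \<in> elts l \<longrightarrow> i \<in> elts l \<and> j \<in> elts l"
proof -
  have le: "i \<in> elts j \<or> i = j \<or> j \<in> elts i"
    by (rule Ord_linear[OF Ord_mu[OF assms(1)] Ord_mu[OF assms(2)]])
  show ?thesis
  proof (cases "i \<in> elts j \<or> i = j")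
    case True
    have "i \<in> elts l \<and> j \<in> elts l" if "Ord l \<and> j \<in> elts l" for l
      using that True Ord_trans[of l j i] by metis
    then have "\<forall>l. Ord l \<and> j \<in> elts l \<longrightarrow> i \<in> elts l \<and> j \<in> elts l" by simp
    with assms(2) show ?thesis by (rule that)
  next
    case False
    then have ji: "j \<in> elts i" using le by blast
    have "i \<in> elts l \<and> j \<in> elts l" if "Ord l \<and> i \<in> elts l" for l
      using that ji Ord_trans[of l i j] by metis
    then have "\<forall>l. Ord l \<and> i \<in> elts l \<longrightarrow> i \<in> elts l \<and> j \<in> elts l" by simp
    with assms(1) show ?thesis by (rule that)
  qed
qed

lemma sequence_bounded:
  assumes "\<And>n :: nat. s n \<in> \<mu>"
  obtains \<beta> where "\<beta> \<in> \<mu>" "\<forall>n. s n \<in> elts \<beta>"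
proof -
  define g where "g i = s (to_nat_on (elts (omega :: 'v)) i)" for i :: 'v
  obtain \<beta> where \<beta>: "\<beta> \<in> \<mu>" "g ` elts omega \<subseteq> elts \<beta>"
    by (rule cf_regular[OF Card_Ord[OF \<kappa>(1)] omega_cf, of g]) (use assms in \<open>auto simp: g_def\<close>)
  have "s n \<in> elts \<beta>" for n
  proof -
    have "g (from_nat_into (elts omega) n) = s n"
      unfolding g_def by (simp add: to_nat_on_from_nat_into_infinite[OF countable_omega infinite_omega])
    moreover have "from_nat_into (elts (omega :: 'v)) n \<in> elts omega"
      by (rule from_nat_into[OF infinite_imp_nonempty[OF infinite_omega]])
    ultimately show ?thesis using subsetD[OF \<beta>(2) imageI] by metis
  qed
  with \<beta>(1) that show ?thesis by blast
qed

text \<open>If all fibres of a regressive function were bounded, the function could not be defined at a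
  closure point of the bounds.\<close>

lemma stat_nonzero: "stat nonzero"
  unfolding stat_def
proof (intro allI impI, rule ccontr)
  fix h assume h: "\<forall>i\<in>nonzero. h i \<in> elts i"
    and "\<not> (\<exists>j. \<forall>i0\<in>\<mu>. \<exists>i\<in>nonzero. i0 \<in> elts i \<and> h i = j)"
  then have "\<forall>j. \<exists>i0\<in>\<mu>. \<forall>i\<in>nonzero. i0 \<in> elts i \<longrightarrow> h i \<noteq> j" by blast
  then obtain B where B: "\<And>j. B j \<in> \<mu>" "\<And>j i. i \<in> nonzero \<Longrightarrow> B j \<in> elts i \<Longrightarrow> h i \<noteq> j" by metis
  have "\<exists>\<beta>\<in>\<mu>. \<alpha> \<in> elts \<beta> \<and> B ` elts \<alpha> \<subseteq> elts \<beta>" if \<alpha>: "\<alpha> \<in> \<mu>" for \<alpha>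
  proof -
    obtain \<beta> where \<beta>: "\<beta> \<in> \<mu>" "B ` elts \<alpha> \<subseteq> elts \<beta>"
      by (rule cf_regular[OF Card_Ord[OF \<kappa>(1)] \<alpha>, of B]) (use B(1) in auto)
    obtain k where k: "k \<in> \<mu>" "\<forall>l. Ord l \<and> k \<in> elts l \<longrightarrow> \<alpha> \<in> elts l \<and> \<beta> \<in> elts l"
      by (rule max_mu[OF \<alpha> \<beta>(1)])
    obtain \<gamma> where \<gamma>: "\<gamma> \<in> \<mu>" "k \<in> elts \<gamma>"
      by (rule sequence_bounded[of "\<lambda>_. k"]) (use k(1) in auto)
    have "\<alpha> \<in> elts \<gamma>" "\<beta> \<in> elts \<gamma>" using k(2) Ord_mu[OF \<gamma>(1)] \<gamma>(2) by auto
    then show ?thesis using \<beta>(2) Ord_subset[OF Ord_mu[OF \<gamma>(1)], of \<beta>] \<gamma>(1) by blast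
  qed
  then obtain C where C: "\<And>\<alpha>. \<alpha> \<in> \<mu> \<Longrightarrow> C \<alpha> \<in> \<mu> \<and> \<alpha> \<in> elts (C \<alpha>) \<and> B ` elts \<alpha> \<subseteq> elts (C \<alpha>)" by metis
  \<comment> \<open>The supremum \<alpha> of this sequence is closed under \<open>B\<close>, so
    \<open>B (h \<alpha>)\<close> lies below \<alpha>, against the choice of \<open>B\<close>.
    Starting at \<open>omega\<close> keeps \<alpha> nonzero, and uncountable cofinality keeps it
    below \<open>cf \<kappa>\<close>.\<close>
  define s where "s = rec_nat omega (\<lambda>_. C)"
  have s: "s 0 = omega" "\<And>n. s (Suc n) = C (s n)" by (simp_all add: s_def)
  have s\<mu>: "s n \<in> \<mu>" for n by (induction n) (use C omega_cf in \<open>auto simp: s\<close>)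
  obtain \<beta> where \<beta>: "\<beta> \<in> \<mu>" "\<forall>n. s n \<in> elts \<beta>" by (rule sequence_bounded[OF s\<mu>])
  have sm: "small (range s)" by (rule small_subset[OF small_elts[of \<beta>]]) (use \<beta>(2) in auto)
  define \<alpha> where "\<alpha> = sup_ord (range s)"
  have Oa: "Ord \<alpha>" unfolding \<alpha>_def by (rule Ord_sup_ord[OF sm]) (use s\<mu> Ord_mu in auto)
  have e\<alpha>: "elts \<alpha> = (\<Union>n. elts (s n))"
  proof -
    have "insert (s n) (elts (s n)) \<subseteq> elts (s n) \<union> elts (s (Suc n))" for n
      using C[OF s\<mu>[of n]] s(2)[of n] by simp
    then show ?thesis unfolding \<alpha>_def elts_sup_ord[OF sm] by blast
  qed
  have "elts \<alpha> \<subseteq> elts \<beta>" unfolding e\<alpha> using Ord_subset[OF Ord_mu[OF \<beta>(1)]] \<beta>(2) by blast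
  then have "\<alpha> \<in> \<mu>"
    using Ord_subset_iff[OF Oa Ord_mu[OF \<beta>(1)]] \<beta>(1) Ord_trans[OF Ord_cf' \<beta>(1)] by blast
  moreover have "elts \<alpha> \<noteq> {}"
  proof -
    have "elts (s 0) \<noteq> {}" unfolding s(1) by (rule infinite_imp_nonempty[OF infinite_omega])
    then show ?thesis unfolding e\<alpha> by blast
  qed
  ultimately have nz: "\<alpha> \<in> nonzero" by (simp add: nonzero_def)
  then have "h \<alpha> \<in> elts \<alpha>" using h by blast
  then obtain n where "h \<alpha> \<in> elts (s n)" unfolding e\<alpha> by blast
  then have "B (h \<alpha>) \<in> elts (s (Suc n))" using C[OF s\<mu>[of n]] s(2) by auto
  then have "B (h \<alpha>) \<in> elts \<alpha>" unfolding e\<alpha> by blast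
  then show False using B(2)[OF nz] by blast
qed

lemma not_statE:
  assumes "\<not> stat T"
  obtains h where "\<forall>i\<in>T. h i \<in> elts i" "\<forall>j. \<exists>i0\<in>\<mu>. \<forall>i\<in>T. i0 \<in> elts i \<longrightarrow> h i \<noteq> j"
  using assms unfolding stat_def by auto

text \<open>Two regressive functions with bounded fibres are glued to one on the union; each fibre
  stays below the larger of its two bounds.\<close>

lemma stat_Un:
  assumes "stat (S \<union> T)" "S \<subseteq> \<mu>" "T \<subseteq> \<mu>"
  shows "stat S \<or> stat T"
proof (rule ccontr)
  assume *: "\<not> ?thesis"
  obtain h1 where h1: "\<forall>i\<in>S. h1 i \<in> elts i" "\<forall>j. \<exists>i0\<in>\<mu>. \<forall>i\<in>S. i0 \<in> elts i \<longrightarrow> h1 i \<noteq> j"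
    by (rule not_statE[of S]) (use * in auto)
  obtain h2 where h2: "\<forall>i\<in>T. h2 i \<in> elts i" "\<forall>j. \<exists>i0\<in>\<mu>. \<forall>i\<in>T. i0 \<in> elts i \<longrightarrow> h2 i \<noteq> j"
    by (rule not_statE[of T]) (use * in auto)
  define h where "h i = (if i \<in> S then h1 i else h2 i)" for i
  have "\<forall>i\<in>S \<union> T. h i \<in> elts i" using h1(1) h2(1) by (auto simp: h_def)
  then obtain j where j: "\<forall>i0\<in>\<mu>. \<exists>i\<in>S \<union> T. i0 \<in> elts i \<and> h i = j"
    using assms(1)[unfolded stat_def, rule_format, of h] by auto
  obtain i1 where i1: "i1 \<in> \<mu>" "\<forall>i\<in>S. i1 \<in> elts i \<longrightarrow> h1 i \<noteq> j" using h1(2) by blast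
  obtain i2 where i2: "i2 \<in> \<mu>" "\<forall>i\<in>T. i2 \<in> elts i \<longrightarrow> h2 i \<noteq> j" using h2(2) by blast
  obtain k where k: "k \<in> \<mu>" "\<forall>l. Ord l \<and> k \<in> elts l \<longrightarrow> i1 \<in> elts l \<and> i2 \<in> elts l"
    by (rule max_mu[OF i1(1) i2(1)])
  obtain i where i: "i \<in> S \<union> T" "k \<in> elts i" "h i = j" using j k(1) by blast
  have "Ord i" using i(1) assms(2,3) Ord_mu by blast
  then have "i1 \<in> elts i" "i2 \<in> elts i" using k(2) i(2) by auto
  then show False using i i1(2) i2(2) unfolding h_def by (cases "i \<in> S") auto
qed

text \<open>Only indices strictly below \<open>i\<close> enter, so that choosing an index for an
  element of \<open>K i\<close> is regressive in \<open>i\<close>.\<close>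

definition K :: "'v \<Rightarrow> 'v set" where "K i = (\<Union>j\<in>elts i. elts (f j))"

lemma small_K: "small (K i)"
  unfolding K_def by (rule small_Union) simp_all

lemma b_subset_K: "i \<in> nonzero \<Longrightarrow> elts b \<subseteq> K i"
  using b(2) Ord_trans[OF Ord_cf', of i] unfolding K_def nonzero_def by blast

text \<open>As \<open>i\<close> is below the cofinality, \<open>f\<close> is bounded on it. So
  \<open>K i\<close> is an ordinal below \<kappa> containing \<open>b\<close>, to which
  \<open>pow\<close> applies.\<close>

lemma Func_K_ordLeq:
  assumes i: "i \<in> nonzero"
  shows "|Func \<mu> (K i)| \<le>o cardSuc |K i|"
proof -
  have i\<mu>: "i \<in> \<mu>" using i by (simp add: nonzero_def)
  have sub: "elts i \<subseteq> \<mu>" by (rule Ord_subset[OF Ord_cf' i\<mu>])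
  define k where "k = vset (K i)"
  have ek: "elts k = K i" unfolding k_def by (rule elts_vset[OF small_K])
  have Of: "Ord (f j)" if "j \<in> elts i" for j
    using f_mem sub that Ord_mem[OF Card_Ord[OF \<kappa>(1)]] by blast
  have Ok: "Ord k"
  proof (rule OrdI)
    fix z assume "z \<in> elts k"
    then obtain j where j: "j \<in> elts i" "z \<in> elts (f j)" unfolding ek K_def by blast
    show "Ord z" by (rule Ord_mem[OF Of[OF j(1)] j(2)])
    show "elts z \<subseteq> elts k" unfolding ek K_def using Ord_subset[OF Of[OF j(1)] j(2)] j(1) by blast
  qed
  have "f ` elts i \<subseteq> elts \<kappa>" using f_mem sub by blast
  then obtain \<beta> where \<beta>: "\<beta> \<in> elts \<kappa>" "\<And>j. j \<in> elts i \<Longrightarrow> f j \<in> elts \<beta>"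
    using not_cofinal_bounded[OF Card_Ord[OF \<kappa>(1)] i\<mu>] by metis
  have O\<beta>: "Ord \<beta>" using \<beta>(1) Ord_mem[OF Card_Ord[OF \<kappa>(1)]] by blast
  have "elts k \<subseteq> elts \<beta>" unfolding ek K_def using \<beta>(2) Ord_subset[OF O\<beta>] by blast
  then have "|elts k| <o |elts \<kappa>|"
    using ordLeq_ordLess_trans[OF card_of_mono1 Card_mem[OF \<kappa>(1) \<beta>(1)]] by blast
  then have "k \<in> elts \<kappa>" using Card_mem_iff[OF \<kappa>(1) Ok] by blast
  then show ?thesis using pow[of k] b_subset_K[OF i] unfolding ek by blast
qed

text \<open>These truncations form the eventually different family: they agree with \<open>x\<close>
  where its argument is below \<open>i\<close> and its value is in \<open>K i\<close>, and take a
  fixed default in \<open>b\<close> elsewhere.\<close>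

definition t :: "'v \<Rightarrow> ('v \<Rightarrow> 'v) \<Rightarrow> 'v \<Rightarrow> 'v" where
  "t i x = (\<lambda>j. if j \<in> \<mu> then if j \<in> elts i \<and> x j \<in> K i then x j else (SOME z. z \<in> elts b) else undefined)"

lemma some_b: "(SOME z. z \<in> elts b) \<in> elts b"
  using infinite_imp_nonempty[OF b(1)] some_in_eq by auto

lemma t_mem: "i \<in> nonzero \<Longrightarrow> t i x \<in> Func \<mu> (K i)"
  unfolding Func_def t_def using some_b b_subset_K by auto

lemma t_eventually_neq:
  assumes x: "x \<in> Func \<mu> (elts \<kappa>)" and y: "y \<in> Func \<mu> (elts \<kappa>)" and "x \<noteq> y"
  obtains i0 where "i0 \<in> \<mu>" "\<forall>i\<in>\<mu>. i0 \<in> elts i \<longrightarrow> t i x \<noteq> t i y"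
proof -
  have "\<exists>j. x j \<noteq> y j" using \<open>x \<noteq> y\<close> by (simp add: fun_eq_iff)
  then obtain j where j: "x j \<noteq> y j" by blast
  then have j\<mu>: "j \<in> \<mu>" using x y unfolding Func_def by (cases "j \<in> \<mu>") auto
  have xy: "x j \<in> elts \<kappa>" "y j \<in> elts \<kappa>" using x y j\<mu> unfolding Func_def by auto
  obtain j1 where j1: "j1 \<in> \<mu>" "x j \<in> elts (f j1)" by (rule cofinal_strict[OF \<kappa> f xy(1)])
  obtain j2 where j2: "j2 \<in> \<mu>" "y j \<in> elts (f j2)" by (rule cofinal_strict[OF \<kappa> f xy(2)])
  obtain k where k: "k \<in> \<mu>" "\<forall>l. Ord l \<and> k \<in> elts l \<longrightarrow> j1 \<in> elts l \<and> j2 \<in> elts l"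
    by (rule max_mu[OF j1(1) j2(1)])
  obtain k' where k': "k' \<in> \<mu>" "\<forall>l. Ord l \<and> k' \<in> elts l \<longrightarrow> j \<in> elts l \<and> k \<in> elts l"
    by (rule max_mu[OF j\<mu> k(1)])
  show ?thesis
  proof (rule that[OF k'(1)], intro ballI impI notI)
    fix i assume i: "i \<in> \<mu>" "k' \<in> elts i" and eq: "t i x = t i y"
    have "j \<in> elts i" "j1 \<in> elts i" "j2 \<in> elts i" using k(2) k'(2) Ord_mu[OF i(1)] i(2) by auto
    then have "t i x j = x j" "t i y j = y j" using j1(2) j2(2) j\<mu> by (auto simp: t_def K_def)
    then show False using j eq by simp
  qed
qed

text \<open>\<open>|Func \<mu> (K i)|\<close> is a well-order of minimal type, at most the successor
  of \<open>|K i|\<close>, so each of its initial segments has at most \<open>|K i|\<close>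
  elements.\<close>

definition le :: "'v \<Rightarrow> ('v \<Rightarrow> 'v) \<Rightarrow> ('v \<Rightarrow> 'v) \<Rightarrow> bool" where
  "le i x y \<longleftrightarrow> (t i x, t i y) \<in> |Func \<mu> (K i)|"

lemma le_total: "i \<in> nonzero \<Longrightarrow> le i x y \<or> le i y x"
proof -
  assume i: "i \<in> nonzero"
  have "well_order_on (Func \<mu> (K i)) |Func \<mu> (K i)|" by (rule card_of_well_order_on)
  then have "total_on (Func \<mu> (K i)) |Func \<mu> (K i)|" "refl_on (Func \<mu> (K i)) |Func \<mu> (K i)|"
    unfolding well_order_on_def linear_order_on_def partial_order_on_def preorder_on_def by auto
  then show ?thesis
    using t_mem[OF i, of x] t_mem[OF i, of y] unfolding le_def total_on_def refl_on_def by metis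
qed

lemma segment_ordLeq:
  assumes i: "i \<in> nonzero" and a: "a \<in> Func \<mu> (K i)"
  shows "|{c. (c, a) \<in> |Func \<mu> (K i)| }| \<le>o |K i|"
proof -
  let ?r = "|Func \<mu> (K i)|"
  have inf: "infinite (K i)" using b_subset_K[OF i] b(1) infinite_super by blast
  have "|Order_Relation.underS ?r a| <o ?r" by (rule card_of_underS) (use a in simp_all)
  then have "|Order_Relation.underS ?r a| <o cardSuc |K i|"
    using Func_K_ordLeq[OF i] by (rule ordLess_ordLeq_trans)
  then have "|Order_Relation.underS ?r a| \<le>o |K i|" by (simp only: ordLess_cardSuc_iff)
  then have "|Order_Relation.underS ?r a \<union> {a}| \<le>o |K i|"
    by (intro infinite_Un_ordLeq inf singleton_ordLeq_infinite)
  moreover have "{c. (c, a) \<in> ?r} \<subseteq> Order_Relation.underS ?r a \<union> {a}"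
    by (auto simp: Order_Relation.underS_def)
  ultimately show ?thesis using card_of_mono1 ordLeq_transitive by blast
qed

definition below :: "('v \<Rightarrow> 'v) \<Rightarrow> ('v \<Rightarrow> 'v) set" where
  "below y = {x \<in> Func \<mu> (elts \<kappa>). stat {i \<in> nonzero. le i x y}}"

text \<open>On a stationary set the segment below \<open>t i y\<close> places \<open>t i x\<close>
  in \<open>K i\<close>, hence in some \<open>f (h i)\<close> with \<open>h\<close> regressive. On
  an unbounded \<open>S\<close> the value of \<open>h\<close> is a constant \<open>j\<close>, so
  \<open>S\<close> and a function into \<open>f j\<close> record \<open>t i x\<close> for all
  \<open>i\<close> in \<open>S\<close>, which determines \<open>x\<close>. There are at most
  \<kappa> such codes.\<close>

lemma below_ordLeq:
  assumes y: "y \<in> Func \<mu> (elts \<kappa>)"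
  shows "|below y| \<le>o |elts \<kappa>|"
proof -
  let ?seg = "\<lambda>i. {c. (c, t i y) \<in> |Func \<mu> (K i)| }"
  have "\<exists>e. inj_on e (?seg i) \<and> e ` ?seg i \<subseteq> K i" if "i \<in> nonzero" for i
    by (rule card_ordLeqE[OF segment_ordLeq[OF that t_mem[OF that]]]) (intro exI conjI)
  then obtain e where e: "\<And>i. i \<in> nonzero \<Longrightarrow> inj_on (e i) (?seg i) \<and> e i ` ?seg i \<subseteq> K i" by metis
  define code where "code x c \<longleftrightarrow> (case c of (j, S, u) \<Rightarrow> j \<in> \<mu> \<and> S \<subseteq> {i \<in> nonzero. le i x y} \<and>
      (\<forall>i0\<in>\<mu>. \<exists>i\<in>S. i0 \<in> elts i) \<and> u \<in> Func \<mu> (elts (f j)) \<and> (\<forall>i\<in>S. u i = e i (t i x)))"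
    for x and c :: "'v \<times> 'v set \<times> ('v \<Rightarrow> 'v)"
  have ex: "\<exists>c. code x c" if "x \<in> below y" for x
  proof -
    let ?T = "{i \<in> nonzero. le i x y}"
    have st: "stat ?T" using that by (simp add: below_def)
    have K: "e i (t i x) \<in> K i" if "i \<in> ?T" for i using e[of i] that by (auto simp: le_def)
    then have "\<exists>j\<in>elts i. e i (t i x) \<in> elts (f j)" if "i \<in> ?T" for i using that unfolding K_def by blast
    then obtain h where h: "\<And>i. i \<in> ?T \<Longrightarrow> h i \<in> elts i \<and> e i (t i x) \<in> elts (f (h i))" by metis
    then obtain j where j: "\<forall>i0\<in>\<mu>. \<exists>i\<in>?T. i0 \<in> elts i \<and> h i = j"
      using st[unfolded stat_def, rule_format, of h] by auto
    define S where "S = {i \<in> ?T. h i = j}"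
    define u where "u i = (if i \<in> \<mu> then if i \<in> S then e i (t i x) else (SOME z. z \<in> elts b) else undefined)" for i
    have S\<mu>: "S \<subseteq> \<mu>" by (auto simp: S_def nonzero_def)
    obtain i where i: "i \<in> S" using j omega_cf unfolding S_def by blast
    then have "j \<in> elts i" using h unfolding S_def by blast
    then have j\<mu>: "j \<in> \<mu>" using Ord_trans[OF Ord_cf', of i j] S\<mu> i by blast
    have "u \<in> Func \<mu> (elts (f j))"
      unfolding Func_def u_def using h some_b b(2)[OF j\<mu>] by (auto simp: S_def)
    moreover have "\<forall>i\<in>S. u i = e i (t i x)" using S\<mu> by (auto simp: u_def)
    ultimately have "code x (j, S, u)" unfolding code_def using j\<mu> j by (auto simp: S_def)
    then show ?thesis by blast
  qed
  have inj: "x = x'" if xx: "x \<in> below y" "x' \<in> below y" and c: "code x c" "code x' c" for x x' c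
  proof (rule ccontr)
    assume "x \<noteq> x'"
    obtain j S u where jSu: "c = (j, S, u)" by (cases c)
    obtain i0 where i0: "i0 \<in> \<mu>" "\<forall>i\<in>\<mu>. i0 \<in> elts i \<longrightarrow> t i x \<noteq> t i x'"
      by (rule t_eventually_neq[of x x']) (use xx \<open>x \<noteq> x'\<close> in \<open>auto simp: below_def\<close>)
    obtain i where i: "i \<in> S" "i0 \<in> elts i" using c(1) i0(1) unfolding code_def jSu by auto
    have le: "i \<in> nonzero" "le i x y" "le i x' y" using c i(1) unfolding code_def jSu by auto
    have "e i (t i x) = e i (t i x')" using c i(1) unfolding code_def jSu by auto
    then have "t i x = t i x'"
      using e[OF le(1)] le(2,3) unfolding le_def by (auto dest: inj_onD)
    then show False using i0(2) i(2) le(1) by (auto simp: nonzero_def)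
  qed
  let ?C = "SIGMA j : \<mu>. Pow \<mu> \<times> Func \<mu> (elts (f j))"
  have "|below y| \<le>o |?C|"
  proof (rule card_of_ordLeqI[where f = "\<lambda>x. SOME c. code x c"])
    have code: "code x (SOME c. code x c)" if "x \<in> below y" for x using ex[OF that] by (rule someI_ex)
    show "inj_on (\<lambda>x. SOME c. code x c) (below y)"
      by (rule inj_onI) (metis code inj)
    show "(SOME c. code x c) \<in> ?C" if "x \<in> below y" for x
      using code[OF that] unfolding code_def by (auto simp: nonzero_def)
  qed
  also have "|?C| \<le>o |elts \<kappa>|"
  proof (rule card_of_Sigma_ordLeq_infinite[OF \<kappa>(2)])
    show "|\<mu>| \<le>o |elts \<kappa>|"
      by (rule ordLeq_transitive[OF ordLess_imp_ordLeq[OF card_of_Pow] Pow_cf])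
    show "\<forall>j\<in>\<mu>. |Pow \<mu> \<times> Func \<mu> (elts (f j))| \<le>o |elts \<kappa>|"
    proof
      fix j assume j: "j \<in> \<mu>"
      have "|Func \<mu> (elts (f j))| \<le>o cardSuc |elts (f j)|" by (rule pow[OF f_mem[OF j] b(2)[OF j]])
      moreover have "cardSuc |elts (f j)| \<le>o |elts \<kappa>|"
        by (rule cardSuc_least) (simp_all add: Card_mem[OF \<kappa>(1) f_mem[OF j]])
      ultimately have "|Func \<mu> (elts (f j))| \<le>o |elts \<kappa>|" by (rule ordLeq_transitive)
      then show "|Pow \<mu> \<times> Func \<mu> (elts (f j))| \<le>o |elts \<kappa>|"
        by (intro card_of_Times_ordLeq_infinite_Field) (simp_all add: \<kappa>(2) Pow_cf)
    qed
  qed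
  finally show ?thesis .
qed

text \<open>Given more functions than \<open>card_succ \<kappa>\<close>, choose that many; some
  \<open>x\<close> is below none of them. As \<open>nonzero\<close> is stationary and
  \<open>le\<close> total, all of them are below \<open>x\<close>, too many for
  \<open>below_ordLeq\<close>.\<close>

theorem Func_ordLeq_card_succ: "|Func \<mu> (elts \<kappa>)| \<le>o |elts (card_succ \<kappa>)|"
proof (rule ccontr)
  let ?F = "Func \<mu> (elts \<kappa>)"
  let ?L = "elts (card_succ \<kappa>)"
  assume "\<not> ?thesis"
  then have lt: "|?L| <o |?F|" by simp
  obtain g where g: "inj_on g ?L" "g ` ?L \<subseteq> ?F" using ordLess_imp_ordLeq[OF lt] by (rule card_ordLeqE)
  have "|\<Union>y\<in>g ` ?L. below y| \<le>o |?L|"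
  proof (rule card_of_UNION_ordLeq_infinite[OF infinite_card_succ[OF \<kappa>(2)] card_of_image], rule ballI)
    fix y assume "y \<in> g ` ?L"
    then have "|below y| \<le>o |elts \<kappa>|" using g(2) by (intro below_ordLeq) blast
    then show "|below y| \<le>o |?L|" by (rule ordLeq_transitive[OF _ ordLess_imp_ordLeq[OF card_succ_greater]])
  qed
  from ordLeq_ordLess_trans[OF this lt] have "\<not> ?F \<subseteq> (\<Union>y\<in>g ` ?L. below y)"
    using card_of_mono1 not_ordLess_ordLeq by blast
  then obtain x where x: "x \<in> ?F" "\<And>y. y \<in> g ` ?L \<Longrightarrow> x \<notin> below y" by blast
  have "g ` ?L \<subseteq> below x"
  proof
    fix y assume y: "y \<in> g ` ?L"
    have "{i \<in> nonzero. le i x y} \<union> {i \<in> nonzero. le i y x} = nonzero" using le_total by blast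
    then have "stat {i \<in> nonzero. le i x y} \<or> stat {i \<in> nonzero. le i y x}"
      by (intro stat_Un) (use stat_nonzero in \<open>auto simp: nonzero_def\<close>)
    moreover have "\<not> stat {i \<in> nonzero. le i x y}" using x y by (auto simp: below_def)
    ultimately show "y \<in> below x" using g(2) y by (auto simp: below_def)
  qed
  then have "|g ` ?L| \<le>o |elts \<kappa>|" by (rule ordLeq_transitive[OF card_of_mono1 below_ordLeq[OF x(1)]])
  moreover have "|?L| \<le>o |g ` ?L|" by (rule card_of_ordLeqI[OF g(1)]) blast
  ultimately have "|?L| \<le>o |elts \<kappa>|" by (rule ordLeq_transitive[rotated])
  then show False using card_succ_greater[of \<kappa>] not_ordLess_ordLeq by blast
qed

end

subsection \<open>The singular cardinal hypothesis\<close>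

lemma Func_ordLeq_cong:
  assumes "|A| \<le>o |B|"
  shows "|Func I A| \<le>o |Func I B|"
  using cexp_mono1[OF assms, of "|I|"] by (simp add: cexp_def)

lemma Func_Pow_ordLeq:
  assumes I: "infinite I" and A: "|A| \<le>o |Pow I|"
  shows "|Func I A| \<le>o |Pow I|"
proof -
  have P: "|Pow I| =o ctwo ^c |I|" using card_of_Pow_Func by (simp add: cexp_def ctwo_def)
  have "|A| \<le>o ctwo ^c |I|" by (rule ordLeq_ordIso_trans[OF A P])
  then have "|A| ^c |I| \<le>o (ctwo ^c |I| ) ^c |I|" by (rule cexp_mono1) simp
  also have "(ctwo ^c |I| ) ^c |I| =o ctwo ^c |I|"
  proof (rule cexp_cprod_ordLeq)
    show "Cinfinite |I|" using I by (simp add: cinfinite_def)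
    then show "Cnotzero |I|" by (rule Cinfinite_Cnotzero)
  qed (simp_all add: Card_order_ctwo ordLeq_refl)
  also have "ctwo ^c |I| =o |Pow I|" by (rule ordIso_symmetric[OF P])
  finally show ?thesis by (simp add: cexp_def)
qed

text \<open>The upper bound of SCH at \<kappa>; the lower one comes from
  \<open>Koenig\<close>.\<close>

definition SCH_at :: "'v::zfc \<Rightarrow> bool" where
  "SCH_at \<kappa> \<longleftrightarrow> (singular \<kappa> \<and> |Pow (elts (cf \<kappa>))| <o |elts \<kappa>| \<longrightarrow>
     |Func (elts (cf \<kappa>)) (elts \<kappa>)| \<le>o |elts (card_succ \<kappa>)| )"

lemma cofinal_strict2:
  assumes "Card \<kappa>" "infinite (elts \<kappa>)" "cofinal_map f \<alpha> \<kappa>" "x \<in> elts \<kappa>" "y \<in> elts \<kappa>"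
  obtains \<gamma> where "\<gamma> \<in> elts \<alpha>" "x \<in> elts (f \<gamma>)" "y \<in> elts (f \<gamma>)"
proof -
  have Ox: "Ord x" and Oy: "Ord y" using assms Card_Ord Ord_mem by blast+
  have f: "Ord (f \<gamma>)" if "\<gamma> \<in> elts \<alpha>" for \<gamma>
    using assms(1,3) that unfolding cofinal_map_def by (blast intro: Ord_mem Card_Ord)
  from Ord_linear[OF Ox Oy] show ?thesis
  proof (elim disjE)
    assume "x \<in> elts y"
    moreover obtain \<gamma> where "\<gamma> \<in> elts \<alpha>" "y \<in> elts (f \<gamma>)" by (rule cofinal_strict[OF assms(1-3,5)])
    ultimately show ?thesis using that Ord_trans[OF f] by blast
  next
    assume "y \<in> elts x"
    moreover obtain \<gamma> where "\<gamma> \<in> elts \<alpha>" "x \<in> elts (f \<gamma>)" by (rule cofinal_strict[OF assms(1-4)])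
    ultimately show ?thesis using that Ord_trans[OF f] by blast
  next
    assume "x = y"
    moreover obtain \<gamma> where "\<gamma> \<in> elts \<alpha>" "x \<in> elts (f \<gamma>)" by (rule cofinal_strict[OF assms(1-4)])
    ultimately show ?thesis using that by blast
  qed
qed

text \<open>A function into \<beta> is determined by its truncations at the values of a cofinal map.
  Each truncation is bounded below \<beta>, and by \<open>small\<close> there are at most
  \<open>|elts \<beta>|\<close> bounded functions.\<close>

lemma Func_ordLeq_of_cofinal:
  fixes \<beta> :: "'v::zfc"
  assumes \<beta>: "Card \<beta>" "infinite (elts \<beta>)" and f: "cofinal_map f \<alpha> \<beta>"
    and small: "\<And>\<gamma>. \<gamma> \<in> elts \<beta> \<Longrightarrow> |Func I (elts \<gamma>)| \<le>o |elts \<beta>|"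
  shows "|Func I (elts \<beta>)| \<le>o |Func (elts \<alpha>) (elts \<beta>)|"
proof -
  let ?B = "\<Union>\<gamma>\<in>elts \<beta>. Func I (elts \<gamma>)"
  \<comment> \<open>The default \<open>f i\<close> is itself not below \<open>f i\<close>, so
    truncations take values in the successor of \<open>f i\<close>.\<close>
  define T where "T x = (\<lambda>i. if i \<in> elts \<alpha> then (\<lambda>j. if j \<in> I then if x j \<in> elts (f i) then x j else f i else undefined)
    else undefined)" for x :: "'a \<Rightarrow> 'v"
  have "|Func I (elts \<beta>)| \<le>o |Func (elts \<alpha>) ?B|"
  proof (rule card_of_ordLeqI[where f = T])
    show "inj_on T (Func I (elts \<beta>))"
    proof (rule inj_onI, rule ext, rule ccontr)
      fix x y j assume x: "x \<in> Func I (elts \<beta>)" and y: "y \<in> Func I (elts \<beta>)" and eq: "T x = T y" and ne: "x j \<noteq> y j"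
      have j: "j \<in> I" using x y ne unfolding Func_def by (cases "j \<in> I") auto
      have xy: "x j \<in> elts \<beta>" "y j \<in> elts \<beta>" using x y j unfolding Func_def by auto
      obtain i where i: "i \<in> elts \<alpha>" "x j \<in> elts (f i)" "y j \<in> elts (f i)"
        by (rule cofinal_strict2[OF \<beta> f xy])
      have "T x i j = T y i j" using eq by simp
      then show False using i j ne by (simp add: T_def)
    qed
    fix x assume "x \<in> Func I (elts \<beta>)"
    show "T x \<in> Func (elts \<alpha>) ?B"
    proof -
      have "T x i \<in> ?B" if i: "i \<in> elts \<alpha>" for i
      proof (rule UN_I)
        have "f i \<in> elts \<beta>" using f i unfolding cofinal_map_def by blast
        then show "vset (insert (f i) (elts (f i))) \<in> elts \<beta>" by (rule Card_limit[OF \<beta>])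
        show "T x i \<in> Func I (elts (vset (insert (f i) (elts (f i)))))"
          using i by (simp add: T_def Func_def)
      qed
      then show ?thesis by (simp add: Func_def T_def)
    qed
  qed
  also have "|Func (elts \<alpha>) ?B| \<le>o |Func (elts \<alpha>) (elts \<beta>)|"
    by (rule Func_ordLeq_cong, rule card_of_UNION_ordLeq_infinite[OF \<beta>(2)]) (use small in \<open>simp_all add: ordLeq_refl\<close>)
  finally show ?thesis .
qed

text \<open>Beyond \<open>2\<^sup>\<mu>\<close>, a non-cardinal reduces to a smaller ordinal of the
  same size. If \<mu> maps cofinally into a cardinal \<beta>, then \<beta> is singular and the
  exponent can be replaced by \<open>cf \<beta>\<close>, where \<open>SCH_at\<close> applies.
  Otherwise all functions are bounded and are counted by the induction hypothesis.\<close>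

lemma power_bound:
  fixes \<mu> \<beta> :: "'v::zfc"
  assumes \<mu>: "Ord \<mu>" "infinite (elts \<mu>)" and "Ord \<beta>"
    and SCH: "\<And>\<nu>. \<nu> \<in> elts \<beta> \<or> \<nu> = \<beta> \<Longrightarrow> SCH_at \<nu>"
  shows "|Func (elts \<mu>) (elts \<beta>)| \<le>o |Pow (elts \<mu>)| \<or> |Func (elts \<mu>) (elts \<beta>)| \<le>o cardSuc |elts \<beta>|"
  using \<open>Ord \<beta>\<close> SCH
proof (induction \<beta> rule: Ord_induct)
  case (Ord \<beta>)
  have IH: "|Func (elts \<mu>) (elts \<gamma>)| \<le>o |Pow (elts \<mu>)| \<or> |Func (elts \<mu>) (elts \<gamma>)| \<le>o cardSuc |elts \<gamma>|"
    if "\<gamma> \<in> elts \<beta>" for \<gamma>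
    by (rule Ord.IH[OF that]) (use Ord.prems Ord_trans[OF Ord.hyps that] that in blast)
  show ?case
  proof (cases "|elts \<beta>| \<le>o |Pow (elts \<mu>)|")
    case True
    then show ?thesis using Func_Pow_ordLeq[OF \<mu>(2)] by blast
  next
    case False
    then have big: "|Pow (elts \<mu>)| <o |elts \<beta>|" by simp
    show ?thesis
    proof (cases "Card \<beta>")
      case False
      then obtain \<alpha> where \<alpha>: "\<alpha> \<in> elts \<beta>" "|elts \<beta>| \<le>o |elts \<alpha>|"
        using Ord.hyps unfolding Card_def by auto
      have *: "|Func (elts \<mu>) (elts \<beta>)| \<le>o |Func (elts \<mu>) (elts \<alpha>)|" by (rule Func_ordLeq_cong[OF \<alpha>(2)])
      have "|elts \<alpha>| \<le>o |elts \<beta>|" by (rule card_of_mono1[OF Ord_subset[OF Ord.hyps \<alpha>(1)]])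
      then have "cardSuc |elts \<alpha>| \<le>o cardSuc |elts \<beta>|" by (simp add: cardSuc_mono_ordLeq)
      then show ?thesis using IH[OF \<alpha>(1)] * ordLeq_transitive by metis
    next
      case True
      have "|elts \<mu>| <o |elts \<beta>|" by (rule ordLess_transitive[OF card_of_Pow big])
      then have inf: "infinite (elts \<beta>)" using \<mu>(2) card_of_ordLeq_infinite ordLess_imp_ordLeq by blast
      have small: "|Func (elts \<mu>) (elts \<gamma>)| \<le>o |elts \<beta>|" if g: "\<gamma> \<in> elts \<beta>" for \<gamma>
      proof -
        have "cardSuc |elts \<gamma>| \<le>o |elts \<beta>|" by (rule cardSuc_least) (simp_all add: Card_mem[OF True g])
        then show ?thesis using IH[OF g] big ordLess_imp_ordLeq ordLeq_transitive by metis
      qed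
      have suc: "|elts \<beta>| \<le>o cardSuc |elts \<beta>|" by (rule cardSuc_ordLeq) simp
      show ?thesis
      proof (cases "\<exists>h. cofinal_map h \<mu> \<beta>")
        case True': True
        then have sub: "elts (cf \<beta>) \<subseteq> elts \<mu>" using cf_min[OF Ord.hyps \<mu>(1)] by blast
        have "|elts (cf \<beta>)| <o |elts \<beta>|"
          by (rule ordLeq_ordLess_trans[OF card_of_mono1[OF sub] \<open>|elts \<mu>| <o |elts \<beta>|\<close>])
        then have "cf \<beta> \<in> elts \<beta>" by (simp add: Card_mem_iff[OF True Ord_cf[OF Ord.hyps]])
        then have "singular \<beta>" using True inf by (simp add: singular_def)
        moreover have "|Pow (elts (cf \<beta>))| <o |elts \<beta>|"
          by (rule ordLeq_ordLess_trans[OF card_of_mono1[OF Pow_mono[OF sub]] big])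
        ultimately have "|Func (elts (cf \<beta>)) (elts \<beta>)| \<le>o |elts (card_succ \<beta>)|"
          using Ord.prems[of \<beta>] by (simp add: SCH_at_def)
        then have "|Func (elts (cf \<beta>)) (elts \<beta>)| \<le>o cardSuc |elts \<beta>|"
          by (rule ordLeq_ordIso_trans[OF _ card_succ_cardSuc])
        moreover obtain f where "cofinal_map f (cf \<beta>) \<beta>" using cf_cofinal[OF Ord.hyps] by blast
        ultimately show ?thesis
          using ordLeq_transitive[OF Func_ordLeq_of_cofinal[OF True inf _ small]] by blast
      next
        case nc: False
        have "Func (elts \<mu>) (elts \<beta>) \<subseteq> (\<Union>\<gamma>\<in>elts \<beta>. Func (elts \<mu>) (elts \<gamma>))"
        proof
          fix x assume x: "x \<in> Func (elts \<mu>) (elts \<beta>)"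
          then have xb: "x ` elts \<mu> \<subseteq> elts \<beta>" by (auto simp: Func_def)
          then obtain \<gamma> where g: "\<gamma> \<in> elts \<beta>" "\<And>i. i \<in> elts \<mu> \<Longrightarrow> \<gamma> \<notin> elts (x i) \<and> \<gamma> \<noteq> x i"
            using nc unfolding cofinal_map_def by metis
          have "x i \<in> elts \<gamma>" if i: "i \<in> elts \<mu>" for i
            using g(2)[OF i] Ord_linear[OF Ord_mem[OF Ord.hyps g(1)] Ord_mem[OF Ord.hyps, of "x i"]] xb i by blast
          then have "x \<in> Func (elts \<mu>) (elts \<gamma>)" using x by (auto simp: Func_def)
          then show "x \<in> (\<Union>\<gamma>\<in>elts \<beta>. Func (elts \<mu>) (elts \<gamma>))" using g(1) by blast
        qed
        from card_of_mono1[OF this]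
        have "|Func (elts \<mu>) (elts \<beta>)| \<le>o |elts \<beta>|"
          by (rule ordLeq_transitive)
            (rule card_of_UNION_ordLeq_infinite[OF inf], use small in \<open>simp_all add: ordLeq_refl\<close>)
        then show ?thesis using suc ordLeq_transitive by blast
      qed
    qed
  qed
qed

lemma infinite_cf:
  assumes \<kappa>: "Card \<kappa>" "infinite (elts \<kappa>)"
  shows "infinite (elts (cf \<kappa>))"
proof
  assume fin: "finite (elts (cf \<kappa>))"
  obtain f where f: "cofinal_map f (cf \<kappa>) \<kappa>" using cf_cofinal[OF Card_Ord[OF \<kappa>(1)]] by blast
  have bd: "\<exists>\<beta>\<in>elts \<kappa>. S \<subseteq> elts \<beta>" if "finite S" "S \<subseteq> elts \<kappa>" for S
    using that
  proof (induction S rule: finite_induct)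
    case empty
    then show ?case using infinite_imp_nonempty[OF \<kappa>(2)] by blast
  next
    case (insert x S)
    then obtain \<beta> where \<beta>: "\<beta> \<in> elts \<kappa>" "S \<subseteq> elts \<beta>" by blast
    have "cofinal_map id \<kappa> \<kappa>" by (auto simp: cofinal_map_def)
    then obtain \<gamma> where g: "\<gamma> \<in> elts \<kappa>" "x \<in> elts (id \<gamma>)" "\<beta> \<in> elts (id \<gamma>)"
      by (rule cofinal_strict2[OF \<kappa> _ _ \<beta>(1), of id \<kappa> x]) (use insert.prems in auto)
    then have "S \<subseteq> elts \<gamma>" using Ord_subset[OF Ord_mem[OF Card_Ord[OF \<kappa>(1)] g(1)]] \<beta>(2) by fastforce
    then show ?case using g by auto
  qed
  have "f ` elts (cf \<kappa>) \<subseteq> elts \<kappa>" using f by (simp add: cofinal_map_def)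
  then obtain \<beta> where \<beta>: "\<beta> \<in> elts \<kappa>" "f ` elts (cf \<kappa>) \<subseteq> elts \<beta>"
    using bd[OF finite_imageI[OF fin]] by blast
  obtain j where "j \<in> elts (cf \<kappa>)" "\<beta> \<in> elts (f j)" by (rule cofinal_strict[OF \<kappa> f \<beta>(1)])
  then show False using \<beta>(2) mem_asym by blast
qed

text \<open>Diagonalisation: coordinate \<open>i\<close> avoids the values of the first
  \<open>f i\<close> listed functions, which are fewer than \<kappa>.\<close>

lemma Koenig:
  assumes \<kappa>: "Card \<kappa>" "infinite (elts \<kappa>)"
  shows "|elts \<kappa>| <o |Func (elts (cf \<kappa>)) (elts \<kappa>)|"
proof (rule ccontr)
  let ?F = "Func (elts (cf \<kappa>)) (elts \<kappa>)"
  assume "\<not> ?thesis"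
  then have le: "|?F| \<le>o |elts \<kappa>|" by simp
  have "?F \<noteq> {}" using infinite_imp_nonempty[OF \<kappa>(2)] by (simp add: Func_is_emp)
  then obtain g where g: "g ` elts \<kappa> = ?F" using le card_of_ordLeq2[of ?F "elts \<kappa>"] by auto
  obtain f where f: "cofinal_map f (cf \<kappa>) \<kappa>" using cf_cofinal[OF Card_Ord[OF \<kappa>(1)]] by blast
  have "\<exists>z\<in>elts \<kappa>. z \<notin> (\<lambda>\<alpha>. g \<alpha> i) ` elts (f i)" if i: "i \<in> elts (cf \<kappa>)" for i
  proof (rule ccontr)
    assume "\<not> ?thesis"
    then have "elts \<kappa> \<subseteq> (\<lambda>\<alpha>. g \<alpha> i) ` elts (f i)" by blast
    then have "|elts \<kappa>| \<le>o |elts (f i)|" by (rule surj_imp_ordLeq)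
    moreover have "f i \<in> elts \<kappa>" using f i by (auto simp: cofinal_map_def)
    ultimately show False using Card_mem[OF \<kappa>(1)] not_ordLess_ordLeq by blast
  qed
  then obtain z where z: "\<And>i. i \<in> elts (cf \<kappa>) \<Longrightarrow> z i \<in> elts \<kappa> \<and> z i \<notin> (\<lambda>\<alpha>. g \<alpha> i) ` elts (f i)" by metis
  define h where "h i = (if i \<in> elts (cf \<kappa>) then z i else undefined)" for i
  have "h \<in> ?F" using z by (simp add: Func_def h_def)
  then obtain \<alpha> where \<alpha>: "\<alpha> \<in> elts \<kappa>" "h = g \<alpha>" using g by blast
  obtain i where i: "i \<in> elts (cf \<kappa>)" "\<alpha> \<in> elts (f i)" by (rule cofinal_strict[OF \<kappa> f \<alpha>(1)])
  have "h i \<notin> (\<lambda>\<alpha>. g \<alpha> i) ` elts (f i)" using z[OF i(1)] i(1) by (simp add: h_def)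
  then show False using i(2) \<alpha>(2) by blast
qed

lemma ordinal_of_small_set:
  fixes X :: "'v::zfc set"
  assumes \<kappa>: "Card \<kappa>" and X: "|X| <o |elts (\<kappa> :: 'v)|"
  obtains \<alpha> where "\<alpha> \<in> elts \<kappa>" "|elts \<alpha>| =o |X|"
proof -
  have "small X" by (rule small_ordLeq[OF ordLess_imp_ordLeq[OF X] small_elts])
  then obtain x where x: "elts x = X" by (auto simp: small_def)
  obtain \<alpha> :: 'v where \<alpha>: "Ord \<alpha>" "|elts \<alpha>| =o |elts x|" by (rule ordinal_of_card)
  have "|elts \<alpha>| <o |elts \<kappa>|" by (rule ordIso_ordLess_trans[OF \<alpha>(2)]) (simp add: x X)
  then have "\<alpha> \<in> elts \<kappa>" by (simp add: Card_mem_iff[OF \<kappa> \<alpha>(1)])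
  then show ?thesis using that \<alpha>(2) x by simp
qed

lemma seqs_ordIso_Func: "|seqs X| =o |Func (elts (omega :: 'v::zfc)) X|"
proof -
  have 1: "|Func (UNIV :: nat set) X| =o |seqs X|" unfolding seqs_def by (rule card_of_Func_UNIV)
  have "|X| ^c |UNIV :: nat set| =o |X| ^c |elts (omega :: 'v)|"
    by (rule cexp_cong2[OF ordIso_symmetric[OF omega_card]]) simp_all
  then have "|Func (UNIV :: nat set) X| =o |Func (elts (omega :: 'v)) X|" by (simp add: cexp_def)
  with ordIso_symmetric[OF 1] show ?thesis by (rule ordIso_transitive)
qed

lemma SCH_at:
  fixes \<kappa> :: "'v::zfc"
  assumes "IGMP TYPE('v)"
  shows "SCH_at \<kappa>"
proof (induction \<kappa> rule: mem_induct)
  case (mem \<kappa>)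
  show ?case
    unfolding SCH_at_def
  proof (intro impI, elim conjE)
    assume "singular \<kappa>" and P\<kappa>: "|Pow (elts (cf \<kappa>))| <o |elts \<kappa>|"
    then have \<kappa>: "Card \<kappa>" "infinite (elts \<kappa>)" by (auto simp: singular_def)
    have O\<kappa>: "Ord \<kappa>" by (rule Card_Ord[OF \<kappa>(1)])
    have infcf: "infinite (elts (cf \<kappa>))" by (rule infinite_cf[OF \<kappa>])
    have pb: "|Func (elts (cf \<kappa>)) (elts \<beta>)| \<le>o |Pow (elts (cf \<kappa>))| \<or>
        |Func (elts (cf \<kappa>)) (elts \<beta>)| \<le>o cardSuc |elts \<beta>|" if "\<beta> \<in> elts \<kappa>" for \<beta>
      by (rule power_bound[OF Ord_cf[OF O\<kappa>] infcf Ord_mem[OF O\<kappa> that]])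
        (use mem Ord_trans[OF O\<kappa> that] that in blast)
    have "cf \<kappa> \<notin> elts omega" using infcf finite_mem_omega by blast
    then consider "cf \<kappa> = omega" | "omega \<in> elts (cf \<kappa>)" using Ord_linear[OF Ord_cf[OF O\<kappa>] Ord_omega] by blast
    then show "|Func (elts (cf \<kappa>)) (elts \<kappa>)| \<le>o |elts (card_succ \<kappa>)|"
    proof cases
      case 1
      have \<kappa>L: "|elts \<kappa>| \<le>o |elts (card_succ \<kappa>)|" by (rule ordLess_imp_ordLeq[OF card_succ_greater])
      \<comment> \<open>Sequences in the successor bound those in \<kappa>. For a set of size below
        \<kappa>, \<open>pb\<close> bounds the sequences by the continuum or by a successor, both at
        most \<kappa>.\<close>
      have "|seqs (elts (card_succ \<kappa>))| \<le>o |elts (card_succ \<kappa>)|"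
      proof (rule card_succ_seqs[OF assms \<kappa> 1])
        have P: "|Pow A| \<le>o |Pow B|" if "|A| \<le>o |B|" for A :: "'x set" and B :: "'y set"
        proof -
          obtain g where g: "inj_on g A" "g ` A \<subseteq> B" using \<open>|A| \<le>o |B|\<close> by (rule card_ordLeqE)
          show ?thesis
            by (rule card_of_ordLeqI[where f = "(`) g"]) (use g in \<open>auto intro: inj_on_image_Pow\<close>)
        qed
        show "|Pow (UNIV :: nat set)| <o |elts \<kappa>|"
          by (rule ordLeq_ordLess_trans[OF P P\<kappa>])
            (simp add: 1 ordIso_imp_ordLeq[OF ordIso_symmetric[OF omega_card]])
        show "|seqs X| \<le>o |elts (card_succ \<kappa>)|" if X: "|X| <o |elts \<kappa>|" for X :: "'v set"
        proof -
          obtain \<alpha> where \<alpha>: "\<alpha> \<in> elts \<kappa>" "|elts \<alpha>| =o |X|" by (rule ordinal_of_small_set[OF \<kappa>(1) X])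
          have "|seqs X| \<le>o |seqs (elts \<alpha>)|"
            by (rule seqs_ordLeq[OF ordIso_imp_ordLeq[OF ordIso_symmetric[OF \<alpha>(2)]]])
          also have "|seqs (elts \<alpha>)| =o |Func (elts (cf \<kappa>)) (elts \<alpha>)|" unfolding 1 by (rule seqs_ordIso_Func)
          also have "|Func (elts (cf \<kappa>)) (elts \<alpha>)| \<le>o |elts \<kappa>|"
          proof -
            have "cardSuc |elts \<alpha>| \<le>o |elts \<kappa>|" by (rule cardSuc_least) (simp_all add: Card_mem[OF \<kappa>(1) \<alpha>(1)])
            then show ?thesis using pb[OF \<alpha>(1)] ordLess_imp_ordLeq[OF P\<kappa>] ordLeq_transitive by metis
          qed
          also note \<kappa>L
          finally show ?thesis .
        qed
      qed
      moreover have "|Func (elts (cf \<kappa>)) (elts \<kappa>)| \<le>o |seqs (elts (card_succ \<kappa>))|"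
        unfolding 1
        by (rule ordLeq_ordIso_trans[OF Func_ordLeq_cong[OF \<kappa>L] ordIso_symmetric[OF seqs_ordIso_Func]])
      ultimately show ?thesis using ordLeq_transitive by blast
    next
      case 2
      obtain p where p: "elts p = {y. elts y \<subseteq> elts (cf \<kappa>)}" using powerset[of "cf \<kappa>"] by auto
      have pP: "|elts p| \<le>o |Pow (elts (cf \<kappa>))|"
        by (rule card_of_ordLeqI[where f = elts]) (auto simp: p inj_on_def intro: extensionality)
      have Pp: "|Pow (elts (cf \<kappa>))| \<le>o |elts p|" unfolding p by (rule ordLeq_Pow_elts)
      \<comment> \<open>\<open>b\<close> has the size of the power set of
        \<open>cf \<kappa>\<close>, so for \<beta> containing \<open>b\<close> the first alternative
        of \<open>pb\<close> is absorbed by the second.\<close>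
      obtain b where b: "b \<in> elts \<kappa>" "|elts b| =o |elts p|"
        by (rule ordinal_of_small_set[OF \<kappa>(1) ordLeq_ordLess_trans[OF pP P\<kappa>]])
      have Pb: "|Pow (elts (cf \<kappa>))| \<le>o |elts b|" by (rule ordLeq_ordIso_trans[OF Pp ordIso_symmetric[OF b(2)]])
      have infb: "infinite (elts b)" using card_of_ordLeq_infinite[OF Pb] infcf by simp
      obtain f0 where f0: "cofinal_map f0 (cf \<kappa>) \<kappa>" using cf_cofinal[OF O\<kappa>] by blast
      \<comment> \<open>The values below \<open>b\<close> are raised to \<open>b\<close>; none
        decreases, so the map stays cofinal.\<close>
      define f where "f j = (if elts b \<subseteq> elts (f0 j) then f0 j else b)" for j
      have f0\<kappa>: "f0 j \<in> elts \<kappa>" if "j \<in> elts (cf \<kappa>)" for j using f0 that by (auto simp: cofinal_map_def)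
      have "f ` elts (cf \<kappa>) \<subseteq> elts \<kappa>" using f0\<kappa> b(1) by (auto simp: f_def)
      moreover have "\<exists>\<gamma>\<in>elts (cf \<kappa>). \<beta> \<in> elts (f \<gamma>) \<or> \<beta> = f \<gamma>" if \<beta>: "\<beta> \<in> elts \<kappa>" for \<beta>
      proof -
        obtain j where j: "j \<in> elts (cf \<kappa>)" "\<beta> \<in> elts (f0 j)" by (rule cofinal_strict[OF \<kappa> f0 \<beta>])
        have Of: "Ord (f0 j)" "Ord b" using Ord_mem[OF O\<kappa>] f0\<kappa>[OF j(1)] b(1) by auto
        have "elts (f0 j) \<subseteq> elts (f j)"
          using Ord_linear[OF Of] Ord_subset[OF Of(1)] Ord_subset[OF Of(2)] by (auto simp: f_def)
        then show ?thesis using j by blast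
      qed
      ultimately have f: "cofinal_map f (cf \<kappa>) \<kappa>" by (simp add: cofinal_map_def)
      interpret uncountable_cofinality \<kappa> b f
      proof
        show "|Func (elts (cf \<kappa>)) (elts \<beta>)| \<le>o cardSuc |elts \<beta>|"
          if \<beta>: "\<beta> \<in> elts \<kappa>" "elts b \<subseteq> elts \<beta>" for \<beta>
        proof -
          have "|Pow (elts (cf \<kappa>))| \<le>o |elts \<beta>|" by (rule ordLeq_transitive[OF Pb card_of_mono1[OF \<beta>(2)]])
          also have "|elts \<beta>| \<le>o cardSuc |elts \<beta>|" by (rule cardSuc_ordLeq) simp
          finally show ?thesis using pb[OF \<beta>(1)] ordLeq_transitive by metis
        qed
      qed (use \<kappa> 2 f infb ordLess_imp_ordLeq[OF P\<kappa>] in \<open>auto simp: f_def\<close>)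
      show ?thesis by (rule Func_ordLeq_card_succ)
    qed
  qed
qed

theorem corollary3p5:
  assumes "IGMP TYPE('v::zfc)"
  shows "SCH TYPE('v)"
  unfolding SCH_def
proof (intro allI impI, elim conjE)
  fix \<kappa> :: 'v
  assume s: "singular \<kappa>" and c: "ctwo ^c |elts (cf \<kappa>)| <o |elts \<kappa>|"
  have \<kappa>: "Card \<kappa>" "infinite (elts \<kappa>)" using s by (auto simp: singular_def)
  have "|Pow (elts (cf \<kappa>))| =o ctwo ^c |elts (cf \<kappa>)|"
    using card_of_Pow_Func by (simp add: cexp_def ctwo_def)
  then have "|Pow (elts (cf \<kappa>))| <o |elts \<kappa>|" using c by (rule ordIso_ordLess_trans)
  then have "|Func (elts (cf \<kappa>)) (elts \<kappa>)| \<le>o |elts (card_succ \<kappa>)|"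
    using SCH_at[OF assms, of \<kappa>] s by (simp add: SCH_at_def)
  moreover have "|elts (card_succ \<kappa>)| \<le>o |Func (elts (cf \<kappa>)) (elts \<kappa>)|"
  proof -
    have "cardSuc |elts \<kappa>| \<le>o |Func (elts (cf \<kappa>)) (elts \<kappa>)|"
      by (rule cardSuc_least) (simp_all add: Koenig[OF \<kappa>])
    then show ?thesis by (rule ordIso_ordLeq_trans[OF card_succ_cardSuc])
  qed
  ultimately show "|elts \<kappa>| ^c |elts (cf \<kappa>)| =o |elts (card_succ \<kappa>)|"
    by (simp add: cexp_def ordIso_iff_ordLeq)
qed

end
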